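(* Let $q$ be a prime power and let $m,l,k$ be positive integers satisfying $3\le k\le\min\{m+1,l\}$. Let $w\in\{0,1\}$ and, for each $2\le r\le k-1$ and each positive divisor $u$ of $\gcd(r+1,l)$, let $w_{r,u}$ be an integer with $0\le w_{r,u}\le n_{r+1,u}^l$. Suppose there exists a $q$-PBD$(l,K,\lambda)$ admitting $H$ as an automorphism group, where $$\lambda=\sum_{r=2}^{k-1}\ \sum_{u\mid\gcd(r+1,l)} w_{r,u}\,\frac{(q^k-1)(q^k-q)\prod_{j=2}^{k-2}(q^{ml}-q^{jl})}{(q^{u}-1)\prod_{j=r+1}^{k-1}(q^k-q^j)}\;+\;w\,q^{(l-1)\left(\binom{k}{2}-1\right)}\prod_{j=2}^{k-1}\frac{q^{(m-j)l}-1}{q^{k-j}-1}.$$ Then there exists a $q$-PBD$(ml,K\cup\{k\},\lambda)$ admitting $G=\mathrm{GL}(m,q^l)$ as an automorphism group. If the original $q$-PBD$(l,K,\lambda)$ is simple, then the resulting $q$-PBD is also simple.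
   Context: Empty products equal $1$. A $q$-PBD$(v,K,\lambda)$ ($q$-analog of a pairwise balanced design, also called a $2$-$(v,K,\lambda)_q$ design) is a pair $(V,\mathcal B)$ where $V$ is a $v$-dimensional vector space over $\mathrm{GF}(q)$ and $\mathcal B$ is a collection, possibly with repetition, of subspaces of $V$ (blocks) with dimensions in $K$, such that every $2$-dimensional subspace of $V$ is contained in exactly $\lambda$ blocks. It is simple if there are no repeated blocks. It admits a subgroup of $\mathrm{GL}(V)$ as an automorphism group if every element of that subgroup maps $\mathcal B$ to itself. $H$ is a Singer cycle of $\mathrm{GF}(q^l)$: identifying $\mathrm{GF}(q)^l$ with $\mathrm{GF}(q^l)$, $H$ is the cyclic group of order $q^l-1$ of all multiplications by elements of $\mathrm{GF}(q^l)^*$. The group $G=\mathrm{GL}(m,q^l)$ acts on $\mathrm{GF}(q)^{ml}$, identified with $\mathrm{GF}(q^l)^m$, by $\mathrm{GF}(q^l)$-linear maps. For $u\mid\gcd(d,l)$, $$n_{d,u}^l=\frac{q^u-1}{q^l-1}\sum_{t:\,u\mid t\mid\gcd(d,l)}\mu(t/u)\begin{bmatrix} l/t\\ d/t\end{bmatrix}_{q^t},$$ where $\mu$ is the Möbius function and $\begin{bmatrix} a\\ b\end{bmatrix}_{Q}$ is the Gaussian binomial coefficient. It equals the number of $H$-orbits on the $d$-dimensional $\mathrm{GF}(q)$-subspaces of $\mathrm{GF}(q^l)$ for which the stabilizer in $H$ of a subspace in the orbit is isomorphic to $\mathrm{GF}(q^u)^*$. *)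

theory Defs
  imports
    "HOL-Analysis.Cartesian_Space"
    "HOL-Algebra.Bij"
    "HOL-Library.Multiset"
    "HOL-Computational_Algebra.Squarefree"
    "HOL-Number_Theory.Prime_Powers"
begin

definition moebius :: "nat \<Rightarrow> int"
  where "moebius n = (if squarefree n then (- 1) ^ card (prime_factors n) else 0)"

text \<open>The usual product formula; it is only meant for \<open>b \<le> a\<close> and \<open>Q > 1\<close>.\<close>

definition gauss_binomial :: "real \<Rightarrow> nat \<Rightarrow> nat \<Rightarrow> real"
  where "gauss_binomial Q a b = (\<Prod>i<b. (Q ^ (a - i) - 1) / (Q ^ (i + 1) - 1))"

definition orbit_number :: "nat \<Rightarrow> nat \<Rightarrow> nat \<Rightarrow> nat \<Rightarrow> real"
  where "orbit_number q l d u =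
    (real q ^ u - 1) / (real q ^ l - 1) *
      (\<Sum>t | u dvd t \<and> t dvd gcd d l.
         of_int (moebius (t div u)) * gauss_binomial (real q ^ t) (l div t) (d div t))"

text \<open>
  A vector space over a finite field is given by its scalar multiplication \<open>smul\<close>
  on the type \<open>'v\<close>, which is finite because only finite-dimensional spaces occur.
  The blocks form a multiset of subsets of \<open>'v\<close>.
\<close>

definition q_pbd ::
  "('a::{field,finite} \<Rightarrow> 'v::{ab_group_add,finite} \<Rightarrow> 'v) \<Rightarrow> nat \<Rightarrow> nat set \<Rightarrow> nat \<Rightarrow>
     'v set multiset \<Rightarrow> bool"
  where "q_pbd smul v K lam B \<longleftrightarrow>
    vector_space smul \<and>
    vector_space.dim smul UNIV = v \<and>
    (\<forall>S. S \<in># B \<longrightarrow> module.subspace smul S \<and> vector_space.dim smul S \<in> K) \<and>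
    (\<forall>T. module.subspace smul T \<and> vector_space.dim smul T = 2 \<longrightarrow>
       size {#S \<in># B. T \<subseteq> S#} = lam)"

definition simple_blocks :: "'v set multiset \<Rightarrow> bool"
  where "simple_blocks B \<longleftrightarrow> (\<forall>S. count B S \<le> 1)"

text \<open>
  The group \<open>\<Gamma>\<close> is a subgroup of the general linear group of the space, that is, a
  group of linear bijections; it has to preserve the blocks together with their
  multiplicities.
\<close>

definition admits_automorphism_group ::
  "('a::{field,finite} \<Rightarrow> 'v::{ab_group_add,finite} \<Rightarrow> 'v) \<Rightarrow> 'v set multiset \<Rightarrow>
     ('v \<Rightarrow> 'v) set \<Rightarrow> bool"
  where "admits_automorphism_group smul B \<Gamma> \<longleftrightarrow>
    subgroup \<Gamma> (BijGroup UNIV) \<and>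
    (\<forall>g\<in>\<Gamma>. Vector_Spaces.linear smul smul g) \<and>
    (\<forall>g\<in>\<Gamma>. image_mset (image g) B = B)"

text \<open>
  An embedding makes \<open>'b\<close> an extension field of \<open>'a\<close>; every space over \<open>'b\<close>
  becomes one over \<open>'a\<close> by restriction of scalars. This is how \<open>GF(q)\<^sup>l\<close> is identified
  with \<open>GF(q\<^sup>l)\<close>, and \<open>GF(q)\<close>-space of dimension \<open>ml\<close> with \<open>GF(q\<^sup>l)\<^sup>m\<close>.
\<close>

definition field_embedding :: "('a::field \<Rightarrow> 'b::field) \<Rightarrow> bool"
  where "field_embedding emb \<longleftrightarrow>
    emb 1 = 1 \<and> (\<forall>x y. emb (x + y) = emb x + emb y) \<and> (\<forall>x y. emb (x * y) = emb x * emb y)"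

definition ext_scale :: "('a::field \<Rightarrow> 'b::field) \<Rightarrow> 'a \<Rightarrow> 'b \<Rightarrow> 'b"
  where "ext_scale emb a x = emb a * x"

definition ext_vec_scale :: "('a::field \<Rightarrow> 'b::field) \<Rightarrow> 'a \<Rightarrow> 'b ^ 'm \<Rightarrow> 'b ^ 'm"
  where "ext_vec_scale emb a x = emb a *s x"

definition singer_cycle :: "('b::field \<Rightarrow> 'b) set"
  where "singer_cycle = {(\<lambda>x. c * x) | c. c \<noteq> 0}"

definition GL_action :: "('b::field ^ 'm \<Rightarrow> 'b ^ 'm) set"
  where "GL_action = {(\<lambda>x. A *v x) | A :: 'b ^ 'm ^ 'm. invertible A}"

end

theory Submission
  imports Defs "HOL-Computational_Algebra.Polynomial"
begin

text \<open>
  Write \<open>L = GF(q\<^sup>l)\<close> and \<open>V = L\<^sup>m\<close>. A 2-dimensional \<open>GF(q)\<close>-subspace of \<open>V\<close> either lies on a line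
  \<open>Lx\<close> or has an \<open>L\<close>-independent basis. The planes of the first kind are covered by copying the given
  design to every line; Singer invariance makes the copy independent of the identification of
  the line with \<open>L\<close>. The planes of the second kind are covered by \<open>k\<close>-dimensional subspaces \<open>W\<close> that
  contain no plane of the first kind: those with an \<open>L\<close>-independent basis, and those whose bases \<open>v\<close>
  satisfy a single \<open>L\<close>-linear relation \<open>\<Sum>i. a i v i = 0\<close>. The \<open>GF(q)\<close>-span \<open>U\<close> of the coefficients is
  determined by \<open>W\<close> up to multiplication by \<open>L\<^sup>*\<close>, that is, by an orbit of the Singer cycle, and
  \<open>W\<close> contains no plane of the first kind iff \<open>dim U \<ge> 3\<close>. Counting the bases that start with a
  given basis of a plane shows that every orbit contributes its summand of \<open>\<lambda>\<close>; that there are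
  enough orbits with stabilizer \<open>GF(q\<^sup>u)\<^sup>*\<close> follows by Moebius inversion over the subfields of \<open>L\<close>.
\<close>

section \<open>Subspaces over a subfield\<close>

text \<open>The shape of \<open>lam\<close> comes from one double count. Fix a basis
  \<open>w\<close> of a plane of the second kind and count the pairs of a \<open>k\<close>-tuple
  \<open>v\<close> starting with \<open>w\<close> and a nonzero coefficient tuple \<open>a\<close>
  of its relation. A space \<open>U\<close> of dimension \<open>d\<close> is spanned by
  \<open>\<Prod>j<d. q^k - q^j\<close> tuples \<open>a\<close>. As \<open>d \<ge> 3\<close>, some
  \<open>a i\<close> with \<open>i \<ge> 2\<close> is nonzero, so \<open>v i\<close> can be
  eliminated without touching \<open>w\<close>, and the other \<open>k - 1\<close> vectors extend
  \<open>w\<close> independently over \<open>L\<close> in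
  \<open>\<Prod>j=2..k-2. q^(m*l) - q^(j*l)\<close> ways. Each \<open>v\<close> has
  \<open>q^l - 1\<close> such \<open>a\<close>, each block has
  \<open>\<Prod>j=2..k-1. q^k - q^j\<close> bases starting with \<open>w\<close>, and an orbit with
  stabilizer of order \<open>q^u - 1\<close> has \<open>(q^l - 1) / (q^u - 1)\<close> members, so
  \<open>q^l - 1\<close> cancels. Independent tuples are treated as type \<open>U = {0}\<close> and
  give the last term of \<open>lam\<close>. No number depends on the plane, and \<open>lam\<close>
  is prescribed so that planes of both kinds agree.\<close>

lemma fun_upd_PiE_eqD:
  assumes "v \<in> PiE J A" "w \<in> PiE J B" "i \<notin> J" "v(i := x) = w(i := y)"
  shows "v = w \<and> x = y"
proof
  show "x = y" using assms(4) by (metis fun_upd_same)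
  show "v = w"
  proof
    fix j show "v j = w j"
    proof (cases "j \<in> J")
      case True then show ?thesis using assms(3,4) by (metis fun_upd_other)
    next
      case False then show ?thesis using PiE_arb[OF assms(1)] PiE_arb[OF assms(2)] by metis
    qed
  qed
qed

text \<open>
  The scalars form a subset \<open>E\<close> of a field rather than a type, because the intermediate fields
  \<open>GF(q\<^sup>t)\<close> depend on \<open>t\<close>. Dimensions are expressed by cardinalities throughout.
\<close>

locale subfield_space = vector_space sc
  for sc :: "'b::{field,finite} \<Rightarrow> 'v::{ab_group_add,finite} \<Rightarrow> 'v" (infixr "\<cdot>" 75) +
  fixes E :: "'b set"
  assumes one_E: "1 \<in> E"
    and diff_E: "x \<in> E \<Longrightarrow> y \<in> E \<Longrightarrow> x - y \<in> E"
    and mult_E: "x \<in> E \<Longrightarrow> y \<in> E \<Longrightarrow> x * y \<in> E"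
    and inverse_E: "x \<in> E \<Longrightarrow> inverse x \<in> E"
begin

lemma zero_E: "0 \<in> E"
  using diff_E[OF one_E one_E] by simp

lemma uminus_E: "x \<in> E \<Longrightarrow> - x \<in> E"
  using diff_E[OF zero_E] by force

lemma add_E: "x \<in> E \<Longrightarrow> y \<in> E \<Longrightarrow> x + y \<in> E"
  using diff_E[of x "- y"] uminus_E by simp

lemma sum_E: "(\<And>i. i \<in> I \<Longrightarrow> f i \<in> E) \<Longrightarrow> sum f I \<in> E"
  by (induction I rule: infinite_finite_induct) (auto simp: zero_E add_E)

definition closed :: "'v set \<Rightarrow> bool" where
  "closed W \<longleftrightarrow> 0 \<in> W \<and> (\<forall>x\<in>W. \<forall>y\<in>W. x + y \<in> W) \<and> (\<forall>e\<in>E. \<forall>x\<in>W. e \<cdot> x \<in> W)"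

text \<open>Families carry an explicit index set \<open>J\<close>, so that adding a vector is a
  function update at a new index and ordered tuples can be counted inside
  \<open>PiE\<close>.\<close>

definition lspan :: "nat set \<Rightarrow> (nat \<Rightarrow> 'v) \<Rightarrow> 'v set" where
  "lspan J v = {\<Sum>j\<in>J. c j \<cdot> v j | c. \<forall>j\<in>J. c j \<in> E}"

definition indep :: "nat set \<Rightarrow> (nat \<Rightarrow> 'v) \<Rightarrow> bool" where
  "indep J v \<longleftrightarrow> (\<forall>c. (\<forall>j\<in>J. c j \<in> E) \<and> (\<Sum>j\<in>J. c j \<cdot> v j) = 0 \<longrightarrow> (\<forall>j\<in>J. c j = 0))"

lemma closed_scale: "closed W \<Longrightarrow> e \<in> E \<Longrightarrow> x \<in> W \<Longrightarrow> e \<cdot> x \<in> W"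
  by (simp add: closed_def)

lemma closed_add: "closed W \<Longrightarrow> x \<in> W \<Longrightarrow> y \<in> W \<Longrightarrow> x + y \<in> W"
  by (simp add: closed_def)

lemma closed_sum: "closed W \<Longrightarrow> (\<And>i. i \<in> I \<Longrightarrow> f i \<in> W) \<Longrightarrow> sum f I \<in> W"
  by (induction I rule: infinite_finite_induct) (auto simp: closed_def)

lemma closed_uminus: "closed W \<Longrightarrow> x \<in> W \<Longrightarrow> - x \<in> W"
  using uminus_E[OF one_E] unfolding closed_def by (metis scale_minus_left scale_one)

lemma closed_diff: "closed W \<Longrightarrow> x \<in> W \<Longrightarrow> y \<in> W \<Longrightarrow> x - y \<in> W"
  using closed_uminus[of W y] unfolding closed_def by (metis add_uminus_conv_diff)

lemma closed_UNIV: "closed UNIV"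
  by (simp add: closed_def)

lemma closed_zero: "closed {0}"
  by (simp add: closed_def)

lemma closed_lspan: "closed (lspan J v)"
  unfolding closed_def
proof (intro conjI ballI)
  show "0 \<in> lspan J v"
    unfolding lspan_def using zero_E by (auto intro!: exI[of _ "\<lambda>_. 0"])
next
  fix x y assume "x \<in> lspan J v" "y \<in> lspan J v"
  then obtain c d where "\<forall>j\<in>J. c j \<in> E" "x = (\<Sum>j\<in>J. c j \<cdot> v j)" "\<forall>j\<in>J. d j \<in> E" "y = (\<Sum>j\<in>J. d j \<cdot> v j)"
    unfolding lspan_def by auto
  then show "x + y \<in> lspan J v" unfolding lspan_def
    by (auto intro!: exI[of _ "\<lambda>j. c j + d j"] simp: scale_left_distrib sum.distrib add_E)
next
  fix e x assume "e \<in> E" "x \<in> lspan J v"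
  then obtain c where "\<forall>j\<in>J. c j \<in> E" "x = (\<Sum>j\<in>J. c j \<cdot> v j)"
    unfolding lspan_def by auto
  then show "e \<cdot> x \<in> lspan J v" unfolding lspan_def using \<open>e \<in> E\<close>
    by (auto intro!: exI[of _ "\<lambda>j. e * c j"] simp: scale_sum_right mult_E)
qed

lemma lspan_subset: "closed W \<Longrightarrow> (\<And>j. j \<in> J \<Longrightarrow> v j \<in> W) \<Longrightarrow> lspan J v \<subseteq> W"
  unfolding lspan_def by (auto intro!: closed_sum) (auto simp: closed_def)

lemma lspan_superset: "finite J \<Longrightarrow> j \<in> J \<Longrightarrow> v j \<in> lspan J v"
  unfolding lspan_def
  using one_E zero_E
  by (auto intro!: exI[of _ "\<lambda>i. if i = j then 1 else 0"] simp: if_distrib[of "\<lambda>c. c \<cdot> _"] cong: if_cong)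

lemma lspan_mono: "finite J \<Longrightarrow> I \<subseteq> J \<Longrightarrow> lspan I v \<subseteq> lspan J v"
  by (rule lspan_subset) (auto simp: closed_lspan intro: lspan_superset)

lemma lspan_cong: "(\<And>j. j \<in> J \<Longrightarrow> v j = v' j) \<Longrightarrow> lspan J v = lspan J v'"
  unfolding lspan_def by (metis (no_types, lifting) sum.cong)

lemma indep_cong: "(\<And>j. j \<in> J \<Longrightarrow> v j = v' j) \<Longrightarrow> indep J v = indep J v'"
proof -
  assume "\<And>j. j \<in> J \<Longrightarrow> v j = v' j"
  then have "(\<Sum>j\<in>J. c j \<cdot> v j) = (\<Sum>j\<in>J. c j \<cdot> v' j)" for c by (intro sum.cong) auto
  then show ?thesis unfolding indep_def by simp
qed

lemma lspan_eq_image: "lspan J v = (\<lambda>c. \<Sum>j\<in>J. c j \<cdot> v j) ` (PiE J (\<lambda>_. E))"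
proof
  show "lspan J v \<subseteq> (\<lambda>c. \<Sum>j\<in>J. c j \<cdot> v j) ` (PiE J (\<lambda>_. E))"
  proof
    fix x assume "x \<in> lspan J v"
    then obtain c where "\<forall>j\<in>J. c j \<in> E" "x = (\<Sum>j\<in>J. c j \<cdot> v j)"
      unfolding lspan_def by auto
    then show "x \<in> (\<lambda>c. \<Sum>j\<in>J. c j \<cdot> v j) ` (PiE J (\<lambda>_. E))"
      by (intro image_eqI[of _ _ "restrict c J"]) (auto intro!: sum.cong)
  qed
qed (auto simp: lspan_def PiE_def Pi_def)

text \<open>The coefficient map is additive, so a trivial kernel means injectivity. In this form
  independence becomes a statement about the cardinality of the span.\<close>

lemma indep_iff_inj_on: "indep J v \<longleftrightarrow> inj_on (\<lambda>c. \<Sum>j\<in>J. c j \<cdot> v j) (PiE J (\<lambda>_. E))"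
proof
  assume i: "indep J v"
  show "inj_on (\<lambda>c. \<Sum>j\<in>J. c j \<cdot> v j) (PiE J (\<lambda>_. E))"
  proof (rule inj_onI)
    fix c d assume c: "c \<in> PiE J (\<lambda>_. E)" and d: "d \<in> PiE J (\<lambda>_. E)"
      and eq: "(\<Sum>j\<in>J. c j \<cdot> v j) = (\<Sum>j\<in>J. d j \<cdot> v j)"
    have "\<forall>j\<in>J. c j - d j = 0"
      using i[unfolded indep_def, rule_format, of "\<lambda>j. c j - d j"] c d eq
      by (auto simp: scale_left_diff_distrib sum_subtractf diff_E PiE_iff)
    then show "c = d" using c d by (intro PiE_ext) auto
  qed
next
  assume i: "inj_on (\<lambda>c. \<Sum>j\<in>J. c j \<cdot> v j) (PiE J (\<lambda>_. E))"
  show "indep J v" unfolding indep_def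
  proof (intro allI impI)
    fix c assume c: "(\<forall>j\<in>J. c j \<in> E) \<and> (\<Sum>j\<in>J. c j \<cdot> v j) = 0"
    have "restrict c J = restrict (\<lambda>_. 0) J"
      by (rule inj_onD[OF i]) (use c zero_E in auto)
    then show "\<forall>j\<in>J. c j = 0" by (metis restrict_apply')
  qed
qed

lemma card_lspan: "finite J \<Longrightarrow> indep J v \<Longrightarrow> card (lspan J v) = card E ^ card J"
  unfolding lspan_eq_image indep_iff_inj_on by (simp add: card_image card_PiE)

lemma indep_if_card_lspan: "finite J \<Longrightarrow> card (lspan J v) = card E ^ card J \<Longrightarrow> indep J v"
  unfolding lspan_eq_image indep_iff_inj_on by (rule eq_card_imp_inj_on) (auto simp: card_PiE finite_PiE)

lemma card_lspan_le: "finite J \<Longrightarrow> card (lspan J v) \<le> card E ^ card J"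
  unfolding lspan_eq_image
  by (rule order_trans[OF card_image_le]) (auto simp: card_PiE finite_PiE)

lemma indep_insert:
  assumes "finite J" "i \<notin> J"
  shows "indep (insert i J) v \<longleftrightarrow> indep J v \<and> v i \<notin> lspan J v"
proof
  assume i: "indep (insert i J) v"
  have "indep J v" unfolding indep_def
  proof (intro allI impI)
    fix c assume c: "(\<forall>j\<in>J. c j \<in> E) \<and> (\<Sum>j\<in>J. c j \<cdot> v j) = 0"
    have "(\<Sum>j\<in>J. (c(i := 0)) j \<cdot> v j) = (\<Sum>j\<in>J. c j \<cdot> v j)"
      using assms by (intro sum.cong) auto
    then have "\<forall>j\<in>insert i J. (c(i := 0)) j = 0"
      using i[unfolded indep_def, THEN spec, of "c(i:=0)"] c assms zero_E by auto
    then show "\<forall>j\<in>J. c j = 0"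
      using assms by (metis fun_upd_other insertCI)
  qed
  moreover have "v i \<notin> lspan J v"
  proof
    assume "v i \<in> lspan J v"
    then obtain c where c: "\<forall>j\<in>J. c j \<in> E" "v i = (\<Sum>j\<in>J. c j \<cdot> v j)"
      unfolding lspan_def by auto
    have "(\<Sum>j\<in>J. (c(i := -1)) j \<cdot> v j) = (\<Sum>j\<in>J. c j \<cdot> v j)"
      using assms by (intro sum.cong) auto
    then have "(\<Sum>j\<in>insert i J. (c(i := -1)) j \<cdot> v j) = 0" using assms c by simp
    moreover have "\<forall>j\<in>insert i J. (c(i := -1)) j \<in> E"
      using c one_E uminus_E by auto
    ultimately have "\<forall>j\<in>insert i J. (c(i := -1)) j = 0"
      using i unfolding indep_def by blast
    then show False by simp
  qed
  ultimately show "indep J v \<and> v i \<notin> lspan J v" ..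
next
  assume a: "indep J v \<and> v i \<notin> lspan J v"
  show "indep (insert i J) v" unfolding indep_def
  proof (intro allI impI)
    fix c assume c: "(\<forall>j\<in>insert i J. c j \<in> E) \<and> (\<Sum>j\<in>insert i J. c j \<cdot> v j) = 0"
    then have s: "c i \<cdot> v i = - (\<Sum>j\<in>J. c j \<cdot> v j)"
      using assms by (simp add: eq_neg_iff_add_eq_0)
    have m: "(\<Sum>j\<in>J. c j \<cdot> v j) \<in> lspan J v" using c unfolding lspan_def by auto
    have "c i = 0"
    proof (rule ccontr)
      assume "c i \<noteq> 0"
      then have "v i = inverse (c i) \<cdot> - (\<Sum>j\<in>J. c j \<cdot> v j)" using s
        by (metis left_inverse scale_one scale_scale)
      also have "\<dots> \<in> lspan J v"
        using closed_lspan[of J v] c inverse_E closed_uminus m unfolding closed_def by blast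
      finally show False using a by simp
    qed
    moreover have "\<forall>j\<in>J. c j = 0"
      using a c \<open>c i = 0\<close> assms unfolding indep_def by auto
    ultimately show "\<forall>j\<in>insert i J. c j = 0" by simp
  qed
qed

lemma indep_insert_upd:
  assumes "finite J" "i \<notin> J"
  shows "indep (insert i J) (v(i := x)) \<longleftrightarrow> indep J v \<and> x \<notin> lspan J v"
proof -
  have "v(i := x) \<in> {w. \<forall>j\<in>J. v j = w j}" using assms by auto
  then have "indep J (v(i := x)) = indep J v" "lspan J (v(i := x)) = lspan J v"
    using indep_cong[of J v "v(i := x)"] lspan_cong[of J v "v(i := x)"] by auto
  then show ?thesis using indep_insert[OF assms, of "v(i := x)"] by simp
qed

lemma indep_empty [simp]: "indep {} v"
  by (simp add: indep_def)

lemma lspan_empty [simp]: "lspan {} v = {0}"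
  by (simp add: lspan_def)

lemma indep_two_iff:
  "indep {0, 1} v \<longleftrightarrow> (\<forall>a\<in>E. \<forall>b\<in>E. a \<cdot> v 0 + b \<cdot> v 1 = 0 \<longrightarrow> a = 0 \<and> b = 0)"
proof
  assume i: "indep {0, 1} v"
  show "\<forall>a\<in>E. \<forall>b\<in>E. a \<cdot> v 0 + b \<cdot> v 1 = 0 \<longrightarrow> a = 0 \<and> b = 0"
  proof (intro ballI impI)
    fix a b assume "a \<in> E" "b \<in> E" "a \<cdot> v 0 + b \<cdot> v 1 = 0"
    then show "a = 0 \<and> b = 0"
      using i[unfolded indep_def, THEN spec, of "\<lambda>i. if i = 0 then a else b"] by simp
  qed
next
  assume h: "\<forall>a\<in>E. \<forall>b\<in>E. a \<cdot> v 0 + b \<cdot> v 1 = 0 \<longrightarrow> a = 0 \<and> b = 0"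
  show "indep {0, 1} v" unfolding indep_def
  proof (intro allI impI, elim conjE)
    fix c assume "\<forall>j\<in>{0, 1}. c j \<in> E" "(\<Sum>j\<in>{0, 1}. c j \<cdot> v j) = 0"
    then show "\<forall>j\<in>{0, 1}. c j = 0" using h[THEN bspec, THEN bspec, of "c 0" "c 1"] by simp
  qed
qed

lemma card_E_gt_1: "1 < card E"
proof -
  have "card {0, 1::'b} \<le> card E" by (intro card_mono) (use zero_E one_E in auto)
  then show ?thesis by simp
qed

section \<open>Counting ordered independent families\<close>

text \<open>An independent family extends at a new index by exactly the vectors of \<open>W\<close>
  outside its span, which gives one factor per index. If \<open>card J\<close> exceeds the dimension
  of \<open>W\<close>, one factor is 0; this is why the product is taken over the reals, where the
  factors after it may be negative.\<close>

lemma indep_extend: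
  assumes "finite J" "J0 \<subseteq> J" "indep J0 v0" "closed W"  "v0 ` J0 \<subseteq> W"
  shows "real (card {v \<in> PiE J (\<lambda>_. W). (\<forall>j\<in>J0. v j = v0 j) \<and> indep J v}) =
    (\<Prod>i = card J0..<card J. real (card W) - real (card E) ^ i)"
proof -
  have "finite (J - J0)" using assms by auto
  moreover have "finite J0" using assms finite_subset by auto
  have "real (card {v \<in> PiE (J0 \<union> I) (\<lambda>_. W). (\<forall>j\<in>J0. v j = v0 j) \<and> indep (J0 \<union> I) v}) =
    (\<Prod>i = card J0..<card (J0 \<union> I). real (card W) - real (card E) ^ i)"
    if "finite I" "I \<inter> J0 = {}" for I
    using that
  proof (induction I)
    case empty
    have "{v \<in> PiE J0 (\<lambda>_. W). (\<forall>j\<in>J0. v j = v0 j) \<and> indep J0 v} = {restrict v0 J0}"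
    proof (intro equalityI subsetI)
      fix v assume v: "v \<in> {v \<in> PiE J0 (\<lambda>_. W). (\<forall>j\<in>J0. v j = v0 j) \<and> indep J0 v}"
      then have "v = restrict v0 J0" by (intro extensionalityI[of _ J0]) (auto simp: PiE_def)
      then show "v \<in> {restrict v0 J0}" by simp
    next
      fix v assume "v \<in> {restrict v0 J0}"
      then show "v \<in> {v \<in> PiE J0 (\<lambda>_. W). (\<forall>j\<in>J0. v j = v0 j) \<and> indep J0 v}"
        using assms indep_cong[of J0 "restrict v0 J0" v0] by auto
    qed
    then show ?case by simp
  next
    case (insert i I)
    let ?J = "J0 \<union> I"
    have i: "i \<notin> ?J" using insert by auto
    have fJ: "finite ?J" using insert \<open>finite J0\<close> by auto
    let ?A = "{v \<in> PiE ?J (\<lambda>_. W). (\<forall>j\<in>J0. v j = v0 j) \<and> indep ?J v}"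
    let ?B = "{v \<in> PiE (insert i ?J) (\<lambda>_. W). (\<forall>j\<in>J0. v j = v0 j) \<and> indep (insert i ?J) v}"
    note upd = indep_insert_upd[OF fJ i]
    have "bij_betw (\<lambda>(v, x). v(i := x)) (Sigma ?A (\<lambda>v. W - lspan ?J v)) ?B"
      unfolding bij_betw_def
    proof
      show "inj_on (\<lambda>(v, x). v(i := x)) (Sigma ?A (\<lambda>v. W - lspan ?J v))"
      proof (rule inj_onI, clarify, goal_cases)
        case (1 v x w y)
        then show ?case using fun_upd_PiE_eqD[of v ?J _ w _ i x y] i by blast
      qed
      show "(\<lambda>(v, x). v(i := x)) ` (Sigma ?A (\<lambda>v. W - lspan ?J v)) = ?B"
      proof (intro equalityI subsetI)
        fix u assume "u \<in> (\<lambda>(v, x). v(i := x)) ` (Sigma ?A (\<lambda>v. W - lspan ?J v))"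
        then show "u \<in> ?B" using upd i assms(5) by (auto simp: PiE_def extensional_def Pi_def image_subset_iff)
      next
        fix u assume u: "u \<in> ?B"
        \<comment> \<open>Resetting the new entry to \<open>undefined\<close> returns to
          \<open>PiE\<close> over the smaller index set.\<close>
        have "u(i := undefined) \<in> PiE ?J (\<lambda>_. W)"
          using u i by (auto simp: PiE_def extensional_def)
        moreover have "indep ?J (u(i := undefined)) \<and> u i \<notin> lspan ?J (u(i := undefined))"
          using upd[of "u(i := undefined)" "u i"] u by simp
        moreover have "u i \<in> W" using u by auto
        ultimately have "(u(i := undefined), u i) \<in> Sigma ?A (\<lambda>v. W - lspan ?J v)"
          using u i by auto
        then have "(\<lambda>(v, x). v(i := x)) (u(i := undefined), u i) \<in> (\<lambda>(v, x). v(i := x)) ` (Sigma ?A (\<lambda>v. W - lspan ?J v))"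
          by (rule imageI)
        then show "u \<in> (\<lambda>(v, x). v(i := x)) ` (Sigma ?A (\<lambda>v. W - lspan ?J v))" by simp
      qed
    qed
    then have "card ?B = card (Sigma ?A (\<lambda>v. W - lspan ?J v))" by (simp add: bij_betw_same_card)
    also have "\<dots> = (\<Sum>v\<in>?A. card (W - lspan ?J v))"
    proof (rule card_SigmaI)
      have "finite (PiE ?J (\<lambda>_. W))" using fJ by (intro finite_PiE) auto
      then show "finite ?A" by simp
    qed auto
    finally have "real (card ?B) = (\<Sum>v\<in>?A. real (card (W - lspan ?J v)))" by simp
    also have "\<dots> = (\<Sum>v\<in>?A. real (card W) - real (card E) ^ card ?J)"
    proof (rule sum.cong[OF refl])
      fix v assume v: "v \<in> ?A"
      then have sub: "lspan ?J v \<subseteq> W" using assms by (intro lspan_subset) auto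
      then have "card (W - lspan ?J v) = card W - card (lspan ?J v)" by (intro card_Diff_subset) auto
      moreover have "card (lspan ?J v) \<le> card W" using sub by (intro card_mono) auto
      moreover have "card (lspan ?J v) = card E ^ card ?J" using v fJ by (intro card_lspan) auto
      ultimately show "real (card (W - lspan ?J v)) = real (card W) - real (card E) ^ card ?J"
        by (simp add: of_nat_diff)
    qed
    also have "\<dots> = real (card ?A) * (real (card W) - real (card E) ^ card ?J)" by simp
    also have "real (card ?A) = (\<Prod>i = card J0..<card ?J. real (card W) - real (card E) ^ i)"
      using insert by auto
    also have "\<dots> * (real (card W) - real (card E) ^ card ?J) =
      (\<Prod>i = card J0..<card (insert i ?J). real (card W) - real (card E) ^ i)"
    proof -
      have "card J0 \<le> card ?J" using fJ by (intro card_mono) auto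
      then show ?thesis using i fJ by simp
    qed
    finally show ?case by simp
  qed
  from this[OF \<open>finite (J - J0)\<close>] have "real (card {v \<in> PiE (J0 \<union> (J - J0)) (\<lambda>_. W). (\<forall>j\<in>J0. v j = v0 j) \<and> indep (J0 \<union> (J - J0)) v}) =
    (\<Prod>i = card J0..<card (J0 \<union> (J - J0)). real (card W) - real (card E) ^ i)" by blast
  moreover have "J0 \<union> (J - J0) = J" using assms(2) by blast
  ultimately show ?thesis by simp
qed

lemma indep_count:
  assumes "closed W"
  shows "real (card {v \<in> PiE {..<n} (\<lambda>_. W). indep {..<n} v}) = (\<Prod>i<n. real (card W) - real (card E) ^ i)"
  using indep_extend[of "{..<n}" "{}" undefined W] assms by (simp add: atLeast0LessThan)

text \<open>A longest independent family spans. Lengths are bounded, as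
  \<open>n < card E ^ n \<le> card W\<close>.\<close>

lemma basis_exists_family:
  assumes "closed W"
  obtains n v where "v \<in> PiE {..<n} (\<lambda>_. W)" "indep {..<n} v" "lspan {..<n} v = W"
proof -
  define P where "P n \<longleftrightarrow> (\<exists>v \<in> PiE {..<n} (\<lambda>_. W). indep {..<n} v)" for n
  have "P 0" unfolding P_def by auto
  moreover have bound: "n \<le> card W" if "P n" for n
  proof -
    from that obtain v where v: "v \<in> PiE {..<n} (\<lambda>_. W)" "indep {..<n} v" unfolding P_def by auto
    have "lspan {..<n} v \<subseteq> W" using v assms by (intro lspan_subset) auto
    then have "card (lspan {..<n} v) \<le> card W" by (intro card_mono) auto
    then have "card E ^ n \<le> card W" using v card_lspan[of "{..<n}" v] by auto
    moreover have "n < card E ^ n" using power_gt_expt[of "card E" n] card_E_gt_1 by simp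
    ultimately show ?thesis by simp
  qed
  ultimately obtain n where n: "P n" "\<And>n'. P n' \<Longrightarrow> n' \<le> n"
    using GreatestI_nat[of P 0 "card W"] Greatest_le_nat[of P _ "card W"] by blast
  from n(1) obtain v where v: "v \<in> PiE {..<n} (\<lambda>_. W)" "indep {..<n} v" unfolding P_def by auto
  have "lspan {..<n} v = W"
  proof (rule ccontr)
    assume ne: "lspan {..<n} v \<noteq> W"
    have "lspan {..<n} v \<subseteq> W" using v assms by (intro lspan_subset) auto
    then obtain x where x: "x \<in> W" "x \<notin> lspan {..<n} v" using ne by auto
    have "indep {..<Suc n} (v(n := x))"
      using v x by (simp add: lessThan_Suc indep_insert_upd)
    moreover have "v(n := x) \<in> PiE {..<Suc n} (\<lambda>_. W)"
      using v x by (auto simp: PiE_def extensional_def Pi_def)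
    ultimately have "P (Suc n)" unfolding P_def by auto
    then show False using n(2) by fastforce
  qed
  then show ?thesis using that v by auto
qed

lemma card_closed:
  assumes "closed W"
  obtains n where "card W = card E ^ n"
proof -
  obtain n v where "v \<in> PiE {..<n} (\<lambda>_. W)" "indep {..<n} v" "lspan {..<n} v = W"
    using basis_exists_family[OF assms] .
  then have "card W = card E ^ n" using card_lspan[of "{..<n}" v] by auto
  then show ?thesis by (rule that)
qed

lemma lspan_eqI:
  assumes "finite J" "indep J v" "closed W" "\<And>j. j \<in> J \<Longrightarrow> v j \<in> W" "card W = card E ^ card J"
  shows "lspan J v = W"
proof (rule card_subset_eq)
  show "lspan J v \<subseteq> W" using assms by (intro lspan_subset) auto
qed (use assms card_lspan[of J v] in auto)

section \<open>Counting subspaces and spanning families\<close>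

text \<open>Independent \<open>b\<close>-tuples of \<open>X\<close> are partitioned by their spans,
  and all subspaces with \<open>card E ^ b\<close> elements have the same number of ordered
  bases.\<close>

lemma closed_count:
  assumes "closed X"
  shows "real (card {W. closed W \<and> W \<subseteq> X \<and> card W = card E ^ b}) *
      (\<Prod>i<b. real (card E) ^ b - real (card E) ^ i) = (\<Prod>i<b. real (card X) - real (card E) ^ i)"
proof -
  let ?S = "{W. closed W \<and> W \<subseteq> X \<and> card W = card E ^ b}"
  let ?F = "\<lambda>W. {v \<in> PiE {..<b} (\<lambda>_. W). indep {..<b} v}"
  have fin: "finite (PiE {..<b} (\<lambda>_. W :: 'v set))" for W by (intro finite_PiE) auto
  have sp: "lspan {..<b} v = W" if "W \<in> ?S" "v \<in> ?F W" for W v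
    using that by (intro lspan_eqI) auto
  have "?F X = (\<Union>W\<in>?S. ?F W)"
  proof (intro equalityI subsetI)
    fix v assume v: "v \<in> ?F X"
    have "lspan {..<b} v \<in> ?S"
      using v assms by (auto simp: closed_lspan card_lspan intro: lspan_subset[THEN subsetD])
    moreover have "v \<in> ?F (lspan {..<b} v)" using v
      by (auto simp: PiE_iff intro: lspan_superset)
    ultimately show "v \<in> (\<Union>W\<in>?S. ?F W)" by blast
  qed (auto simp: PiE_iff)
  then have "card (?F X) = card (\<Union>W\<in>?S. ?F W)" by simp
  also have "\<dots> = (\<Sum>W\<in>?S. card (?F W))"
  proof (rule card_UN_disjoint)
    show "\<forall>W\<in>?S. finite (?F W)" using fin by simp
    show "\<forall>W\<in>?S. \<forall>W'\<in>?S. W \<noteq> W' \<longrightarrow> ?F W \<inter> ?F W' = {}"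
    proof (intro ballI impI equals0I)
      fix W W' v assume "W \<in> ?S" "W' \<in> ?S" "W \<noteq> W'" "v \<in> ?F W \<inter> ?F W'"
      then show False using sp[of W v] sp[of W' v] by simp
    qed
  qed (rule finite)
  finally have "real (card (?F X)) = (\<Sum>W\<in>?S. real (card (?F W)))" by simp
  also have "\<dots> = (\<Sum>W\<in>?S. \<Prod>i<b. real (card E) ^ b - real (card E) ^ i)"
    by (intro sum.cong refl) (subst indep_count, auto)
  finally show ?thesis using indep_count[OF assms, of b] by simp
qed


text \<open>Cardinalities of closed sets are powers of \<open>card E\<close>, so no closed set lies
  strictly between a hyperplane of \<open>U\<close> and \<open>U\<close> itself.\<close>

lemma lspan_insert_eq:
  assumes "finite J" "closed U" "x \<in> U" "lspan J a \<subseteq> U" "card U = card E ^ Suc d" "card (lspan J a) = card E ^ d"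
    "x \<notin> lspan J a" "i \<notin> J"
  shows "lspan (insert i J) (a(i := x)) = U"
proof -
  let ?H = "lspan J a"
  let ?S = "lspan (insert i J) (a(i := x))"
  have "lspan J (a(i := x)) = ?H" using assms by (intro lspan_cong) auto
  then have H: "?H \<subseteq> ?S" using lspan_mono[of "insert i J" J "a(i := x)"] assms by auto
  have x: "x \<in> ?S" using lspan_superset[of "insert i J" i "a(i := x)"] assms by simp
  obtain n where n: "card ?S = card E ^ n" using card_closed[OF closed_lspan] .
  have "?H \<subset> ?S" using H x assms by blast
  then have "card ?H < card ?S" by (intro psubset_card_mono) auto
  then have "card E ^ d < card E ^ n" using assms n by simp
  then have "d < n" using card_E_gt_1 by (simp add: power_strict_increasing_iff)
  then have "card U \<le> card ?S" using assms n card_E_gt_1 power_increasing[of "Suc d" n "card E"] by simp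
  moreover have "?S \<subseteq> U"
  proof (rule lspan_subset)
    fix j assume "j \<in> insert i J"
    then show "(a(i := x)) j \<in> U" using lspan_superset[of J j a] assms by auto
  qed fact
  ultimately show ?thesis by (intro card_seteq) auto
qed

text \<open>This is \<open>closed_count\<close> with \<open>b = d\<close>. Splitting off the factor
  for \<open>i = 0\<close> on the right leaves a factor \<open>card E\<close> in each remaining
  term; then all but the stated factors cancel.\<close>

lemma hyperplane_count:
  assumes "closed U" "card U = card E ^ Suc d"
  shows "real (card {H. closed H \<and> H \<subseteq> U \<and> card H = card E ^ d}) * (real (card E) - 1) = real (card E) ^ Suc d - 1"
proof -
  let ?Q = "real (card E)"
  have Q: "?Q > 1" using card_E_gt_1 by simp
  let ?n = "real (card {H. closed H \<and> H \<subseteq> U \<and> card H = card E ^ d})"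
  have *: "?n * (\<Prod>i<d. ?Q ^ d - ?Q ^ i) = (\<Prod>i<d. ?Q ^ Suc d - ?Q ^ i)"
    using closed_count[OF assms(1), of d] assms(2) by simp
  show ?thesis
  proof (cases d)
    case 0
    then show ?thesis using * by simp
  next
    case (Suc e)
    have "(\<Prod>i<d. ?Q ^ Suc d - ?Q ^ i) = (?Q ^ Suc d - 1) * (\<Prod>i<e. ?Q * (?Q ^ d - ?Q ^ i))"
      unfolding Suc prod.lessThan_Suc_shift by (simp add: algebra_simps)
    also have "\<dots> = (?Q ^ Suc d - 1) * (?Q ^ e * (\<Prod>i<e. ?Q ^ d - ?Q ^ i))"
      by (simp add: prod.distrib)
    finally have "?n * ((\<Prod>i<e. ?Q ^ d - ?Q ^ i) * (?Q ^ d - ?Q ^ e)) = (?Q ^ Suc d - 1) * (?Q ^ e * (\<Prod>i<e. ?Q ^ d - ?Q ^ i))"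
      using * Suc by simp
    moreover have ne: "(\<Prod>i<e. ?Q ^ d - ?Q ^ i) \<noteq> 0" using Q Suc by (auto simp: power_inject_exp simp del: power_Suc)
    moreover have "?Q ^ d - ?Q ^ e = ?Q ^ e * (?Q - 1)" using Suc by (simp add: algebra_simps)
    moreover have "?Q ^ e \<noteq> 0" using Q by (metis power_not_zero not_one_less_zero)
    ultimately have "(?n * (?Q - 1)) * ((\<Prod>i<e. ?Q ^ d - ?Q ^ i) * ?Q ^ e) = (?Q ^ Suc d - 1) * ((\<Prod>i<e. ?Q ^ d - ?Q ^ i) * ?Q ^ e)"
      by (simp only: ac_simps)
    moreover have nz: "(\<Prod>i<e. ?Q ^ d - ?Q ^ i) * ?Q ^ e \<noteq> 0"
      using no_zero_divisors[OF ne \<open>?Q ^ e \<noteq> 0\<close>] .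
    ultimately show ?thesis unfolding mult_right_cancel[OF nz] by simp
  qed
qed

text \<open>The first \<open>k\<close> members of a spanning family of \<open>k + 1\<close> vectors span \<open>U\<close> or a hyperplane of \<open>U\<close>.\<close>

lemma spanning_count:
  assumes "closed U" "card U = card E ^ d"
  shows "real (card {a \<in> PiE {..<k} (\<lambda>_. U). lspan {..<k} a = U}) = (\<Prod>j<d. real (card E) ^ k - real (card E) ^ j)"
  using assms
proof (induction k arbitrary: U d)
  case 0
  show ?case
  proof (cases d)
    case d: 0
    then have "card U = 1" using "0.prems" by simp
    then have "U = {0}" using "0.prems" by (metis card_1_singletonE closed_def singletonD)
    moreover have "{a. a = (\<lambda>x. undefined) \<and> {0} = U} = {\<lambda>x. undefined}" using calculation by auto
    ultimately show ?thesis using d by simp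
  next
    case (Suc e)
    have "{0} \<noteq> U"
    proof
      assume "{0} = U"
      then have "card U = 1" by auto
      then have "card E ^ d = 1" using "0.prems" by argo
      then show False using Suc card_E_gt_1 by simp
    qed
    then show ?thesis using Suc by (simp add: prod.lessThan_Suc_shift del: prod.lessThan_Suc)
  qed
next
  case (Suc k)
  let ?Q = "real (card E)"
  have Q: "?Q > 1" using card_E_gt_1 by simp
  let ?F = "\<lambda>H. {a \<in> PiE {..<k} (\<lambda>_. H). lspan {..<k} a = H}"
  have fF: "finite (?F H)" for H
    by (rule finite_subset[OF _ finite_PiE[of "{..<k}" "\<lambda>_. H"]]) auto
  let ?S = "{H. closed H \<and> H \<subseteq> U \<and> Suc (LEAST n. card H = card E ^ n) = d}"
  \<comment> \<open>Hyperplanes are written multiplicatively, so that for \<open>d = 0\<close> there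
    are none and no exponent is truncated.\<close>
  let ?Hs = "{H. closed H \<and> H \<subseteq> U \<and> card H * card E = card U}"
  let ?P = "\<lambda>(a, x). a(k := x)"
  let ?D1 = "?F U \<times> U"
  let ?D2 = "Sigma ?Hs (\<lambda>H. ?F H \<times> (U - H))"
  let ?A = "{a \<in> PiE {..<Suc k} (\<lambda>_. U). lspan {..<Suc k} a = U}"
  have spU: "lspan {..<Suc k} (a(k := x)) = lspan (insert k {..<k}) (a(k := x))" for a x
    by (simp add: lessThan_Suc)
  let ?D = "{(a, x). a \<in> PiE {..<k} (\<lambda>_. U) \<and> x \<in> U \<and> lspan (insert k {..<k}) (a(k := x)) = U}"
  have "bij_betw ?P ?D ?A"
    unfolding bij_betw_def
  proof
    show "inj_on ?P ?D"
    proof (rule inj_onI, clarify, goal_cases)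
      case (1 v x w y)
      then show ?case using fun_upd_PiE_eqD[of v "{..<k}" _ w _ k x y] by blast
    qed
    show "?P ` ?D = ?A"
    proof (intro equalityI subsetI)
      fix u assume "u \<in> ?P ` ?D"
      then show "u \<in> ?A" by (auto simp: PiE_def extensional_def lessThan_Suc)
    next
      fix u assume u: "u \<in> ?A"
      have "u(k := undefined) \<in> PiE {..<k} (\<lambda>_. U)"
        using u by (auto simp: PiE_def extensional_def)
      then have "(u(k := undefined), u k) \<in> ?D" using u by (auto simp: lessThan_Suc)
      then have "?P (u(k := undefined), u k) \<in> ?P ` ?D" by (rule imageI)
      then show "u \<in> ?P ` ?D" by simp
    qed
  qed
  then have "card ?A = card ?D" by (simp add: bij_betw_same_card)
  also have "?D = ?D1 \<union> (\<lambda>(H, a, x). (a, x)) ` ?D2"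
  proof -
    have 1: "(a, x) \<in> ?D1" if a: "a \<in> PiE {..<k} (\<lambda>_. U)" and x: "x \<in> U"
      and sp: "lspan (insert k {..<k}) (a(k := x)) = U"
      and no: "(a, x) \<notin> (\<lambda>(H, a, x). (a, x)) ` ?D2" for a x
    proof -
    let ?H = "lspan {..<k} a"
    have HU: "?H \<subseteq> U" using a Suc.prems by (intro lspan_subset) auto
    have aH: "a \<in> PiE {..<k} (\<lambda>_. ?H)" using a by (auto simp: PiE_iff intro: lspan_superset)
    have "?H = U"
    proof (cases "x \<in> ?H")
      case True
      have "lspan (insert k {..<k}) (a(k := x)) \<subseteq> ?H"
        by (rule lspan_subset) (use True in \<open>auto simp: closed_lspan intro: lspan_superset\<close>)
      then show ?thesis using sp HU by auto
    next
      case False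
      then have "card ?H * card E \<noteq> card U"
        using no aH HU x closed_lspan[of "{..<k}" a] by (auto simp: image_iff)
      \<comment> \<open>One more vector multiplies a span by at most \<open>card E\<close>. As
        equality is excluded, comparing exponents leaves only \<open>?H = U\<close>.\<close>
      moreover have "card U \<le> card ?H * card E"
      proof -
        have "U \<subseteq> (\<lambda>(h, e). h + e \<cdot> x) ` (?H \<times> E)"
        proof
          fix y assume "y \<in> U"
          then have "y \<in> lspan (insert k {..<k}) (a(k := x))" using sp by simp
          then obtain c where c: "\<forall>j\<in>insert k {..<k}. c j \<in> E" "y = (\<Sum>j\<in>insert k {..<k}. c j \<cdot> (a(k := x)) j)"
            unfolding lspan_def by blast
          have "y = (\<Sum>j<k. c j \<cdot> a j) + c k \<cdot> x"
            using c(2) by (simp add: add.commute)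
          moreover have "(\<Sum>j<k. c j \<cdot> a j) \<in> ?H" using c unfolding lspan_def by auto
          ultimately show "y \<in> (\<lambda>(h, e). h + e \<cdot> x) ` (?H \<times> E)"
            using c by (intro image_eqI[of _ _ "(\<Sum>j<k. c j \<cdot> a j, c k)"]) auto
        qed
        then have "card U \<le> card ((\<lambda>(h, e). h + e \<cdot> x) ` (?H \<times> E))" by (intro card_mono) auto
        also have "\<dots> \<le> card (?H \<times> E)" by (intro card_image_le) auto
        finally show ?thesis by (simp add: card_cartesian_product)
      qed
      ultimately have lt: "card U < card ?H * card E" by simp
      obtain n where n: "card ?H = card E ^ n" using card_closed[OF closed_lspan] .
      have "card E ^ d < card E ^ Suc n" using lt n Suc.prems by (simp add: mult.commute)
      then have "d < Suc n" using card_E_gt_1 power_strict_increasing_iff by blast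
      then have "card U \<le> card ?H" using n Suc.prems card_E_gt_1 by (simp add: power_increasing)
      then show ?thesis using HU by (intro card_seteq) auto
    qed
    then show "(a, x) \<in> ?D1" using a x aH by auto
    qed
    have 2: "(a, x) \<in> ?D" if a: "a \<in> PiE {..<k} (\<lambda>_. U)" and x: "x \<in> U" and sp: "lspan {..<k} a = U" for a x
    proof -
    have "lspan {..<k} (a(k := x)) = U" using sp lspan_cong[of "{..<k}" "a(k := x)" a] by auto
    then have "U \<subseteq> lspan (insert k {..<k}) (a(k := x))"
      using lspan_mono[of "insert k {..<k}" "{..<k}" "a(k := x)"] by auto
    moreover have "lspan (insert k {..<k}) (a(k := x)) \<subseteq> U"
      by (rule lspan_subset) (use a x Suc.prems in auto)
    ultimately show ?thesis
      using a x by auto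
    qed
    have 3: "(a, x) \<in> ?D" if H: "closed H" "H \<subseteq> U" "card H * card E = card U" and a: "a \<in> PiE {..<k} (\<lambda>_. H)"
       and aH: "lspan {..<k} a = H" and x: "x \<in> U" "x \<notin> H" for H a x
    proof -
    obtain n where n: "card H = card E ^ n" using card_closed[OF H(1)] .
    have "lspan (insert k {..<k}) (a(k := x)) = U"
      by (rule lspan_insert_eq[of _ _ _ _ n]) (use H aH n x Suc.prems in \<open>auto simp: mult.commute\<close>)
    then show ?thesis using a H x by (auto simp: PiE_iff)
    qed
    show ?thesis
    proof (intro equalityI subsetI)
      fix z assume z: "z \<in> ?D"
      obtain a x where "z = (a, x)" by (cases z)
      then show "z \<in> ?D1 \<union> (\<lambda>(H, a, x). (a, x)) ` ?D2" using z 1[of a x] by blast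
    next
      fix z assume "z \<in> ?D1 \<union> (\<lambda>(H, a, x). (a, x)) ` ?D2"
      then consider a x where "z = (a, x)" "(a, x) \<in> ?D1" | H a x where "z = (a, x)" "(H, a, x) \<in> ?D2" by auto
      then show "z \<in> ?D"
      proof cases
        case (1 a x)
        then show ?thesis using 2[of a x] by blast
      next
        case (2 H a x)
        then show ?thesis using 3[of H a x] by blast
      qed
    qed
  qed
  also have "card (?D1 \<union> (\<lambda>(H, a, x). (a, x)) ` ?D2) = card ?D1 + card ((\<lambda>(H, a, x). (a, x)) ` ?D2)"
  proof (rule card_Un_disjoint)
    show "?D1 \<inter> (\<lambda>(H, a, x). (a, x)) ` ?D2 = {}" by auto
  qed (use fF in auto)
  also have "card ((\<lambda>(H, a, x). (a, x)) ` ?D2) = card ?D2"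
    by (rule card_image) (auto simp: inj_on_def)
  also have "card ?D2 = (\<Sum>H\<in>?Hs. card (?F H \<times> (U - H)))"
    using fF by (intro card_SigmaI) auto
  finally have cA: "real (card ?A) = real (card (?F U)) * real (card U) + (\<Sum>H\<in>?Hs. real (card (?F H)) * real (card (U - H)))"
    by (simp add: card_cartesian_product)
  show ?case
  proof (cases d)
    case 0
    have "card H * card E \<noteq> 1" for H :: "'v set" using card_E_gt_1 by auto
    then have "?Hs = {}" using Suc.prems 0 by simp
    then have "(\<Sum>H\<in>?Hs. real (card (?F H)) * real (card (U - H))) = 0" by (simp only: sum.empty)
    then show ?thesis using cA Suc.IH[OF Suc.prems] Suc.prems 0 by simp
  next
    case (Suc e)
    define p where "p = (\<Prod>j<e. ?Q ^ k - ?Q ^ j)"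
    have Hs: "?Hs = {H. closed H \<and> H \<subseteq> U \<and> card H = card E ^ e}"
      using Suc.prems Suc card_E_gt_1 by (auto simp: mult.commute)
    have "(\<Sum>H\<in>?Hs. real (card (?F H)) * real (card (U - H))) = (\<Sum>H\<in>?Hs. p * (?Q ^ d - ?Q ^ e))"
    proof (rule sum.cong[OF refl])
      fix H assume "H \<in> ?Hs"
      then have H: "closed H" "H \<subseteq> U" "card H = card E ^ e" using Hs by auto
      have "card (U - H) = card U - card H" using H by (intro card_Diff_subset) auto
      moreover have "card H \<le> card U" using H by (intro card_mono) auto
      ultimately have "real (card (U - H)) = ?Q ^ d - ?Q ^ e"
        using Suc.prems H by (simp add: of_nat_diff)
      then show "real (card (?F H)) * real (card (U - H)) = p * (?Q ^ d - ?Q ^ e)"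
        using Suc.IH[OF H(1,3)] unfolding p_def by simp
    qed
    also have "\<dots> = p * ?Q ^ e * (real (card ?Hs) * (?Q - 1))" using Suc by (simp add: algebra_simps)
    also have "real (card ?Hs) * (?Q - 1) = ?Q ^ d - 1"
      unfolding Hs using hyperplane_count[of U e] Suc.prems Suc by simp
    finally have 1: "(\<Sum>H\<in>?Hs. real (card (?F H)) * real (card (U - H))) = p * ?Q ^ e * (?Q ^ d - 1)" .
    have 2: "real (card (?F U)) = p * (?Q ^ k - ?Q ^ e)"
      using Suc.IH[OF Suc.prems] Suc unfolding p_def by simp
    have "(\<Prod>j<d. ?Q ^ Suc k - ?Q ^ j) = (?Q ^ Suc k - 1) * (\<Prod>j<e. ?Q * (?Q ^ k - ?Q ^ j))"
      unfolding Suc prod.lessThan_Suc_shift by (simp add: algebra_simps)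
    also have "\<dots> = (?Q ^ Suc k - 1) * ?Q ^ e * p"
      unfolding p_def by (simp add: prod.distrib)
    finally have 3: "(\<Prod>j<d. ?Q ^ Suc k - ?Q ^ j) = (?Q ^ Suc k - 1) * ?Q ^ e * p" .
    \<comment> \<open>With \<open>Q * Q^e = Q^d\<close> the two contributions telescope:
      \<open>Q * (Q^k - Q^e) + (Q^d - 1) = Q^(k+1) - 1\<close>.\<close>
    show ?thesis unfolding cA 1 2 3 using Suc.prems Suc by (simp add: algebra_simps)
  qed
qed

end

section \<open>Roots of unity and the Moebius function\<close>

text \<open>Fermat's argument: multiplication by a nonzero \<open>x\<close> of \<open>M\<close>
  permutes \<open>M - {0}\<close>, so the product of these elements is unchanged by a factor
  \<open>x ^ card (M - {0})\<close>.\<close>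

lemma subfield_power_card:
  fixes M :: "'b::{field,finite} set"
  assumes M: "0 \<in> M" "\<And>x y. x \<in> M \<Longrightarrow> y \<in> M \<Longrightarrow> x * y \<in> M" "\<And>x. x \<in> M \<Longrightarrow> inverse x \<in> M" and x: "x \<in> M"
  shows "x ^ card M = x"
proof (cases "x = 0")
  case True
  have "finite M" by simp
  then obtain n where "card M = Suc n" using M(1) by (metis card_0_eq empty_iff not0_implies_Suc)
  then show ?thesis using True by simp
next
  case False
  have "(\<Prod>y\<in>M-{0}. x * y) = x ^ card (M - {0}) * \<Prod>(M-{0})"
    by (simp add: prod.distrib)
  moreover have "(\<Prod>y\<in>M-{0}. x * y) = (\<Prod>y\<in>M-{0}. y)"
    by (rule prod.reindex_bij_witness[of _ "\<lambda>y. inverse x * y" "\<lambda>y. x * y"])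
      (use False x M in \<open>auto simp: mult.assoc[symmetric]\<close>)
  moreover have "\<Prod>(M-{0}) \<noteq> 0" by simp
  ultimately have "x ^ card (M - {0}) = 1" by simp
  moreover have "card M = Suc (card (M - {0}))" using card_Suc_Diff1[of M 0] M(1) by (metis finite)
  ultimately show ?thesis by simp
qed

lemma card_power_eq_self_le:
  assumes "1 < n"
  shows "card {x::'b::{field,finite}. x ^ n = x} \<le> n"
proof -
  define p :: "'b poly" where "p = monom 1 n - [:0, 1:]"
  have c: "coeff p n = 1" unfolding p_def using assms by (simp add: coeff_pCons split: nat.splits)
  then have "p \<noteq> 0" by auto
  have "degree p \<le> n" unfolding p_def
    by (intro degree_diff_le) (use assms in \<open>auto simp: degree_monom_eq\<close>)
  have "{x. x ^ n = x} = {x. poly p x = 0}" unfolding p_def by (auto simp: poly_monom)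
  then show ?thesis using card_poly_roots_bound[OF \<open>p \<noteq> 0\<close>] \<open>degree p \<le> n\<close> by simp
qed

text \<open>With \<open>N = n * k\<close> the order of the multiplicative group,
  \<open>X^N - 1\<close> is \<open>X^n - 1\<close> times a polynomial with at most
  \<open>N - n\<close> roots. All \<open>N\<close> nonzero elements are roots of the product, so at
  least \<open>n\<close> of them are roots of \<open>X^n - 1\<close>; the degree bounds this from
  above.\<close>

lemma card_roots_of_unity_dvd:
  assumes "n dvd CARD('b::{field,finite}) - 1" "0 < n"
  shows "card {x::'b. x ^ n = 1} = n"
proof -
  let ?N = "CARD('b) - 1"
  have "card {0, 1::'b} \<le> CARD('b)" by (intro card_mono) auto
  then have N: "0 < ?N" by simp
  obtain k where k: "?N = n * k" using assms by auto
  then have "k > 0" using N by (cases k) auto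
  define p :: "'b poly" where "p = monom 1 n - 1"
  define r :: "'b poly" where "r = (\<Sum>i<k. monom 1 (n * i))"
  have pr: "p * r = monom 1 ?N - 1"
  proof -
    have "r = (\<Sum>i<k. (monom 1 n) ^ i)" unfolding r_def by (simp add: monom_power mult.commute)
    then have "p * r = (monom 1 n) ^ k - 1" unfolding p_def using power_diff_1_eq[of "monom 1 n :: 'b poly" k] by simp
    then show ?thesis using k by (simp add: monom_power mult.commute)
  qed
  have cp: "coeff p n = 1" unfolding p_def using assms by (simp add: coeff_1)
  then have p0: "p \<noteq> 0" by auto
  have r0: "r \<noteq> 0"
  proof
    assume "r = 0"
    then have "monom (1::'b) ?N - 1 = 0" using pr by simp
    then have "coeff (monom (1::'b) ?N - 1) ?N = 0" by simp
    then show False using N by simp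
  qed
  have dp: "degree p \<le> n" unfolding p_def by (intro degree_diff_le) (auto simp: degree_monom_eq)
  have dr: "degree r \<le> n * (k - 1)" unfolding r_def
    by (intro degree_sum_le) (auto simp: degree_monom_eq)
  have one: "x ^ ?N = 1" if "x \<noteq> 0" for x :: 'b
  proof -
    have "x ^ CARD('b) = x" using subfield_power_card[of UNIV x] by simp
    then have "x * x ^ ?N = x * 1" using N by (simp flip: power_Suc)
    then show ?thesis using that mult_left_cancel by blast
  qed
  have "UNIV - {0} \<subseteq> {x. poly p x = 0} \<union> {x. poly r x = 0}"
  proof
    fix x :: 'b assume "x \<in> UNIV - {0}"
    then have "poly (p * r) x = 0" unfolding pr using one by (simp add: poly_monom)
    then show "x \<in> {x. poly p x = 0} \<union> {x. poly r x = 0}" by auto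
  qed
  then have "card (UNIV - {0::'b}) \<le> card ({x. poly p x = 0} \<union> {x. poly r x = 0})" by (intro card_mono) auto
  also have "\<dots> \<le> card {x. poly p x = 0} + card {x. poly r x = 0}" by (rule card_Un_le)
  also have "\<dots> \<le> card {x. poly p x = 0} + n * (k - 1)" using card_poly_roots_bound[OF r0] dr by simp
  finally have "n * k \<le> card {x. poly p x = 0} + n * (k - 1)" using k by simp
  moreover have "n * k = n + n * (k - 1)" using \<open>k > 0\<close> by (cases k) auto
  ultimately have "n \<le> card {x. poly p x = 0}" by simp
  moreover have "card {x. poly p x = 0} \<le> n" using card_poly_roots_bound[OF p0] dp by simp
  moreover have "{x. poly p x = 0} = {x. x ^ n = 1}" unfolding p_def by (auto simp: poly_monom)
  ultimately show ?thesis by simp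
qed

text \<open>Squarefree divisors correspond to sets of prime factors, so the sum is the expansion of
  the product of \<open>-1 + 1\<close> over all prime factors of \<open>n\<close>.\<close>

lemma sum_moebius_divisors:
  assumes "0 < n"
  shows "(\<Sum>d | d dvd n. moebius d) = (if n = 1 then 1 else 0)"
proof -
  let ?P = "prime_factors n"
  have "(\<Sum>d | d dvd n. moebius d) = (\<Sum>d | d dvd n \<and> squarefree d. moebius d)"
    using assms by (intro sum.mono_neutral_right) (auto simp: moebius_def)
  also have "\<dots> = (\<Sum>X\<in>Pow ?P. (-1) ^ card X)"
  proof (rule sum.reindex_bij_witness[of _ "\<lambda>X. \<Prod>X" prime_factors])
    fix d assume d: "d \<in> {d. d dvd n \<and> squarefree d}"
    then have "d \<noteq> 0" using assms by auto
    have "(\<Prod>p\<in>prime_factors d. p ^ multiplicity p d) = d"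
      using prod_prime_factors[OF \<open>d \<noteq> 0\<close>] by simp
    moreover have "(\<Prod>p\<in>prime_factors d. p ^ multiplicity p d) = (\<Prod>p\<in>prime_factors d. p)"
    proof (rule prod.cong[OF refl])
      fix p assume p: "p \<in> prime_factors d"
      then have "multiplicity p d \<le> 1" using d squarefree_factorial_semiring'[of d] \<open>d \<noteq> 0\<close> by auto
      moreover have "multiplicity p d > 0" using p \<open>d \<noteq> 0\<close> by (simp add: prime_factors_multiplicity)
      ultimately show "p ^ multiplicity p d = p" by (cases "multiplicity p d") auto
    qed
    ultimately show "\<Prod>(prime_factors d) = d" by simp
    show "prime_factors d \<in> Pow ?P" using d assms dvd_prime_factors[of n d] by auto
    show "(-1) ^ card (prime_factors d) = moebius d" using d by (simp add: moebius_def)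
  next
    fix X assume X: "X \<in> Pow ?P"
    then have fX: "finite X" and pX: "\<And>p. p \<in> X \<Longrightarrow> prime p" using finite_subset by (auto simp: in_prime_factors_iff)
    have *: "prime_factorization (\<Prod>X) = mset_set X"
    proof -
      have "prime_factorization (prod_mset (mset_set X)) = mset_set X"
        using pX fX by (intro prime_factorization_prod_mset_primes) auto
      then show ?thesis by (simp add: prod_unfold_prod_mset)
    qed
    show "prime_factors (\<Prod>X) = X" using * fX by simp
    have "0 \<notin> X" using pX not_prime_0 by blast
    then have nz: "\<Prod>X \<noteq> 0" using fX by simp
    have "squarefree (\<Prod>X)"
    proof (rule squarefree_prod_coprime)
      show "coprime a b" if "a \<in> X" "b \<in> X" "a \<noteq> b" for a b
        using that pX primes_coprime by blast
      show "squarefree a" if "a \<in> X" for a using that pX squarefree_prime by auto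
    qed
    moreover have "\<Prod>X dvd n"
    proof (rule prime_factorization_subset_imp_dvd[OF nz])
      have "mset_set X \<subseteq># mset_set ?P" using X fX by (intro subset_imp_msubset_mset_set) auto
      also have "\<dots> \<subseteq># prime_factorization n" by (rule mset_set_set_mset_msubset)
      finally show "prime_factorization (\<Prod>X) \<subseteq># prime_factorization n" using * by simp
    qed
    ultimately show "\<Prod>X \<in> {d. d dvd n \<and> squarefree d}" by simp
  qed
  also have "\<dots> = (\<Prod>p\<in>?P. -1 + 1)"
  proof -
    have "(\<Prod>p\<in>?P. -1 + (1::int)) = (\<Sum>X\<in>Pow ?P. (\<Prod>p\<in>X. -1) * (\<Prod>p\<in>?P - X. 1))"
      by (subst prod_add) auto
    then show ?thesis by simp
  qed
  also have "\<dots> = (if n = 1 then 1 else 0)"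
  proof (cases "?P = {}")
    case True
    then have "prime_factorization n = {#}" by simp
    then have "n = 1" using assms unfolding prime_factorization_empty_iff by simp
    then show ?thesis by simp
  next
    case False
    then have "n \<noteq> 1" by auto
    then show ?thesis using False by (simp add: power_0_left)
  qed
  finally show ?thesis .
qed

section \<open>Subfields and orbits of the Singer cycle\<close>

locale finite_field_extension =
  fixes emb :: "'a::{field,finite} \<Rightarrow> 'b::{field,finite}" and q l :: nat
  assumes q: "primepow q" and card_a: "CARD('a) = q" and card_b: "CARD('b) = q ^ l"
    and emb: "field_embedding emb"
begin

lemma q_gt_1: "1 < q"
  using q primepow_gt_Suc_0 by simp

lemma q_power_gt_1: "0 < t \<Longrightarrow> 1 < q ^ t"
  using one_less_power[OF q_gt_1] by blast

lemma l_pos: "0 < l"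
proof (rule ccontr)
  assume "\<not> 0 < l"
  then have "CARD('b) = 1" using card_b by simp
  then obtain x where "(UNIV :: 'b set) = {x}" by (rule card_1_singletonE)
  then have "(0::'b) = 1" by (metis UNIV_I singletonD)
  then show False by simp
qed

lemma emb_1: "emb 1 = 1" and emb_add: "emb (x + y) = emb x + emb y" and emb_mult: "emb (x * y) = emb x * emb y"
  using emb by (auto simp: field_embedding_def)

lemma emb_0: "emb 0 = 0"
  using emb_add[of 0 0] by (metis add_cancel_right_right add_0)

lemma emb_diff: "emb (x - y) = emb x - emb y"
  using emb_add[of "x - y" y] by (simp add: algebra_simps)

lemma emb_inverse: "emb (inverse x) = inverse (emb x)"
proof (cases "x = 0")
  case False
  then have "emb x * emb (inverse x) = 1" using emb_mult[of x "inverse x"] emb_1 by simp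
  then show ?thesis by (metis inverse_unique)
qed (simp add: emb_0)

lemma inj_emb: "inj emb"
proof (rule injI)
  fix x y assume eq: "emb x = emb y"
  show "x = y"
  proof (rule ccontr)
    assume "x \<noteq> y"
    then have "emb ((x - y) * inverse (x - y)) = 1" by (simp add: emb_1)
    then show False using eq by (simp add: emb_mult emb_diff)
  qed
qed

lemma subfield_range_emb: "vector_space sc \<Longrightarrow> subfield_space sc (range emb)"
  by (unfold_locales) (auto simp: vector_space_def module_def image_iff simp flip: emb_1 emb_diff emb_mult emb_inverse)

lemma vector_space_times: "vector_space ((*) :: 'b \<Rightarrow> 'b \<Rightarrow> 'b)"
  by unfold_locales (auto simp: algebra_simps)

lemma card_range_emb: "card (range emb) = q"
  using card_image[OF inj_emb] card_a by simp

sublocale FL: subfield_space "(*)" "range emb"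
  by (rule subfield_range_emb[OF vector_space_times])

section \<open>The intermediate fields\<close>

text \<open>The fixed points of a power of the Frobenius map. For \<open>t dvd l\<close> this is the
  subfield with \<open>q ^ t\<close> elements.\<close>

definition GF :: "nat \<Rightarrow> 'b set" where
  "GF t = {x. x ^ (q ^ t) = x}"

text \<open>Powers of the characteristic are the exponents for which taking powers is additive.
  Translation by 1 permutes the field, so \<open>CARD('b)\<close> vanishes in it; hence the
  characteristic divides a power of the prime below \<open>q\<close>.\<close>

lemma char_power: obtains n where "q ^ t = CHAR('b) ^ n"
proof -
  obtain p e where pe: "prime p" "e > 0" "q = p ^ e" using q unfolding primepow_def by auto
  have "CHAR('b) > 0" by (rule finite_imp_CHAR_pos) simp
  then have "prime CHAR('b)" by (rule prime_CHAR_semidom)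
  have "(\<Sum>x\<in>(UNIV :: 'b set). x + 1) = (\<Sum>x\<in>UNIV. x)"
    by (rule sum.reindex_bij_witness[of _ "\<lambda>x. x - 1" "\<lambda>x. x + 1"]) auto
  then have "of_nat CARD('b) = (0 :: 'b)" by (simp add: sum.distrib)
  then have "CHAR('b) dvd CARD('b)" by (simp only: of_nat_eq_0_iff_char_dvd)
  then have "CHAR('b) dvd p ^ (e * l)" using card_b pe by (simp add: power_mult)
  then have "CHAR('b) dvd p" using \<open>prime CHAR('b)\<close> prime_dvd_power by blast
  then have "CHAR('b) = p" using pe \<open>prime CHAR('b)\<close> primes_dvd_imp_eq by blast
  then have "q ^ t = CHAR('b) ^ (e * t)" using pe by (simp add: power_mult)
  then show ?thesis by (rule that)
qed

lemma GF_diff: "x \<in> GF t \<Longrightarrow> y \<in> GF t \<Longrightarrow> x - y \<in> GF t"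
proof -
  assume x: "x \<in> GF t" and y: "y \<in> GF t"
  obtain n where n: "q ^ t = CHAR('b) ^ n" by (rule char_power)
  have "CHAR('b) > 0" by (rule finite_imp_CHAR_pos) simp
  then have "prime CHAR('b)" by (rule prime_CHAR_semidom)
  then have "((x - y) + y) ^ (q ^ t) = (x - y) ^ (q ^ t) + y ^ (q ^ t)" using n by (rule freshmans_dream')
  then show ?thesis using x y unfolding GF_def by (simp add: algebra_simps)
qed

lemma subfield_GF: "vector_space sc \<Longrightarrow> subfield_space sc (GF t)"
proof -
  assume "vector_space sc"
  then interpret vector_space sc .
  show ?thesis
  proof
    show "x \<in> GF t \<Longrightarrow> y \<in> GF t \<Longrightarrow> x - y \<in> GF t" for x y by (rule GF_diff)
  qed (auto simp: GF_def power_mult_distrib power_inverse)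
qed

lemma GF_mono: "s dvd t \<Longrightarrow> GF s \<subseteq> GF t"
proof
  fix x assume "s dvd t" and x: "x \<in> GF s"
  then obtain k where k: "t = s * k" by auto
  have "x ^ (q ^ (s * k)) = x"
  proof (induction k)
    case (Suc k)
    have "x ^ (q ^ (s * Suc k)) = (x ^ (q ^ s)) ^ (q ^ (s * k))"
      by (simp add: power_add flip: power_mult)
    then show ?case using x Suc by (simp add: GF_def)
  qed simp
  then show "x \<in> GF t" using k by (simp add: GF_def)
qed

lemma power_minus_1_dvd: "s dvd t \<Longrightarrow> q ^ s - 1 dvd q ^ t - (1::nat)"
proof -
  assume "s dvd t"
  then obtain k where "t = s * k" by auto
  have "int (q ^ s) - 1 dvd int (q ^ s) ^ k - 1"
    using power_diff_1_eq[of "int (q ^ s)" k] by simp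
  moreover have "int (q ^ s - 1) = int (q ^ s) - 1" "int (q ^ t - 1) = int (q ^ s) ^ k - 1"
    using q_gt_1 \<open>t = s * k\<close> by (auto simp: of_nat_diff power_mult)
  ultimately show ?thesis by (metis of_nat_dvd_iff)
qed

text \<open>The nonzero elements are the roots of unity of order dividing \<open>q^t - 1\<close>.
  Since \<open>t dvd l\<close> gives \<open>q^t - 1 dvd q^l - 1\<close>, the large field contains
  all of them.\<close>

lemma card_GF: "t dvd l \<Longrightarrow> card (GF t) = q ^ t"
proof -
  assume "t dvd l"
  then have "0 < t" using l_pos by (auto intro: Nat.gr0I)
  then have 1: "1 < q ^ t" by (rule q_power_gt_1)
  have e: "GF t = insert 0 {x. x ^ (q ^ t - 1) = 1}"
  proof -
    have "x ^ (q ^ t) = x \<longleftrightarrow> x = 0 \<or> x ^ (q ^ t - 1) = 1" for x :: 'b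
    proof -
      have "q ^ t = Suc (q ^ t - 1)" using 1 by simp
      then have "x ^ (q ^ t) = x * x ^ (q ^ t - 1)" by (metis power_Suc)
      then show ?thesis by auto
    qed
    then show ?thesis unfolding GF_def by auto
  qed
  have "q ^ t - 1 dvd CARD('b) - 1" unfolding card_b by (rule power_minus_1_dvd) fact
  then have "card {x::'b. x ^ (q ^ t - 1) = 1} = q ^ t - 1"
    using 1 by (intro card_roots_of_unity_dvd) auto
  moreover have "0 \<notin> {x::'b. x ^ (q ^ t - 1) = 1}" using 1 by (simp add: power_0_left)
  ultimately show ?thesis unfolding e using 1 by simp
qed

text \<open>All elements of \<open>M\<close> are roots of \<open>X^(q^t) - X\<close>, which has at
  most \<open>q^t\<close> roots; so a subfield is determined by its order.\<close>

lemma subfield_eq_GF: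
  assumes "subfield_space ((*) :: 'b \<Rightarrow> 'b \<Rightarrow> 'b) M" "card M = q ^ t" "0 < t"
  shows "M = GF t"
proof -
  interpret M: subfield_space "(*) :: 'b \<Rightarrow> 'b \<Rightarrow> 'b" M by fact
  have "M \<subseteq> GF t"
  proof
    fix x assume "x \<in> M"
    then have "x ^ card M = x"
      by (intro subfield_power_card) (auto simp: M.zero_E M.mult_E M.inverse_E)
    then show "x \<in> GF t" using assms by (simp add: GF_def)
  qed
  moreover have "card (GF t) \<le> card M"
    unfolding GF_def assms(2) by (intro card_power_eq_self_le q_power_gt_1 assms(3))
  ultimately show ?thesis by (intro card_seteq) auto
qed

section \<open>Stabilizers of subspaces\<close>

definition stab :: "'b set \<Rightarrow> 'b set" where
  "stab U = {c. \<forall>x\<in>U. c * x \<in> U}"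

lemma stab_image: "c \<in> stab U \<Longrightarrow> c \<noteq> 0 \<Longrightarrow> (*) c ` U = U"
proof (rule card_subset_eq)
  assume "c \<in> stab U"
  then show "(*) c ` U \<subseteq> U" unfolding stab_def by blast
next
  assume "c \<noteq> 0"
  then have "inj_on ((*) c) U" by (simp add: inj_on_def)
  then show "card ((*) c ` U) = card U" by (rule card_image)
qed simp

lemma subfield_stab:
  assumes "FL.closed U" "U \<noteq> {0}"
  shows "subfield_space ((*) :: 'b \<Rightarrow> 'b \<Rightarrow> 'b) (stab U)"
proof -
  interpret vector_space "(*) :: 'b \<Rightarrow> 'b \<Rightarrow> 'b" by (rule vector_space_times)
  show ?thesis
  proof
    show "x - y \<in> stab U" if "x \<in> stab U" "y \<in> stab U" for x y
      using that FL.closed_diff[OF assms(1)] unfolding stab_def by (auto simp: left_diff_distrib)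
    show "inverse x \<in> stab U" if x: "x \<in> stab U" for x
    proof (cases "x = 0")
      case True
      then show ?thesis using x by simp
    next
      case False
      have "(*) x ` U = U" by (rule stab_image) fact+
      then have "inverse x * y \<in> U" if "y \<in> U" for y
        using that False by (metis (no_types, lifting) imageE mult.assoc left_inverse mult_1)
      then show ?thesis by (simp add: stab_def)
    qed
  qed (auto simp: stab_def mult.assoc)
qed

lemma range_emb_subset_stab: "FL.closed U \<Longrightarrow> range emb \<subseteq> stab U"
  unfolding FL.closed_def stab_def by blast

text \<open>The stabilizer is a field containing the small field, hence has \<open>q ^ u\<close>
  elements. Both \<open>U\<close> and the large field are vector spaces over it, which yields the
  two divisibilities.\<close>

lemma dim_stab:
  assumes "FL.closed U" "card U = q ^ d" "0 < d"
  obtains u where "u dvd d" "u dvd l" "0 < u" "stab U = GF u"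
proof -
  have U0: "U \<noteq> {0}"
  proof
    assume "U = {0}"
    then have "card U = 1" by simp
    then show False using assms q_gt_1 by simp
  qed
  interpret M: subfield_space "(*) :: 'b \<Rightarrow> 'b \<Rightarrow> 'b" "stab U" by (rule subfield_stab) fact+
  have "FL.closed (stab U)" unfolding FL.closed_def
    using subsetD[OF range_emb_subset_stab[OF assms(1)] rangeI] M.zero_E M.add_E M.mult_E by auto
  then obtain u where u: "card (stab U) = q ^ u" using FL.card_closed card_range_emb by metis
  have u0: "0 < u"
  proof (rule ccontr)
    assume "\<not> 0 < u"
    then show False using u M.card_E_gt_1 by simp
  qed
  have div: "u dvd n" if W: "M.closed W" "card W = q ^ n" for W n
  proof -
    obtain k where "card W = card (stab U) ^ k" by (rule M.card_closed[OF W(1)])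
    then have "q ^ n = q ^ (u * k)" using W u by (simp add: power_mult)
    then have "n = u * k" using q_gt_1 by (simp add: power_inject_exp)
    then show ?thesis by simp
  qed
  have "M.closed U" using assms(1) unfolding M.closed_def FL.closed_def by (auto simp: stab_def)
  then have "u dvd d" using assms(2) div by blast
  moreover have "u dvd l" using div[of UNIV l] M.closed_UNIV card_b by simp
  moreover have "stab U = GF u" by (rule subfield_eq_GF) (use u u0 in \<open>auto intro: M.subfield_space_axioms\<close>)
  ultimately show ?thesis using u0 that by blast
qed

text \<open>A field is a vector space over each of its subfields, so its order is a power of
  theirs.\<close>

lemma GF_subset_iff:
  assumes "s dvd l" "t dvd l"
  shows "GF s \<subseteq> GF t \<longleftrightarrow> s dvd t"
proof
  assume sub: "GF s \<subseteq> GF t"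
  interpret S: subfield_space "(*) :: 'b \<Rightarrow> 'b \<Rightarrow> 'b" "GF s" by (rule subfield_GF[OF vector_space_times])
  interpret T: subfield_space "(*) :: 'b \<Rightarrow> 'b \<Rightarrow> 'b" "GF t" by (rule subfield_GF[OF vector_space_times])
  have "S.closed (GF t)" unfolding S.closed_def using sub T.zero_E T.add_E T.mult_E by auto
  then obtain k where "card (GF t) = card (GF s) ^ k" by (rule S.card_closed)
  then have "q ^ t = q ^ (s * k)" using assms by (simp add: card_GF power_mult)
  then show "s dvd t" using q_gt_1 by (simp add: power_inject_exp)
qed (rule GF_mono)

section \<open>Moebius inversion over the subfields\<close>

definition subspaces :: "nat \<Rightarrow> 'b set set" where
  "subspaces d = {U. FL.closed U \<and> card U = q ^ d}"

definition typed_subspaces :: "nat \<Rightarrow> nat \<Rightarrow> 'b set set" where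
  "typed_subspaces d u = {U \<in> subspaces d. stab U = GF u}"

text \<open>The hypothesis is what counting ordered bases yields. Taking \<open>Q^i\<close> out of
  every factor and reversing the order of the factors on the left turns it into the product
  formula.\<close>

lemma gauss_binomial_unique:
  fixes n Q :: real
  assumes "n * (\<Prod>i<b. Q ^ b - Q ^ i) = (\<Prod>i<b. Q ^ a - Q ^ i)" "b \<le> a" "1 < Q"
  shows "n = gauss_binomial Q a b"
proof -
  have f: "(\<Prod>i<b. Q ^ c - Q ^ i) = (\<Prod>i<b. Q ^ i) * (\<Prod>i<b. Q ^ (c - i) - 1)" if "b \<le> c" for c
    unfolding prod.distrib[symmetric]
    by (rule prod.cong) (use that in \<open>auto simp: algebra_simps simp flip: power_add\<close>)
  have r: "(\<Prod>i<b. Q ^ (b - i) - 1) = (\<Prod>i<b. Q ^ (i + 1) - 1)"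
    by (rule prod.reindex_bij_witness[of _ "\<lambda>i. b - 1 - i" "\<lambda>i. b - 1 - i"])
      (auto simp: Suc_diff_Suc simp flip: power_Suc)
  have nz: "(\<Prod>i<b. Q ^ i) \<noteq> 0" using assms(3) by auto
  have nz2: "(\<Prod>i<b. Q ^ (i + 1) - 1) \<noteq> 0"
  proof -
    have "1 < Q ^ (i + 1)" for i using assms(3) by (intro one_less_power) auto
    then have "Q ^ (i + 1) - 1 \<noteq> 0" for i by (metis less_irrefl right_minus_eq)
    then show ?thesis by simp
  qed
  have "(\<Prod>i<b. Q ^ i) * (n * (\<Prod>i<b. Q ^ (i + 1) - 1)) = (\<Prod>i<b. Q ^ i) * (\<Prod>i<b. Q ^ (a - i) - 1)"
    using assms(1) unfolding f[OF order_refl] f[OF assms(2)] r by (simp only: ac_simps)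
  then have "n * (\<Prod>i<b. Q ^ (i + 1) - 1) = (\<Prod>i<b. Q ^ (a - i) - 1)" using nz by simp
  then show ?thesis unfolding gauss_binomial_def prod_dividef using nz2 by (simp add: field_simps)
qed

text \<open>A subspace stabilized by \<open>GF t\<close> is the same as a subspace over
  \<open>GF t\<close>. Over that field the dimensions \<open>d\<close> and \<open>l\<close> become
  \<open>d div t\<close> and \<open>l div t\<close>.\<close>

lemma card_GF_subspaces:
  assumes "t dvd gcd d l" "d \<le> l"
  shows "real (card {U \<in> subspaces d. GF t \<subseteq> stab U}) = gauss_binomial (real q ^ t) (l div t) (d div t)"
proof -
  have t: "t dvd l" "t dvd d" "t \<noteq> 0" using assms l_pos by auto
  interpret T: subfield_space "(*) :: 'b \<Rightarrow> 'b \<Rightarrow> 'b" "GF t" by (rule subfield_GF[OF vector_space_times])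
  have emb_GF: "emb e \<in> GF t" for e
  proof -
    have "range emb = GF 1" using subfield_eq_GF[OF FL.subfield_space_axioms, of 1] card_range_emb by simp
    then have "emb e \<in> GF 1" by blast
    then show ?thesis using GF_mono[of 1 t] by auto
  qed
  then have "{U \<in> subspaces d. GF t \<subseteq> stab U} = {U. T.closed U \<and> U \<subseteq> UNIV \<and> card U = card (GF t) ^ (d div t)}"
    unfolding subspaces_def FL.closed_def T.closed_def stab_def card_GF[OF t(1)] power_mult[symmetric]
    using t emb_GF by auto
  moreover have "CARD('b) = card (GF t) ^ (l div t)" using t by (simp add: card_GF card_b flip: power_mult)
  ultimately have "real (card {U \<in> subspaces d. GF t \<subseteq> stab U}) * (\<Prod>i<d div t. (real q ^ t) ^ (d div t) - (real q ^ t) ^ i)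
     = (\<Prod>i<d div t. (real q ^ t) ^ (l div t) - (real q ^ t) ^ i)"
    using T.closed_count[OF T.closed_UNIV, of "d div t"] t by (simp add: card_GF)
  then show ?thesis
  proof (rule gauss_binomial_unique)
    show "d div t \<le> l div t" using assms(2) by (rule div_le_mono)
    show "1 < real q ^ t" using q_gt_1 t(3) by (intro one_less_power) auto
  qed
qed

text \<open>The subspaces are sorted by their exact stabilizer \<open>GF s\<close>, which contains
  \<open>GF t\<close> iff \<open>t dvd s\<close>.\<close>

lemma card_GF_subspaces_eq_sum:
  assumes "t dvd gcd d l" "0 < d"
  shows "card {U \<in> subspaces d. GF t \<subseteq> stab U} = (\<Sum>s | t dvd s \<and> s dvd gcd d l. card (typed_subspaces d s))"
proof -
  let ?I = "{s. t dvd s \<and> s dvd gcd d l}"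
  have fin: "finite ?I" 
  proof (rule finite_subset)
    show "?I \<subseteq> {s. s dvd gcd d l}" by blast
    show "finite {s. s dvd gcd d l}" using assms(2) by (intro finite_divisors_nat) simp
  qed
  have "{U \<in> subspaces d. GF t \<subseteq> stab U} = (\<Union>s\<in>?I. typed_subspaces d s)"
  proof (intro equalityI subsetI)
    fix U assume U: "U \<in> {U \<in> subspaces d. GF t \<subseteq> stab U}"
    then have "FL.closed U" "card U = q ^ d" by (auto simp: subspaces_def)
    then obtain u where u: "u dvd d" "u dvd l" "0 < u" "stab U = GF u"
      by (rule dim_stab[OF _ _ assms(2)])
    then have "t dvd u" using U GF_subset_iff[of t u] assms by auto
    then show "U \<in> (\<Union>s\<in>?I. typed_subspaces d s)" using u U by (auto simp: typed_subspaces_def)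
  next
    fix U assume "U \<in> (\<Union>s\<in>?I. typed_subspaces d s)"
    then show "U \<in> {U \<in> subspaces d. GF t \<subseteq> stab U}" using GF_mono by (auto simp: typed_subspaces_def)
  qed
  moreover have "card (\<Union>s\<in>?I. typed_subspaces d s) = (\<Sum>s\<in>?I. card (typed_subspaces d s))"
  proof (rule card_UN_disjoint)
    show "\<forall>i\<in>?I. \<forall>j\<in>?I. i \<noteq> j \<longrightarrow> typed_subspaces d i \<inter> typed_subspaces d j = {}"
    proof (intro ballI impI equals0I)
      fix i j U assume ij: "i \<in> ?I" "j \<in> ?I" "i \<noteq> j" "U \<in> typed_subspaces d i \<inter> typed_subspaces d j"
      then have "GF i = GF j" by (auto simp: typed_subspaces_def)
      then have "i dvd j" "j dvd i" using GF_subset_iff[of i j] GF_subset_iff[of j i] ij by auto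
      then show False using ij dvd_antisym by blast
    qed
  qed (use fin in auto)
  ultimately show ?thesis by simp
qed

text \<open>After the binomials are replaced by sums over exact stabilizers \<open>GF s\<close> and
  the two sums are exchanged, the coefficient at \<open>s\<close> is the sum of the Moebius function
  over the divisors of \<open>s div u\<close>. It vanishes unless \<open>s = u\<close>.\<close>

lemma card_typed_subspaces:
  assumes "u dvd gcd d l" "0 < d" "d \<le> l"
  shows "real (card (typed_subspaces d u)) =
    (\<Sum>t | u dvd t \<and> t dvd gcd d l. of_int (moebius (t div u)) * gauss_binomial (real q ^ t) (l div t) (d div t))"
proof -
  let ?g = "gcd d l"
  have g: "0 < ?g" using assms by simp
  have u: "0 < u" using assms by (auto intro: Nat.gr0I)
  let ?I = "\<lambda>u. {t. u dvd t \<and> t dvd ?g}"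
  let ?f = "\<lambda>s. real (card (typed_subspaces d s))"
  have fin: "finite (?I u)" for u
  proof (rule finite_subset)
    show "?I u \<subseteq> {s. s dvd ?g}" by blast
    show "finite {s. s dvd ?g}" using g by (intro finite_divisors_nat)
  qed
  have "(\<Sum>t\<in>?I u. of_int (moebius (t div u)) * gauss_binomial (real q ^ t) (l div t) (d div t)) =
    (\<Sum>t\<in>?I u. \<Sum>s\<in>?I t. of_int (moebius (t div u)) * ?f s)"
  proof (rule sum.cong[OF refl])
    fix t assume t: "t \<in> ?I u"
    have "gauss_binomial (real q ^ t) (l div t) (d div t) = (\<Sum>s\<in>?I t. ?f s)"
      using card_GF_subspaces[of t d] card_GF_subspaces_eq_sum[of t d] t assms by simp
    then show "of_int (moebius (t div u)) * gauss_binomial (real q ^ t) (l div t) (d div t) =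
      (\<Sum>s\<in>?I t. of_int (moebius (t div u)) * ?f s)" by (simp add: sum_distrib_left)
  qed
  also have "\<dots> = (\<Sum>t\<in>?I u. \<Sum>s\<in>{s \<in> ?I u. t dvd s}. of_int (moebius (t div u)) * ?f s)"
  proof (rule sum.cong[OF refl])
    fix t assume "t \<in> ?I u"
    then have "u dvd t" by simp
    then have "?I t = {s \<in> ?I u. t dvd s}" using dvd_trans[OF \<open>u dvd t\<close>] by blast
    then show "(\<Sum>s\<in>?I t. of_int (moebius (t div u)) * ?f s) = (\<Sum>s\<in>{s \<in> ?I u. t dvd s}. of_int (moebius (t div u)) * ?f s)"
      by simp
  qed
  also have "\<dots> = (\<Sum>s\<in>?I u. \<Sum>t\<in>{t \<in> ?I u. t dvd s}. of_int (moebius (t div u)) * ?f s)"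
    by (rule sum.swap_restrict) (use fin in auto)
  also have "\<dots> = (\<Sum>s\<in>?I u. ?f s * of_int (\<Sum>t\<in>{t \<in> ?I u. t dvd s}. moebius (t div u)))"
    by (simp add: sum_distrib_left mult.commute)
  also have "\<dots> = (\<Sum>s\<in>?I u. ?f s * (if s = u then 1 else 0))"
  proof (rule sum.cong[OF refl])
    fix s assume s: "s \<in> ?I u"
    then obtain k where k: "s = u * k" by auto
    have "s \<noteq> 0" using s g by (metis (mono_tags, lifting) dvd_0_left_iff mem_Collect_eq less_irrefl)
    then have "0 < k" using k by (auto intro: Nat.gr0I)
    have "(\<Sum>t\<in>{t \<in> ?I u. t dvd s}. moebius (t div u)) = (\<Sum>e | e dvd k. moebius e)"
    proof (rule sum.reindex_bij_witness[of _ "\<lambda>e. u * e" "\<lambda>t. t div u"])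
      fix t assume t: "t \<in> {t \<in> ?I u. t dvd s}"
      then show "u * (t div u) = t" by simp
      show "t div u \<in> {e. e dvd k}" using t u k by auto
    next
      fix e assume e: "e \<in> {e. e dvd k}"
      then have "u * e dvd s" using k by simp
      moreover have "s dvd gcd d l" using s by blast
      ultimately have "u * e dvd gcd d l" by (rule dvd_trans)
      then show "u * e \<in> {t \<in> ?I u. t dvd s}" using \<open>u * e dvd s\<close> dvd_triv_left[of u e] by blast
      show "u * e div u = e" using u by simp
    qed simp
    also have "\<dots> = (if s = u then 1 else 0)" using sum_moebius_divisors[OF \<open>0 < k\<close>] k u by auto
    finally show "?f s * of_int (\<Sum>t\<in>{t \<in> ?I u. t dvd s}. moebius (t div u)) = ?f s * (if s = u then 1 else 0)"
      by simp
  qed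
  also have "\<dots> = ?f u" using fin assms by (simp add: if_distrib[of "\<lambda>x. _ * x"] cong: if_cong)
  finally show ?thesis ..
qed

section \<open>Orbits of the Singer cycle\<close>

lemma times_image_times_image: "(*) a ` (*) b ` U = (*) (a * b :: 'b) ` U"
  unfolding image_image by (rule image_cong[OF refl]) (simp only: mult.assoc)

text \<open>Orbit-stabilizer: the scalars that map \<open>U\<close> to the same image
  \<open>W\<close> as \<open>c0\<close> form the coset \<open>c0 * e\<close> with \<open>e\<close>
  in \<open>GF u - {0}\<close>.\<close>

lemma card_stab_orbit:
  assumes "U \<in> typed_subspaces d u" "u dvd l"
  shows "card ((\<lambda>c. (*) c ` U) ` (UNIV - {0})) * (q ^ u - 1) = q ^ l - 1"
proof -
  let ?h = "\<lambda>c. (*) c ` U"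
  have stab: "stab U = GF u" using assms by (simp add: typed_subspaces_def)
  have fib: "card {c \<in> UNIV - {0}. ?h c = W} = q ^ u - 1" if "W \<in> ?h ` (UNIV - {0})" for W
  proof -
    obtain c0 where c0: "c0 \<noteq> 0" "W = ?h c0" using \<open>W \<in> _\<close> by auto
    have "bij_betw ((*) c0) (GF u - {0}) {c \<in> UNIV - {0}. ?h c = W}"
    proof (rule bij_betw_byWitness[where f' = "\<lambda>c. c / c0"])
      show "(*) c0 ` (GF u - {0}) \<subseteq> {c \<in> UNIV - {0}. ?h c = W}"
      proof (rule image_subsetI)
        fix e assume "e \<in> GF u - {0}"
        then have e: "e \<in> GF u" "e \<noteq> 0" by auto
        have eU: "(*) e ` U = U" by (rule stab_image) (use e stab in auto)
        have "?h (c0 * e) = (*) c0 ` ((*) e ` U)" by (simp only: times_image_times_image)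
        then have "?h (c0 * e) = W" unfolding c0 eU .
        then show "c0 * e \<in> {c \<in> UNIV - {0}. ?h c = W}" using c0 e by simp
      qed
      show "(\<lambda>c. c / c0) ` {c \<in> UNIV - {0}. ?h c = W} \<subseteq> GF u - {0}"
      proof (rule image_subsetI)
        fix c assume "c \<in> {c \<in> UNIV - {0}. ?h c = W}"
        then have c: "c \<noteq> 0" "?h c = W" by auto
        have "c / c0 * x \<in> U" if "x \<in> U" for x
        proof -
          have "c * x \<in> W" using c that by auto
          then obtain y where "y \<in> U" "c * x = c0 * y" unfolding c0 by auto
          then have "c / c0 * x = y" using c0 by (simp add: field_simps)
          then show ?thesis using \<open>y \<in> U\<close> by simp
        qed
        then show "c / c0 \<in> GF u - {0}" using c c0 unfolding stab[symmetric] stab_def by auto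
      qed
    qed (use c0 in auto)
    then have "card {c \<in> UNIV - {0}. ?h c = W} = card (GF u - {0})" by (simp add: bij_betw_same_card)
    also have "\<dots> = q ^ u - 1" using card_GF[OF assms(2)] q_gt_1 by (simp add: GF_def power_0_left)
    finally show ?thesis .
  qed
  have "q ^ l - 1 = card (UNIV - {0::'b})" using card_b by simp
  also have "UNIV - {0::'b} = (\<Union>W\<in>?h ` (UNIV - {0}). {c \<in> UNIV - {0}. ?h c = W})" by auto
  also have "card \<dots> = (\<Sum>W\<in>?h ` (UNIV - {0}). card {c \<in> UNIV - {0}. ?h c = W})"
    by (rule card_UN_disjoint) auto
  also have "\<dots> = card (?h ` (UNIV - {0})) * (q ^ u - 1)" using fib by simp
  finally show ?thesis ..
qed


lemma closed_times_image: "FL.closed U \<Longrightarrow> FL.closed ((*) c ` U)"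
  unfolding FL.closed_def
proof (intro conjI ballI; elim conjE)
  assume "0 \<in> U"
  then show "0 \<in> (*) c ` U" by (intro image_eqI[of _ _ 0]) auto
next
  fix x y assume "\<forall>x\<in>U. \<forall>y\<in>U. x + y \<in> U" "x \<in> (*) c ` U" "y \<in> (*) c ` U"
  then show "x + y \<in> (*) c ` U" by (auto simp flip: distrib_left)
next
  fix e x assume "\<forall>e\<in>range emb. \<forall>x\<in>U. e * x \<in> U" "e \<in> range emb" "x \<in> (*) c ` U"
  then show "e * x \<in> (*) c ` U" by (auto simp: mult.left_commute[of _ c])
qed

lemma stab_times_image: "c \<noteq> 0 \<Longrightarrow> stab ((*) c ` U) = stab U"
proof -
  assume c: "c \<noteq> 0"
  have "e * (c * x) \<in> (*) c ` U \<longleftrightarrow> e * x \<in> U" for e x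
    using c by (auto simp: mult.left_commute[of e c])
  then show ?thesis unfolding stab_def by auto
qed

lemma typed_subspaces_times:
  "U \<in> typed_subspaces d u \<Longrightarrow> c \<noteq> 0 \<Longrightarrow> (*) c ` U \<in> typed_subspaces d u"
  by (simp add: typed_subspaces_def subspaces_def closed_times_image stab_times_image card_image inj_on_def)

text \<open>All orbits of subspaces with stabilizer \<open>GF u\<close> have the same size, so
  \<open>orbit_number\<close> is indeed the number of these orbits; \<open>X\<close> is the union of
  any \<open>w\<close> of them.\<close>

lemma obtain_invariant_subspaces:
  assumes "u dvd gcd d l" "0 < d" "d \<le> l" "0 \<le> w" "of_int w \<le> orbit_number q l d u"
  obtains X where "X \<subseteq> typed_subspaces d u" "\<And>U c. U \<in> X \<Longrightarrow> c \<noteq> 0 \<Longrightarrow> (*) c ` U \<in> X"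
    "real (card X) * (real q ^ u - 1) = of_int w * (real q ^ l - 1)"
proof -
  let ?T = "typed_subspaces d u"
  let ?orb = "\<lambda>U :: 'b set. (\<lambda>c. (*) c ` U) ` (UNIV - {0})"
  have u: "u dvd l" "0 < u" using assms by (auto intro: Nat.gr0I)
  have q1: "1 < q ^ u" "1 < q ^ l" using q_power_gt_1 u l_pos by blast+
  have orb_sub: "?orb U \<subseteq> ?T" if "U \<in> ?T" for U using that typed_subspaces_times by blast
  have orb_self: "U \<in> ?orb U" for U by (rule image_eqI[of _ _ 1]) auto
  have orb_scale: "?orb ((*) c ` U) = ?orb U" if "c \<noteq> 0" for c U
  proof (intro equalityI subsetI)
    fix W assume "W \<in> ?orb ((*) c ` U)"
    then obtain e where "e \<noteq> 0" "W = (*) e ` (*) c ` U" by auto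
    then show "W \<in> ?orb U" using that by (intro image_eqI[of _ _ "e * c"]) (auto simp: times_image_times_image)
  next
    fix W assume "W \<in> ?orb U"
    then obtain e where "e \<noteq> 0" "W = (*) e ` U" by auto
    moreover have "(*) (e / c) ` (*) c ` U = (*) e ` U"
      unfolding times_image_times_image using that by simp
    ultimately show "W \<in> ?orb ((*) c ` U)" using that by (intro image_eqI[of _ _ "e / c"]) (simp_all only:, simp)
  qed
  have orb_eq: "?orb W = ?orb U" if "W \<in> ?orb U" for U W
  proof -
    obtain c where "c \<noteq> 0" "W = (*) c ` U" using \<open>W \<in> ?orb U\<close> by auto
    then show ?thesis using orb_scale[OF \<open>c \<noteq> 0\<close>, of U] by (simp only:)
  qed
  have orb_mem: "A = ?orb W" if A: "A \<in> ?orb ` ?T" "W \<in> A" for A W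
  proof -
    obtain U where "A = ?orb U" using A(1) by (rule imageE)
    then show ?thesis using orb_eq[of W U] A(2) by (simp only:)
  qed
  have size: "card Y * (q ^ u - 1) = card \<S> * (q ^ l - 1)" if S: "\<S> \<subseteq> ?orb ` ?T" and Y: "Y = \<Union>\<S>" for \<S> Y
  proof -
    have "card (\<Union>\<S>) = sum card \<S>"
    proof (rule card_Union_disjoint)
      show "pairwise disjnt \<S>" unfolding pairwise_def disjnt_def
      proof (intro ballI impI equals0I)
        fix A B W assume h: "A \<in> \<S>" "B \<in> \<S>" "A \<noteq> B" "W \<in> A \<inter> B"
        then have "A = ?orb W" "B = ?orb W" using orb_mem[of A W] orb_mem[of B W] S by (meson IntD1 IntD2 subsetD)+
        then show False using h(3) by simp
      qed
    qed simp
    then have "card Y * (q ^ u - 1) = (\<Sum>A\<in>\<S>. card A * (q ^ u - 1))" using Y by (simp add: sum_distrib_right)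
    also have "\<dots> = (\<Sum>A\<in>\<S>. q ^ l - 1)"
    proof (rule sum.cong[OF refl])
      fix A assume "A \<in> \<S>"
      then have "A \<in> ?orb ` ?T" using S by (meson subsetD)
      then obtain U where "A = ?orb U" "U \<in> ?T" by (rule imageE)
      then show "card A * (q ^ u - 1) = q ^ l - 1" using card_stab_orbit[of U d u] u by simp
    qed
    finally show ?thesis by simp
  qed
  have "?T = \<Union>(?orb ` ?T)"
  proof
    show "?T \<subseteq> \<Union>(?orb ` ?T)"
    proof
      fix U assume "U \<in> ?T"
      then have "?orb U \<in> ?orb ` ?T" by (rule imageI)
      then show "U \<in> \<Union>(?orb ` ?T)" using orb_self[of U] by (rule UnionI)
    qed
    show "\<Union>(?orb ` ?T) \<subseteq> ?T" by (rule UN_least) (rule orb_sub)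
  qed
  \<comment> \<open>Applied to all orbits at once, the size formula expresses their number by
    \<open>card ?T\<close>, which is known from the Moebius inversion.\<close>
  from size[OF subset_refl this] have "card ?T * (q ^ u - 1) = card (?orb ` ?T) * (q ^ l - 1)" .
  then have "real (card ?T * (q ^ u - 1)) = real (card (?orb ` ?T) * (q ^ l - 1))" by simp
  then have e1: "real (card ?T) * (real q ^ u - 1) = real (card (?orb ` ?T)) * (real q ^ l - 1)"
    using q1 by (simp add: of_nat_diff)
  have e2: "real q ^ l - 1 \<noteq> 0" using q1(2) of_nat_less_iff[of 1 "q ^ l", where 'a = real] by simp
  have "orbit_number q l d u = (real q ^ u - 1) / (real q ^ l - 1) * real (card ?T)"
    unfolding orbit_number_def using card_typed_subspaces[OF assms(1-3)] by simp
  then have "orbit_number q l d u = (real (card ?T) * (real q ^ u - 1)) / (real q ^ l - 1)" by simp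
  then have "orbit_number q l d u = real (card (?orb ` ?T))" unfolding e1 using e2 by simp
  then have "nat w \<le> card (?orb ` ?T)" using assms by linarith
  then obtain \<S> where S: "\<S> \<subseteq> ?orb ` ?T" "card \<S> = nat w" by (rule obtain_subset_with_card_n)
  show ?thesis
  proof (rule that[of "\<Union>\<S>"])
    have "\<Union>\<S> \<subseteq> \<Union>(?orb ` ?T)" using S(1) by (rule Union_mono)
    also have "\<dots> \<subseteq> ?T" by (rule UN_least) (rule orb_sub)
    finally show "\<Union>\<S> \<subseteq> ?T" .
    show "(*) c ` U \<in> \<Union>\<S>" if "U \<in> \<Union>\<S>" "c \<noteq> 0" for U c
    proof -
      obtain A where A: "A \<in> \<S>" "U \<in> A" using \<open>U \<in> \<Union>\<S>\<close> by blast
      then have "A = ?orb U" using orb_mem[of A U] S by (meson subsetD)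
      moreover have "(*) c ` U \<in> ?orb U" using \<open>c \<noteq> 0\<close> by simp
      ultimately have "(*) c ` U \<in> A" by (simp only:)
      then show ?thesis using A by blast
    qed
    have "real (card (\<Union>\<S>) * (q ^ u - 1)) = real (nat w * (q ^ l - 1))" using size[OF S(1) refl] S(2) by simp
    then show "real (card (\<Union>\<S>)) * (real q ^ u - 1) = of_int w * (real q ^ l - 1)"
      using q1 assms(4) by (simp add: of_nat_diff)
  qed
qed

lemma typed_subspacesD:
  assumes "U \<in> typed_subspaces d u"
  shows "FL.closed U" "card U = q ^ d" "stab U = GF u"
  using assms by (auto simp: typed_subspaces_def subspaces_def)

text \<open>Collects the orbits chosen for all \<open>r\<close> and \<open>u\<close>. The sum
  formula is stated for every \<open>f\<close> because the later counts depend on \<open>U\<close>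
  only through its dimension \<open>d U\<close>, which is \<open>r + 1\<close> for the orbits chosen
  at index \<open>r\<close>.\<close>

lemma obtain_invariant_family:
  fixes w :: "nat \<Rightarrow> nat \<Rightarrow> int"
  assumes "k \<le> l" and w: "\<And>r u. 2 \<le> r \<Longrightarrow> r \<le> k - 1 \<Longrightarrow> u dvd gcd (r + 1) l \<Longrightarrow>
    0 \<le> w r u \<and> of_int (w r u) \<le> orbit_number q l (r + 1) u"
  obtains \<U> d where "\<And>U c. U \<in> \<U> \<Longrightarrow> c \<noteq> 0 \<Longrightarrow> (*) c ` U \<in> \<U>"
    "\<And>U. U \<in> \<U> \<Longrightarrow> 3 \<le> d U \<and> FL.closed U \<and> card U = q ^ d U"
    "\<And>f :: nat \<Rightarrow> real. (\<Sum>U\<in>\<U>. f (d U)) =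
      (\<Sum>r = 2..k - 1. \<Sum>u | u dvd gcd (r + 1) l. of_int (w r u) * (real q ^ l - 1) / (real q ^ u - 1) * f (r + 1))"
proof -
  let ?I = "Sigma {2..k - 1} (\<lambda>r. {u. u dvd gcd (r + 1) l})"
  let ?good = "\<lambda>r u X. X \<subseteq> typed_subspaces (r + 1) u \<and> (\<forall>U c. U \<in> X \<longrightarrow> c \<noteq> 0 \<longrightarrow> (*) c ` U \<in> X) \<and>
    real (card X) * (real q ^ u - 1) = of_int (w r u) * (real q ^ l - 1)"
  have "\<exists>X. ?good r u X" if ru: "2 \<le> r" "r \<le> k - 1" "u dvd gcd (r + 1) l" for r u
  proof -
    have "r + 1 \<le> l" using ru assms(1) by simp
    moreover have "0 \<le> w r u" "of_int (w r u) \<le> orbit_number q l (r + 1) u" using w[OF ru] by blast+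
    ultimately obtain X where "X \<subseteq> typed_subspaces (r + 1) u" "\<And>U c. U \<in> X \<Longrightarrow> c \<noteq> 0 \<Longrightarrow> (*) c ` U \<in> X"
      "real (card X) * (real q ^ u - 1) = of_int (w r u) * (real q ^ l - 1)"
      by (rule obtain_invariant_subspaces[OF ru(3), of "w r u", rotated]) simp_all
    then show ?thesis by blast
  qed
  then obtain X where X: "\<And>r u. 2 \<le> r \<Longrightarrow> r \<le> k - 1 \<Longrightarrow> u dvd gcd (r + 1) l \<Longrightarrow> ?good r u (X r u)" by metis
  define \<U> where "\<U> = (\<Union>(r, u)\<in>?I. X r u)"
  define d where "d U = (THE n. card U = q ^ n)" for U :: "'b set"
  have d_eq: "d U = n" if "card U = q ^ n" for U n
    unfolding d_def using that q_gt_1 by (auto simp: power_inject_exp)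
  have fin_dvd: "finite {u. u dvd gcd (r + 1) l}" for r by (rule finite_divisors_nat) simp
  show ?thesis
  proof (rule that[of \<U> d])
    fix U c assume "U \<in> \<U>" and c: "(c::'b) \<noteq> 0"
    then obtain r u where ru: "2 \<le> r" "r \<le> k - 1" "u dvd gcd (r + 1) l" "U \<in> X r u"
      unfolding \<U>_def by auto
    then have "(*) c ` U \<in> X r u" using X[OF ru(1-3)] c by blast
    then show "(*) c ` U \<in> \<U>" unfolding \<U>_def using ru by auto
  next
    fix U assume "U \<in> \<U>"
    then obtain r u where ru: "2 \<le> r" "r \<le> k - 1" "u dvd gcd (r + 1) l" "U \<in> X r u"
      unfolding \<U>_def by auto
    then have "U \<in> typed_subspaces (r + 1) u" using X[OF ru(1-3)] by blast
    then have U: "FL.closed U" "card U = q ^ (r + 1)" by (rule typed_subspacesD)+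
    then show "3 \<le> d U \<and> FL.closed U \<and> card U = q ^ d U" using d_eq[OF U(2)] ru by simp
  next
    fix f :: "nat \<Rightarrow> real"
    have "(\<Sum>U\<in>\<U>. f (d U)) = (\<Sum>p\<in>?I. \<Sum>U\<in>X (fst p) (snd p). f (d U))"
      unfolding \<U>_def case_prod_beta
    proof (rule sum.UNION_disjoint)
      show "finite ?I" using fin_dvd by (intro finite_SigmaI) auto
      \<comment> \<open>The cardinality of a subspace recovers \<open>r\<close>, its stabilizer
        recovers \<open>u\<close>.\<close>
      show "\<forall>p\<in>?I. \<forall>p'\<in>?I. p \<noteq> p' \<longrightarrow> X (fst p) (snd p) \<inter> X (fst p') (snd p') = {}"
      proof (intro ballI impI equals0I)
        fix p p' U assume p: "p \<in> ?I" "p' \<in> ?I" "p \<noteq> p'" "U \<in> X (fst p) (snd p) \<inter> X (fst p') (snd p')"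
        obtain r u where ru: "p = (r, u)" by (cases p)
        obtain r' u' where ru': "p' = (r', u')" by (cases p')
        have r: "2 \<le> r" "r \<le> k - 1" "u dvd gcd (r + 1) l" "U \<in> X r u" using p ru by auto
        have r': "2 \<le> r'" "r' \<le> k - 1" "u' dvd gcd (r' + 1) l" "U \<in> X r' u'" using p ru' by auto
        have t: "U \<in> typed_subspaces (r + 1) u" "U \<in> typed_subspaces (r' + 1) u'"
          using X[OF r(1-3)] X[OF r'(1-3)] r(4) r'(4) by blast+
        have "q ^ (r + 1) = q ^ (r' + 1)" using typed_subspacesD(2)[OF t(1)] typed_subspacesD(2)[OF t(2)] by (simp only:)
        then have "r = r'" using q_gt_1 power_inject_exp[of q "r + 1" "r' + 1"] by simp
        moreover have "GF u = GF u'" using typed_subspacesD(3)[OF t(1)] typed_subspacesD(3)[OF t(2)] by (simp only:)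
        moreover have "u dvd l" "u' dvd l" using r(3) r'(3) by simp_all
        ultimately have "r = r'" "u dvd u'" "u' dvd u" using GF_subset_iff by blast+
        then show False using p(3) ru ru' dvd_antisym by blast
      qed
    qed simp
    also have "\<dots> = (\<Sum>r = 2..k - 1. \<Sum>u | u dvd gcd (r + 1) l. \<Sum>U\<in>X r u. f (d U))"
      by (subst sum.Sigma) (use fin_dvd in \<open>auto simp: case_prod_beta\<close>)
    also have "\<dots> = (\<Sum>r = 2..k - 1. \<Sum>u | u dvd gcd (r + 1) l.
      of_int (w r u) * (real q ^ l - 1) / (real q ^ u - 1) * f (r + 1))"
    proof (intro sum.cong refl)
      fix r u assume "r \<in> {2..k - 1}" "u \<in> {u. u dvd gcd (r + 1) l}"
      then have ru: "2 \<le> r" "r \<le> k - 1" "u dvd gcd (r + 1) l" by auto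
      have "(\<Sum>U\<in>X r u. f (d U)) = (\<Sum>U\<in>X r u. f (r + 1))"
      proof (rule sum.cong[OF refl])
        fix U assume "U \<in> X r u"
        then have "U \<in> typed_subspaces (r + 1) u" using X[OF ru] by blast
        then show "f (d U) = f (r + 1)" using d_eq[OF typed_subspacesD(2)] by simp
      qed
      also have "\<dots> = real (card (X r u)) * f (r + 1)" by simp
      also have "real (card (X r u)) = of_int (w r u) * (real q ^ l - 1) / (real q ^ u - 1)"
      proof -
        have "u \<noteq> 0" using ru(3) by (metis dvd_0_left_iff gcd_eq_0_iff add_is_0 one_neq_zero)
        then have "1 < q ^ u" by (intro q_power_gt_1) simp
        then have "1 < real q ^ u" by (metis of_nat_1 of_nat_less_iff of_nat_power)
        then show ?thesis using X[OF ru] by (simp add: field_simps)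
      qed
      finally show "(\<Sum>U\<in>X r u. f (d U)) = of_int (w r u) * (real q ^ l - 1) / (real q ^ u - 1) * f (r + 1)" .
    qed
    finally show "(\<Sum>U\<in>\<U>. f (d U)) =
      (\<Sum>r = 2..k - 1. \<Sum>u | u dvd gcd (r + 1) l. of_int (w r u) * (real q ^ l - 1) / (real q ^ u - 1) * f (r + 1))" .
  qed
qed

end

section \<open>Tuples with one linear relation\<close>

text \<open>Three kinds of linear algebra coexist here: \<open>FL\<close> is the large field over
  the small one, \<open>FV\<close> the space over the small field, \<open>LV\<close> the space over
  the large field.\<close>

locale extension_space = finite_field_extension emb q l + vector_space sc
  for emb :: "'a::{field,finite} \<Rightarrow> 'b::{field,finite}" and q l :: nat
    and sc :: "'b \<Rightarrow> 'v::{ab_group_add,finite} \<Rightarrow> 'v" (infixr "\<cdot>" 75)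
begin

declare FL.scale_scale [simp del] \<comment> \<open>associativity from right to left on the field itself\<close>

sublocale FV: subfield_space sc "range emb"
  by (rule subfield_range_emb) (rule vector_space_axioms)

sublocale LV: subfield_space sc UNIV
  by unfold_locales auto

text \<open>
  The coefficient tuples of the linear relations between the \<open>v i\<close> over the large field form the
  line spanned by \<open>a\<close>; for \<open>a = 0\<close> this is linear independence.
\<close>

definition relator :: "nat \<Rightarrow> (nat \<Rightarrow> 'v) \<Rightarrow> (nat \<Rightarrow> 'b) \<Rightarrow> bool" where
  "relator k v a \<longleftrightarrow> (\<forall>c. (\<Sum>i<k. c i \<cdot> v i) = 0 \<longleftrightarrow> (\<exists>e. \<forall>i<k. c i = e * a i))"

text \<open>The relator of \<open>v\<close> is unique up to a nonzero factor from the large field,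
  so the types of one tuple form a whole orbit of the Singer cycle.\<close>

definition has_type :: "nat \<Rightarrow> 'b set \<Rightarrow> (nat \<Rightarrow> 'v) \<Rightarrow> bool" where
  "has_type k U v \<longleftrightarrow> (\<exists>a. FL.lspan {..<k} a = U \<and> relator k v a)"

lemma lspan_times: "FL.lspan J (\<lambda>i. e * a i) = (*) e ` FL.lspan J a"
  unfolding FL.lspan_eq_image image_image sum_distrib_left
  by (intro image_cong sum.cong refl) (rule mult.left_commute)

text \<open>Makes the type a property of the block. If \<open>v = N v'\<close> with a matrix
  \<open>N\<close> over the small field, a relation \<open>a\<close> of \<open>v\<close> becomes the
  relation \<open>a N\<close> of \<open>v'\<close>; as \<open>N\<close> is invertible over the small
  field, the span of the coefficients is the same.\<close>

lemma has_type_change_basis: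
  assumes t: "has_type k U v" and i: "FV.indep {..<k} v" and sp: "FV.lspan {..<k} v' = FV.lspan {..<k} v"
  shows "has_type k U v'"
proof -
  obtain a where a: "FL.lspan {..<k} a = U" "relator k v a" using t unfolding has_type_def by auto
  have i': "FV.indep {..<k} v'"
    by (rule FV.indep_if_card_lspan) (use sp FV.card_lspan[OF _ i] in auto)
  have "v' i \<in> FV.lspan {..<k} v" if "i < k" for i
    using FV.lspan_superset[of "{..<k}" i v'] that sp by auto
  then have "\<forall>i. \<exists>c. i < k \<longrightarrow> (\<forall>j<k. c j \<in> range emb) \<and> v' i = (\<Sum>j<k. c j \<cdot> v j)"
    unfolding FV.lspan_def by fastforce
  then obtain M where M: "\<And>i j. i < k \<Longrightarrow> j < k \<Longrightarrow> M i j \<in> range emb" "\<And>i. i < k \<Longrightarrow> v' i = (\<Sum>j<k. M i j \<cdot> v j)"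
    by metis
  have "v j \<in> FV.lspan {..<k} v'" if "j < k" for j
    using FV.lspan_superset[of "{..<k}" j v] that sp by auto
  then have "\<forall>j. \<exists>c. j < k \<longrightarrow> (\<forall>i<k. c i \<in> range emb) \<and> v j = (\<Sum>i<k. c i \<cdot> v' i)"
    unfolding FV.lspan_def by fastforce
  then obtain N where N: "\<And>i j. i < k \<Longrightarrow> j < k \<Longrightarrow> N j i \<in> range emb" "\<And>j. j < k \<Longrightarrow> v j = (\<Sum>i<k. N j i \<cdot> v' i)"
    by metis
  have v'_v: "(\<Sum>i<k. c i \<cdot> v' i) = (\<Sum>j<k. (\<Sum>i<k. c i * M i j) \<cdot> v j)" for c
  proof -
    have "(\<Sum>i<k. c i \<cdot> v' i) = (\<Sum>i<k. \<Sum>j<k. (c i * M i j) \<cdot> v j)"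
      using M(2) by (intro sum.cong) (auto simp: scale_sum_right)
    also have "\<dots> = (\<Sum>j<k. \<Sum>i<k. (c i * M i j) \<cdot> v j)" by (rule sum.swap)
    finally show ?thesis by (simp add: scale_sum_left)
  qed
  have v_v': "(\<Sum>j<k. c j \<cdot> v j) = (\<Sum>i<k. (\<Sum>j<k. c j * N j i) \<cdot> v' i)" for c
  proof -
    have "(\<Sum>j<k. c j \<cdot> v j) = (\<Sum>j<k. \<Sum>i<k. (c j * N j i) \<cdot> v' i)"
      using N(2) by (intro sum.cong) (auto simp: scale_sum_right)
    also have "\<dots> = (\<Sum>i<k. \<Sum>j<k. (c j * N j i) \<cdot> v' i)" by (rule sum.swap)
    finally show ?thesis by (simp add: scale_sum_left)
  qed
  have uniq: "c j = d j" if "FV.indep {..<k} w" "(\<Sum>j<k. c j \<cdot> w j) = (\<Sum>j<k. d j \<cdot> w j)"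
      "\<And>j. j < k \<Longrightarrow> c j \<in> range emb" "\<And>j. j < k \<Longrightarrow> d j \<in> range emb" "j < k" for c d w j
  proof -
    have "(\<Sum>j<k. (c j - d j) \<cdot> w j) = 0" using that(2) by (simp add: scale_left_diff_distrib sum_subtractf)
    then have "c j - d j = 0"
      using that(1) unfolding FV.indep_def using that(3-5) FL.diff_E by (auto dest!: spec[of _ "\<lambda>j. c j - d j"])
    then show ?thesis by simp
  qed
  have delta: "(\<Sum>j<k. (if j = i then 1 else 0) \<cdot> w j) = w i" if "i < k" for i and w :: "nat \<Rightarrow> 'v"
    using that by (simp add: if_distrib[of "\<lambda>c. c \<cdot> _"] cong: if_cong)
  have E01: "(if b then 1 else 0) \<in> range emb" for b using FL.zero_E FL.one_E by simp
  \<comment> \<open>The two expansions give \<open>M N v' = v'\<close>. All coefficients lie in the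
    small field, over which \<open>v'\<close> is independent, so they can be compared.\<close>
  have MN: "(\<Sum>j<k. M i j * N j i') = (if i' = i then 1 else 0)" if "i < k" "i' < k" for i i'
  proof (rule uniq[OF i', of "\<lambda>i'. \<Sum>j<k. M i j * N j i'" "\<lambda>i'. if i' = i then 1 else 0"])
    have "(\<Sum>i'<k. (\<Sum>j<k. M i j * N j i') \<cdot> v' i') = v' i"
      using M(2)[OF that(1)] v_v'[of "M i"] by (simp only:)
    then show "(\<Sum>i'<k. (\<Sum>j<k. M i j * N j i') \<cdot> v' i') = (\<Sum>i'<k. (if i' = i then 1 else 0) \<cdot> v' i')"
      unfolding delta[OF that(1)] .
    show "(\<Sum>j<k. M i j * N j i') \<in> range emb" if "i' < k" for i'
      by (intro FL.sum_E FL.mult_E M(1) N(1)) (use that \<open>i < k\<close> in simp_all)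
  qed (rule E01, fact)
  have NM: "(\<Sum>i<k. N j i * M i j') = (if j' = j then 1 else 0)" if "j < k" "j' < k" for j j'
  proof (rule uniq[OF i, of "\<lambda>j'. \<Sum>i<k. N j i * M i j'" "\<lambda>j'. if j' = j then 1 else 0"])
    have "(\<Sum>j'<k. (\<Sum>i<k. N j i * M i j') \<cdot> v j') = v j"
      using N(2)[OF that(1)] v'_v[of "N j"] by (simp only:)
    then show "(\<Sum>j'<k. (\<Sum>i<k. N j i * M i j') \<cdot> v j') = (\<Sum>j'<k. (if j' = j then 1 else 0) \<cdot> v j')"
      unfolding delta[OF that(1)] .
    show "(\<Sum>i<k. N j i * M i j') \<in> range emb" if "j' < k" for j'
      by (intro FL.sum_E FL.mult_E M(1) N(1)) (use that \<open>j < k\<close> in simp_all)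
  qed (rule E01, fact)
  have cMN: "(\<Sum>j<k. (\<Sum>i<k. c i * M i j) * N j i') = c i'" if "i' < k" for c i'
  proof -
    have "(\<Sum>j<k. (\<Sum>i<k. c i * M i j) * N j i') = (\<Sum>j<k. \<Sum>i<k. c i * (M i j * N j i'))"
      unfolding sum_distrib_right by (intro sum.cong refl) (rule mult.assoc)
    also have "\<dots> = (\<Sum>i<k. c i * (\<Sum>j<k. M i j * N j i'))"
      unfolding sum_distrib_left by (rule sum.swap)
    also have "\<dots> = (\<Sum>i<k. c i * (if i' = i then 1 else 0))" by (intro sum.cong refl) (simp only: MN that lessThan_iff)
    also have "\<dots> = c i'" using that by (simp add: if_distrib[of "\<lambda>x. _ * x"] cong: if_cong)
    finally show ?thesis .
  qed
  have cNM: "(\<Sum>i<k. (\<Sum>j<k. c j * N j i) * M i j') = c j'" if "j' < k" for c j'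
  proof -
    have "(\<Sum>i<k. (\<Sum>j<k. c j * N j i) * M i j') = (\<Sum>i<k. \<Sum>j<k. c j * (N j i * M i j'))"
      unfolding sum_distrib_right by (intro sum.cong refl) (rule mult.assoc)
    also have "\<dots> = (\<Sum>j<k. c j * (\<Sum>i<k. N j i * M i j'))"
      unfolding sum_distrib_left by (rule sum.swap)
    also have "\<dots> = (\<Sum>j<k. c j * (if j' = j then 1 else 0))" by (intro sum.cong refl) (simp only: NM that lessThan_iff)
    also have "\<dots> = c j'" using that by (simp add: if_distrib[of "\<lambda>x. _ * x"] cong: if_cong)
    finally show ?thesis .
  qed
  \<comment> \<open>The product \<open>a N\<close>, obtained by substituting \<open>v = N v'\<close>
    into the relation \<open>a\<close>.\<close>
  define a' where "a' i = (\<Sum>j<k. a j * N j i)" for i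
  have "relator k v' a'"
    unfolding relator_def
  proof
    fix c
    have "(\<Sum>i<k. c i \<cdot> v' i) = 0 \<longleftrightarrow> (\<exists>e. \<forall>j<k. (\<Sum>i<k. c i * M i j) = e * a j)"
      using a(2)[unfolded relator_def, THEN spec, of "\<lambda>j. \<Sum>i<k. c i * M i j"] unfolding v'_v .
    also have "\<dots> \<longleftrightarrow> (\<exists>e. \<forall>i<k. c i = e * a' i)"
    proof (intro iff_exI iffI allI impI)
      fix e i assume e: "\<forall>j<k. (\<Sum>i<k. c i * M i j) = e * a j" and ik: "i < k"
      have "c i = (\<Sum>j<k. (\<Sum>i<k. c i * M i j) * N j i)" using cMN[OF ik] by simp
      also have "\<dots> = (\<Sum>j<k. e * a j * N j i)" using e by (intro sum.cong) auto
      finally show "c i = e * a' i" unfolding a'_def by (simp add: sum_distrib_left mult.assoc)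
    next
      fix e j assume e: "\<forall>i<k. c i = e * a' i" and jk: "j < k"
      have "(\<Sum>i<k. c i * M i j) = (\<Sum>i<k. e * a' i * M i j)" using e by (intro sum.cong) auto
      also have "\<dots> = e * (\<Sum>i<k. a' i * M i j)" by (simp add: sum_distrib_left mult.assoc)
      also have "\<dots> = e * a j" using cNM[OF jk] unfolding a'_def by simp
      finally show "(\<Sum>i<k. c i * M i j) = e * a j" .
    qed
    finally show "(\<Sum>i<k. c i \<cdot> v' i) = 0 \<longleftrightarrow> (\<exists>e. \<forall>i<k. c i = e * a' i)" .
  qed
  moreover have "FL.lspan {..<k} a' = FL.lspan {..<k} a"
  proof
    show "FL.lspan {..<k} a' \<subseteq> FL.lspan {..<k} a"
    proof (rule FL.lspan_subset[OF FL.closed_lspan])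
      fix i assume "i \<in> {..<k}"
      then show "a' i \<in> FL.lspan {..<k} a" unfolding a'_def FL.lspan_def
        using N(1) by (auto intro!: exI[of _ "\<lambda>j. N j i"] simp: mult.commute)
    qed
    show "FL.lspan {..<k} a \<subseteq> FL.lspan {..<k} a'"
    proof (rule FL.lspan_subset[OF FL.closed_lspan])
      fix j assume j: "j \<in> {..<k}"
      then have "a j = (\<Sum>i<k. M i j * a' i)" using cNM[of j a] unfolding a'_def by (simp add: mult.commute)
      then show "a j \<in> FL.lspan {..<k} a'" unfolding FL.lspan_def
        using M(1) j by (auto intro!: exI[of _ "\<lambda>i. M i j"])
    qed
  qed
  ultimately show ?thesis unfolding has_type_def using a(1) by auto
qed

text \<open>A nontrivial relation over the small field has coefficients spanning
  \<open>range emb\<close>. It is also a nonzero multiple of the relator, so \<open>U\<close> would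
  have \<open>q\<close> elements too.\<close>

lemma has_type_indep:
  assumes "has_type k U v" "card U \<noteq> q"
  shows "FV.indep {..<k} v"
  unfolding FV.indep_def
proof (intro allI impI, elim conjE)
  fix c assume c: "\<forall>j\<in>{..<k}. c j \<in> range emb" "(\<Sum>j<k. c j \<cdot> v j) = 0"
  obtain a where a: "FL.lspan {..<k} a = U" "relator k v a" using assms(1) unfolding has_type_def by auto
  obtain e where e: "\<And>i. i < k \<Longrightarrow> c i = e * a i" using a(2) c(2) unfolding relator_def by blast
  show "\<forall>j\<in>{..<k}. c j = 0"
  proof (rule ccontr)
    assume "\<not> (\<forall>j\<in>{..<k}. c j = 0)"
    then obtain j where j: "j < k" "c j \<noteq> 0" by auto
    then have "e \<noteq> 0" using e by auto
    have "FL.lspan {..<k} c = FL.lspan {..<k} (\<lambda>i. e * a i)" using e by (intro FL.lspan_cong) auto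
    then have "card (FL.lspan {..<k} c) = card U"
      using a(1) \<open>e \<noteq> 0\<close> by (simp add: lspan_times card_image inj_on_def)
    moreover have "FL.lspan {..<k} c = range emb"
    proof
      have "FL.closed (range emb)" unfolding FL.closed_def using FL.zero_E FL.add_E FL.mult_E by blast
      then show "FL.lspan {..<k} c \<subseteq> range emb" by (rule FL.lspan_subset) (use c in blast)
      show "range emb \<subseteq> FL.lspan {..<k} c"
      proof
        fix x assume x: "x \<in> range emb"
        have "c j \<in> range emb" using c(1) j(1) by blast
        from FL.mult_E[OF x FL.inverse_E[OF this]] have "x * inverse (c j) \<in> range emb" .
        moreover have "c j \<in> FL.lspan {..<k} c" using j by (intro FL.lspan_superset) auto
        ultimately have "x * inverse (c j) * c j \<in> FL.lspan {..<k} c"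
          by (rule FL.closed_scale[OF FL.closed_lspan])
        moreover have "x * inverse (c j) * c j = x" using j(2) by (simp add: mult.assoc)
        ultimately show "x \<in> FL.lspan {..<k} c" by (simp only:)
      qed
    qed
    ultimately show False using card_range_emb assms(2) by simp
  qed
qed

section \<open>Counting tuples with a given relation\<close>

text \<open>Solving the relation at an index with nonzero coefficient reduces tuples with a given
  relator to independent tuples that are shorter by one.\<close>

lemma relator_iff:
  assumes "i < k" "a i \<noteq> 0"
  defines "J \<equiv> {..<k} - {i}"
  shows "relator k v a \<longleftrightarrow> LV.indep J v \<and> v i = - (\<Sum>j\<in>J. (a j / a i) \<cdot> v j)"
proof -
  have split: "(\<Sum>j<k. c j \<cdot> v j) = c i \<cdot> v i + (\<Sum>j\<in>J. c j \<cdot> v j)" for c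
    unfolding J_def using assms(1) by (intro sum.remove) auto
  have ii: "i \<notin> J" "finite J" by (auto simp: J_def)
  show ?thesis
  proof
    assume r: "relator k v a"
    have "(\<Sum>j<k. a j \<cdot> v j) = 0" using r unfolding relator_def by (metis mult_1)
    then have "inverse (a i) \<cdot> (a i \<cdot> v i + (\<Sum>j\<in>J. a j \<cdot> v j)) = 0" unfolding split by simp
    then have "v i + (\<Sum>j\<in>J. (a j / a i) \<cdot> v j) = 0"
      using assms(2) by (simp add: scale_right_distrib scale_sum_right field_simps)
    then have "v i = - (\<Sum>j\<in>J. (a j / a i) \<cdot> v j)" by (simp add: eq_neg_iff_add_eq_0)
    moreover have "LV.indep J v" unfolding LV.indep_def
    proof (intro allI impI, elim conjE)
      fix c assume c: "(\<Sum>j\<in>J. c j \<cdot> v j) = 0"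
      \<comment> \<open>Extended by 0 at \<open>i\<close>, a relation among the other vectors is a
        multiple of \<open>a\<close> that vanishes at \<open>i\<close>, hence zero.\<close>
      have "(\<Sum>j\<in>J. (c(i := 0)) j \<cdot> v j) = (\<Sum>j\<in>J. c j \<cdot> v j)" using ii by (intro sum.cong) auto
      then have "(\<Sum>j<k. (c(i := 0)) j \<cdot> v j) = 0" unfolding split using c by simp
      then obtain e where e: "\<And>j. j < k \<Longrightarrow> (c(i := 0)) j = e * a j" using r unfolding relator_def by blast
      from e[OF assms(1)] assms(2) have "e = 0" by simp
      then show "\<forall>j\<in>J. c j = 0" using e unfolding J_def by (metis Diff_iff fun_upd_other insertI1 lessThan_iff mult_zero_left)
    qed
    ultimately show "LV.indep J v \<and> v i = - (\<Sum>j\<in>J. (a j / a i) \<cdot> v j)" by simp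
  next
    assume a: "LV.indep J v \<and> v i = - (\<Sum>j\<in>J. (a j / a i) \<cdot> v j)"
    show "relator k v a" unfolding relator_def
    proof
      fix c
      have s: "(\<Sum>j<k. c j \<cdot> v j) = (\<Sum>j\<in>J. (c j - c i * (a j / a i)) \<cdot> v j)"
      proof -
        have "c i \<cdot> v i = - (\<Sum>j\<in>J. (c i * (a j / a i)) \<cdot> v j)"
          using a by (simp add: scale_sum_right scale_minus_right)
        then show ?thesis unfolding split by (simp add: scale_left_diff_distrib sum_subtractf)
      qed
      have "(\<Sum>j<k. c j \<cdot> v j) = 0 \<longleftrightarrow> (\<forall>j\<in>J. c j - c i * (a j / a i) = 0)"
      proof
        assume "(\<Sum>j<k. c j \<cdot> v j) = 0"
        then have "(\<Sum>j\<in>J. (c j - c i * (a j / a i)) \<cdot> v j) = 0" by (simp only: s)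
        then show "\<forall>j\<in>J. c j - c i * (a j / a i) = 0"
          using a[THEN conjunct1, unfolded LV.indep_def, THEN spec, of "\<lambda>j. c j - c i * (a j / a i)"] by blast
      next
        assume "\<forall>j\<in>J. c j - c i * (a j / a i) = 0"
        then show "(\<Sum>j<k. c j \<cdot> v j) = 0" unfolding s by simp
      qed
      also have "\<dots> \<longleftrightarrow> (\<exists>e. \<forall>i<k. c i = e * a i)"
      proof
        assume h: "\<forall>j\<in>J. c j - c i * (a j / a i) = 0"
        have "c j = (c i / a i) * a j" if "j < k" for j
        proof (cases "j = i")
          case False
          then have "c j - c i * (a j / a i) = 0" using h that unfolding J_def by blast
          then show ?thesis by simp
        qed (use assms(2) in simp)
        then show "\<exists>e. \<forall>i<k. c i = e * a i" by blast
      next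
        assume "\<exists>e. \<forall>i<k. c i = e * a i"
        then obtain e where e: "\<And>j. j < k \<Longrightarrow> c j = e * a j" by blast
        then show "\<forall>j\<in>J. c j - c i * (a j / a i) = 0" using assms(1,2) unfolding J_def by auto
      qed
      finally show "(\<Sum>j<k. c j \<cdot> v j) = 0 \<longleftrightarrow> (\<exists>e. \<forall>i<k. c i = e * a i)" .
    qed
  qed
qed

lemma relator_zero_iff:
  assumes "\<And>i. i < k \<Longrightarrow> a i = 0"
  shows "relator k v a \<longleftrightarrow> LV.indep {..<k} v"
proof -
  have ex_iff: "(\<exists>e. \<forall>i<k. c i = e * a i) \<longleftrightarrow> (\<forall>j\<in>{..<k}. c j = 0)" for c
    using assms by (simp add: Ball_def)
  have "(\<Sum>i<k. c i \<cdot> v i) = 0" if "\<forall>j\<in>{..<k}. c j = 0" for c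
    using that by simp
  then show ?thesis unfolding relator_def LV.indep_def ex_iff
    by (intro iff_allI) blast
qed

lemma relator_cong: "(\<And>i. i < k \<Longrightarrow> v i = v' i) \<Longrightarrow> (\<And>i. i < k \<Longrightarrow> a i = a' i) \<Longrightarrow> relator k v a = relator k v' a'"
proof -
  assume v: "\<And>i. i < k \<Longrightarrow> v i = v' i" and a: "\<And>i. i < k \<Longrightarrow> a i = a' i"
  have "(\<Sum>i<k. c i \<cdot> v i) = (\<Sum>i<k. c i \<cdot> v' i)" for c using v by (intro sum.cong) auto
  moreover have "(\<forall>i<k. c i = e * a i) = (\<forall>i<k. c i = e * a' i)" for c e using a by auto
  ultimately show ?thesis unfolding relator_def by simp
qed

lemma relator_times: "e \<noteq> 0 \<Longrightarrow> relator k v (\<lambda>i. e * a i) = relator k v a"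
proof -
  assume e: "e \<noteq> 0"
  have "(\<exists>e'. \<forall>i<k. c i = e' * (e * a i)) \<longleftrightarrow> (\<exists>e'. \<forall>i<k. c i = e' * a i)" for c
  proof
    assume "\<exists>e'. \<forall>i<k. c i = e' * (e * a i)"
    then obtain e' where "\<forall>i<k. c i = e' * (e * a i)" ..
    then have "\<forall>i<k. c i = (e' * e) * a i" by (simp add: mult.assoc)
    then show "\<exists>e'. \<forall>i<k. c i = e' * a i" ..
  next
    assume "\<exists>e'. \<forall>i<k. c i = e' * a i"
    then obtain e' where "\<forall>i<k. c i = e' * a i" ..
    then have "\<forall>i<k. c i = (e' / e) * (e * a i)" using e by simp
    then show "\<exists>e'. \<forall>i<k. c i = e' * (e * a i)" ..
  qed
  then show ?thesis unfolding relator_def by simp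
qed

text \<open>Dropping the entry at \<open>i\<close>, which is forced, is a bijection onto independent
  families on \<open>k - 1\<close> indices. The prescribed entries 0 and 1 survive because
  \<open>2 \<le> i\<close>.\<close>

lemma count_relator_nonzero:
  assumes i: "2 \<le> i" "i < k" "a i \<noteq> 0" and w: "LV.indep {0, 1} w"
  shows "real (card {v \<in> PiE {..<k} (\<lambda>_. UNIV). (\<forall>j\<in>{0, 1}. v j = w j) \<and> relator k v a}) =
    (\<Prod>j = 2..<k - 1. real CARD('v) - real (q ^ l) ^ j)"
proof -
  let ?J = "{..<k} - {i}"
  let ?A = "{v \<in> PiE ?J (\<lambda>_. UNIV). (\<forall>j\<in>{0, 1}. v j = w j) \<and> LV.indep ?J v}"
  let ?B = "{v \<in> PiE {..<k} (\<lambda>_. UNIV). (\<forall>j\<in>{0, 1}. v j = w j) \<and> relator k v a}"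
  let ?s = "\<lambda>v. - (\<Sum>j\<in>?J. (a j / a i) \<cdot> v j)"
  let ?f = "\<lambda>v. v(i := ?s v)"
  have s: "?s (v(i := x)) = ?s v" for v x by (intro arg_cong[where f = uminus] sum.cong) auto
  have ind: "LV.indep ?J (v(i := x)) = LV.indep ?J v" for v x by (rule LV.indep_cong) auto
  have inj: "inj_on ?f ?A"
  proof (rule inj_onI)
    fix v v' assume h: "v \<in> ?A" "v' \<in> ?A" "?f v = ?f v'"
    then show "v = v'" using fun_upd_PiE_eqD[of v ?J "\<lambda>_. UNIV" v' "\<lambda>_. UNIV" i "?s v" "?s v'"] by blast
  qed
  have img: "?f ` ?A = ?B"
  proof (intro equalityI subsetI)
    fix u assume "u \<in> ?f ` ?A"
    then obtain v where v: "v \<in> ?A" "u = ?f v" by blast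
    have "relator k u a" unfolding relator_iff[of i k a, OF i(2,3)] v(2) s ind using v(1) by simp
    moreover have "u \<in> PiE {..<k} (\<lambda>_. UNIV)" using v i by (auto simp: PiE_def extensional_def)
    moreover have "\<forall>j\<in>{0, 1}. u j = w j" using v i(1) by auto
    ultimately show "u \<in> ?B" by blast
  next
    fix u assume u: "u \<in> ?B"
    then have r: "LV.indep ?J u" "u i = ?s u" using relator_iff[of i k a, OF i(2,3)] by blast+
    let ?v = "u(i := undefined)"
    have "?v \<in> PiE ?J (\<lambda>_. UNIV)" using u by (auto simp: PiE_def extensional_def)
    moreover have "\<forall>j\<in>{0, 1}. ?v j = w j" using u i(1) by auto
    ultimately have A: "?v \<in> ?A" using r ind by blast
    have "u = ?f ?v" unfolding s r(2)[symmetric] by simp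
    then show "u \<in> ?f ` ?A" using A by (rule image_eqI)
  qed
  have "card ?B = card ?A" unfolding img[symmetric] by (rule card_image[OF inj])
  moreover have "real (card ?A) = (\<Prod>j = 2..<k - 1. real CARD('v) - real (q ^ l) ^ j)"
    using LV.indep_extend[of ?J "{0, 1}" w UNIV] i w card_b LV.closed_UNIV by (simp add: numeral_2_eq_2)
  ultimately show ?thesis by simp
qed

lemma count_relator_zero:
  assumes "\<And>i. i < k \<Longrightarrow> a i = 0" "2 \<le> k" and w: "LV.indep {0, 1} w"
  shows "real (card {v \<in> PiE {..<k} (\<lambda>_. UNIV). (\<forall>j\<in>{0, 1}. v j = w j) \<and> relator k v a}) =
    (\<Prod>j = 2..<k. real CARD('v) - real (q ^ l) ^ j)"
  using LV.indep_extend[of "{..<k}" "{0, 1}" w UNIV] relator_zero_iff[of k a, OF assms(1)] assms(2) w card_b LV.closed_UNIV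
  by (simp add: numeral_2_eq_2)

definition typed_tuples :: "nat \<Rightarrow> (nat \<Rightarrow> 'v) \<Rightarrow> 'b set set \<Rightarrow> (nat \<Rightarrow> 'v) set" where
  "typed_tuples k w \<U> = {v \<in> PiE {..<k} (\<lambda>_. UNIV). (\<forall>j\<in>{0, 1}. v j = w j) \<and> (\<exists>U\<in>\<U>. has_type k U v)}"

text \<open>Two coefficients span at most \<open>q ^ 2\<close> elements. This is how dimension at
  least 3 is exploited: the entry to be eliminated can be chosen away from the prescribed indices 0
  and 1.\<close>

lemma has_nonzero_coeff:
  assumes "q ^ 2 < card (FL.lspan {..<k} a)"
  obtains i where "2 \<le> i" "i < k" "a i \<noteq> 0"
proof (rule ccontr)
  assume "\<not> thesis"
  note no = this and obt = that
  have z: "a i = 0" if "2 \<le> i" "i < k" for i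
  proof (rule ccontr)
    assume "a i \<noteq> 0"
    from obt[OF that this] no show False by blast
  qed
  have "FL.lspan {..<k} a \<subseteq> FL.lspan {0, 1} a"
  proof (rule FL.lspan_subset[OF FL.closed_lspan])
    fix j assume j: "j \<in> {..<k}"
    show "a j \<in> FL.lspan {0, 1} a"
    proof (cases "j < 2")
      case True
      then have "j \<in> {0, 1}" by auto
      then show ?thesis by (intro FL.lspan_superset) auto
    next
      case False
      then have "a j = 0" using z j by simp
      then show ?thesis using FL.closed_lspan FL.closed_def by simp
    qed
  qed
  then have "card (FL.lspan {..<k} a) \<le> card (FL.lspan {0, 1} a)" by (intro card_mono) auto
  also have "\<dots> \<le> q ^ 2" using FL.card_lspan_le[of "{0, 1}" a] card_range_emb by (simp add: numeral_2_eq_2)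
  finally show False using assms by simp
qed

text \<open>The relators are the multiples \<open>e * a0\<close> of one of them with
  \<open>e\<close> nonzero. Invariance of the family keeps their spans in it, and \<open>big\<close>
  excludes the zero tuple, so that distinct \<open>e\<close> give distinct relators.\<close>

lemma card_relators:
  assumes inv: "\<And>U c. U \<in> \<U> \<Longrightarrow> c \<noteq> 0 \<Longrightarrow> (*) c ` U \<in> \<U>" and big: "\<And>U. U \<in> \<U> \<Longrightarrow> q ^ 2 < card U"
    and v: "U \<in> \<U>" "has_type k U v"
  shows "card {a \<in> PiE {..<k} (\<lambda>_. UNIV). FL.lspan {..<k} a \<in> \<U> \<and> relator k v a} = q ^ l - 1"
proof -
  let ?R = "{a \<in> PiE {..<k} (\<lambda>_. UNIV). FL.lspan {..<k} a \<in> \<U> \<and> relator k v a}"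
  obtain a0 where a0: "FL.lspan {..<k} a0 = U" "relator k v a0" using v unfolding has_type_def by blast
  obtain i where i: "2 \<le> i" "i < k" "a0 i \<noteq> 0"
    by (rule has_nonzero_coeff[of k a0]) (use a0(1) big[OF v(1)] in simp_all)
  let ?f = "\<lambda>e. restrict (\<lambda>i. e * a0 i) {..<k}"
  have inj: "inj_on ?f (UNIV - {0})"
  proof (rule inj_onI)
    fix e e' assume "?f e = ?f e'"
    then have "?f e i = ?f e' i" by simp
    then show "e = e'" using i by simp
  qed
  have img: "?f ` (UNIV - {0}) = ?R"
  proof (intro equalityI subsetI)
    fix a assume "a \<in> ?f ` (UNIV - {0})"
    then obtain e where e: "e \<noteq> 0" "a = ?f e" by blast
    have "FL.lspan {..<k} a = FL.lspan {..<k} (\<lambda>i. e * a0 i)" unfolding e(2) by (intro FL.lspan_cong) simp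
    then have "FL.lspan {..<k} a = (*) e ` U" unfolding lspan_times a0(1) .
    then have "FL.lspan {..<k} a \<in> \<U>" using inv[OF v(1) e(1)] by (simp only:)
    moreover have "relator k v a = relator k v (\<lambda>i. e * a0 i)" unfolding e(2) by (intro relator_cong) auto
    then have "relator k v a" unfolding relator_times[OF e(1)] using a0(2) by simp
    moreover have "a \<in> PiE {..<k} (\<lambda>_. UNIV)" unfolding e(2) by simp
    ultimately show "a \<in> ?R" by blast
  next
    fix a assume a: "a \<in> ?R"
    have "(\<exists>e. \<forall>i<k. a i = e * a i)" by (rule exI[of _ 1]) simp
    then have "(\<Sum>i<k. a i \<cdot> v i) = 0" using a unfolding relator_def by blast
    then obtain e where e: "\<forall>i<k. a i = e * a0 i" using a0(2) unfolding relator_def by blast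
    have "q ^ 2 < card (FL.lspan {..<k} a)" using a big by blast
    then obtain j where j: "2 \<le> j" "j < k" "a j \<noteq> 0" by (rule has_nonzero_coeff)
    then have "e \<noteq> 0" using e by auto
    moreover have "a = ?f e"
    proof (rule extensionalityI[of _ "{..<k}"])
      show "a \<in> extensional {..<k}" using a by (simp add: PiE_def)
    qed (use e in simp_all)
    ultimately show "a \<in> ?f ` (UNIV - {0})" by blast
  qed
  have "card ?R = card (UNIV - {0::'b})" unfolding img[symmetric] by (rule card_image[OF inj])
  then show ?thesis using card_b by simp
qed

text \<open>
  Double counting of the pairs of a tuple and one of its \<open>q\<^sup>l - 1\<close> nonzero relators: every relator
  expresses one vector by the others and leaves these independent.
\<close>

lemma count_typed_tuples:
  assumes inv: "\<And>U c. U \<in> \<U> \<Longrightarrow> c \<noteq> 0 \<Longrightarrow> (*) c ` U \<in> \<U>" and big: "\<And>U. U \<in> \<U> \<Longrightarrow> 3 \<le> d U"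
    and closed: "\<And>U. U \<in> \<U> \<Longrightarrow> FL.closed U \<and> card U = q ^ d U"
    and w: "LV.indep {0, 1} w"
  shows "real (card (typed_tuples k w \<U>)) * (real q ^ l - 1) =
    (\<Sum>U\<in>\<U>. \<Prod>j<d U. real q ^ k - real q ^ j) * (\<Prod>j = 2..<k - 1. real CARD('v) - real (q ^ l) ^ j)"
proof -
  have big': "q ^ 2 < card U" if "U \<in> \<U>" for U
    using closed[OF that] big[OF that] q_gt_1 by (simp add: power_strict_increasing_iff)
  let ?A = "{a \<in> PiE {..<k} (\<lambda>_. UNIV). FL.lspan {..<k} a \<in> \<U>}"
  let ?V = "{v \<in> PiE {..<k} (\<lambda>_. UNIV). \<forall>j\<in>{0, 1}. v j = w j}"
  let ?P = "\<Prod>j = 2..<k - 1. real CARD('v) - real (q ^ l) ^ j"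
  have finP: "finite (PiE {..<k} (\<lambda>_. UNIV :: 'b set))" by (intro finite_PiE) auto
  have fA: "finite ?A" by (rule finite_subset[OF _ finite_PiE[of "{..<k}" "\<lambda>_. UNIV"]]) auto
  have fV: "finite ?V" by (rule finite_subset[OF _ finite_PiE[of "{..<k}" "\<lambda>_. UNIV"]]) auto
  have fT: "typed_tuples k w \<U> \<subseteq> ?V" unfolding typed_tuples_def by blast
  have "(\<Sum>a\<in>?A. real (card {v \<in> ?V. relator k v a})) = (\<Sum>v\<in>?V. real (card {a \<in> ?A. relator k v a}))"
  proof -
    have "(\<Sum>a\<in>?A. \<Sum>v\<in>{v \<in> ?V. relator k v a}. 1 :: real) = (\<Sum>v\<in>?V. \<Sum>a\<in>{a \<in> ?A. relator k v a}. 1)"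
      by (rule sum.swap_restrict) (use fA fV in simp_all)
    then show ?thesis by simp
  qed
  also have "\<dots> = (\<Sum>v\<in>typed_tuples k w \<U>. real (card {a \<in> ?A. relator k v a}))"
  proof (rule sum.mono_neutral_right[OF fV fT], intro ballI)
    fix v assume v: "v \<in> ?V - typed_tuples k w \<U>"
    have "{a \<in> ?A. relator k v a} = {}"
    proof (intro equals0I)
      fix a assume "a \<in> {a \<in> ?A. relator k v a}"
      then have "FL.lspan {..<k} a \<in> \<U>" "has_type k (FL.lspan {..<k} a) v" unfolding has_type_def by blast+
      then show False using v unfolding typed_tuples_def by blast
    qed
    then show "real (card {a \<in> ?A. relator k v a}) = 0" by (simp only: card.empty)
  qed
  also have "\<dots> = (\<Sum>v\<in>typed_tuples k w \<U>. real (q ^ l - 1))"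
  proof (rule sum.cong[OF refl])
    fix v assume "v \<in> typed_tuples k w \<U>"
    then obtain U where U: "U \<in> \<U>" "has_type k U v" unfolding typed_tuples_def by blast
    have "{a \<in> ?A. relator k v a} = {a \<in> PiE {..<k} (\<lambda>_. UNIV). FL.lspan {..<k} a \<in> \<U> \<and> relator k v a}" by blast
    moreover have "card {a \<in> PiE {..<k} (\<lambda>_. UNIV). FL.lspan {..<k} a \<in> \<U> \<and> relator k v a} = q ^ l - 1"
      by (rule card_relators[OF _ _ U]) (fact inv big')+
    ultimately show "real (card {a \<in> ?A. relator k v a}) = real (q ^ l - 1)" by (simp only:)
  qed
  also have "\<dots> = real (card (typed_tuples k w \<U>)) * (real q ^ l - 1)"
    using q_power_gt_1[OF l_pos] by (simp add: of_nat_diff)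
  finally have 1: "(\<Sum>a\<in>?A. real (card {v \<in> ?V. relator k v a})) = real (card (typed_tuples k w \<U>)) * (real q ^ l - 1)" .
  have "(\<Sum>a\<in>?A. real (card {v \<in> ?V. relator k v a})) = (\<Sum>a\<in>?A. ?P)"
  proof (rule sum.cong[OF refl])
    fix a assume "a \<in> ?A"
    then have "q ^ 2 < card (FL.lspan {..<k} a)" using big' by blast
    then obtain i where i: "2 \<le> i" "i < k" "a i \<noteq> 0" by (rule has_nonzero_coeff)
    have "{v \<in> ?V. relator k v a} = {v \<in> PiE {..<k} (\<lambda>_. UNIV). (\<forall>j\<in>{0, 1}. v j = w j) \<and> relator k v a}" by blast
    then show "real (card {v \<in> ?V. relator k v a}) = ?P"
      using count_relator_nonzero[of i k a w, OF i w] by (simp only:)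
  qed
  also have "\<dots> = real (card ?A) * ?P" by simp
  \<comment> \<open>Sorting the coefficient tuples by their span leaves the spanning tuples of each
    \<open>U\<close>.\<close>
  also have "card ?A = (\<Sum>U\<in>\<U>. card {a \<in> PiE {..<k} (\<lambda>_. U). FL.lspan {..<k} a = U})"
  proof -
    have fib: "{a \<in> PiE {..<k} (\<lambda>_. UNIV). FL.lspan {..<k} a = U} = {a \<in> PiE {..<k} (\<lambda>_. U). FL.lspan {..<k} a = U}" for U
    proof (intro equalityI subsetI)
      fix a assume "a \<in> {a \<in> PiE {..<k} (\<lambda>_. UNIV). FL.lspan {..<k} a = U}"
      then show "a \<in> {a \<in> PiE {..<k} (\<lambda>_. U). FL.lspan {..<k} a = U}"
        using FL.lspan_superset[of "{..<k}" _ a] by (auto simp: PiE_iff)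
    qed (auto simp: PiE_iff)
    have "?A = (\<Union>U\<in>\<U>. {a \<in> PiE {..<k} (\<lambda>_. UNIV). FL.lspan {..<k} a = U})" by blast
    also have "card \<dots> = (\<Sum>U\<in>\<U>. card {a \<in> PiE {..<k} (\<lambda>_. UNIV). FL.lspan {..<k} a = U})"
    proof (rule card_UN_disjoint)
      show "\<forall>U\<in>\<U>. finite {a \<in> PiE {..<k} (\<lambda>_. UNIV). FL.lspan {..<k} a = U}"
        using finP by simp
    qed auto
    finally show ?thesis unfolding fib .
  qed
  also have "real (\<Sum>U\<in>\<U>. card {a \<in> PiE {..<k} (\<lambda>_. U). FL.lspan {..<k} a = U}) = (\<Sum>U\<in>\<U>. \<Prod>j<d U. real q ^ k - real q ^ j)"
    unfolding of_nat_sum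
  proof (rule sum.cong[OF refl])
    fix U assume "U \<in> \<U>"
    then show "real (card {a \<in> PiE {..<k} (\<lambda>_. U). FL.lspan {..<k} a = U}) = (\<Prod>j<d U. real q ^ k - real q ^ j)"
      using FL.spanning_count[of U "d U" k] closed[of U] card_range_emb by simp
  qed
  finally show ?thesis using 1 by simp
qed

text \<open>Type \<open>{0}\<close> means a zero relator, that is, independence over the large
  field. There is a single relator per tuple, so no factor \<open>q^l - 1\<close> arises.\<close>

lemma count_typed_tuples_zero:
  assumes "2 \<le> k" and w: "LV.indep {0, 1} w"
  shows "real (card (typed_tuples k w {{0}})) = (\<Prod>j = 2..<k. real CARD('v) - real (q ^ l) ^ j)"
proof -
  have "has_type k {0} v \<longleftrightarrow> relator k v (\<lambda>_. 0)" for v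
  proof
    assume "has_type k {0} v"
    then obtain a where a: "FL.lspan {..<k} a = {0}" "relator k v a" unfolding has_type_def by blast
    then have "a i = 0" if "i < k" for i using FL.lspan_superset[of "{..<k}" i a] that by auto
    then show "relator k v (\<lambda>_. 0)" using a(2) relator_cong[of k v v a "\<lambda>_. 0"] by blast
  next
    assume "relator k v (\<lambda>_. 0)"
    moreover have "FL.lspan {..<k} (\<lambda>_. 0) = {0}"
    proof
      show "FL.lspan {..<k} (\<lambda>_. 0) \<subseteq> {0}" by (rule FL.lspan_subset[OF FL.closed_zero]) simp
      show "{0} \<subseteq> FL.lspan {..<k} (\<lambda>_. 0)" using FL.closed_lspan FL.closed_def by blast
    qed
    ultimately show "has_type k {0} v" unfolding has_type_def by blast
  qed
  then have "typed_tuples k w {{0}} = {v \<in> PiE {..<k} (\<lambda>_. UNIV). (\<forall>j\<in>{0, 1}. v j = w j) \<and> relator k v (\<lambda>_. 0)}"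
    unfolding typed_tuples_def by blast
  then show ?thesis using count_relator_zero[of k "\<lambda>_. 0" w] assms by (simp only:)
qed

section \<open>Blocks spanned by typed tuples\<close>

text \<open>A set and not a multiset: a block has many bases, and each of them an orbit of types,
  but it is to occur once.\<close>

definition typed_blocks :: "nat \<Rightarrow> 'b set set \<Rightarrow> 'v set set" where
  "typed_blocks k \<U> = {FV.lspan {..<k} v | v. \<exists>U\<in>\<U>. has_type k U v}"

lemma typed_blocks_subspace:
  assumes "\<And>U. U \<in> \<U> \<Longrightarrow> card U \<noteq> q" "W \<in> typed_blocks k \<U>"
  shows "FV.closed W" "card W = q ^ k"
proof -
  obtain v U where v: "W = FV.lspan {..<k} v" "U \<in> \<U>" "has_type k U v"
    using assms(2) unfolding typed_blocks_def by blast
  show "FV.closed W" unfolding v(1) by (rule FV.closed_lspan)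
  have "FV.indep {..<k} v" using v(3) by (rule has_type_indep) (rule assms(1)[OF v(2)])
  then show "card W = q ^ k" unfolding v(1) using card_range_emb by (simp add: FV.card_lspan)
qed

text \<open>The typed tuples starting with \<open>w\<close> are partitioned by their spans. By
  \<open>has_type_change_basis\<close> every basis of a block that starts with \<open>w\<close>
  occurs among them, so each block contributes the same number.\<close>

lemma count_typed_blocks:
  assumes ne: "\<And>U. U \<in> \<U> \<Longrightarrow> card U \<noteq> q" and w: "FV.indep {0, 1} w" and k: "2 \<le> k"
  shows "real (card {W \<in> typed_blocks k \<U>. FV.lspan {0, 1} w \<subseteq> W}) * (\<Prod>j = 2..<k. real q ^ k - real q ^ j) =
    real (card (typed_tuples k w \<U>))"
proof -
  let ?S = "{W \<in> typed_blocks k \<U>. FV.lspan {0, 1} w \<subseteq> W}"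
  let ?F = "\<lambda>W. {v \<in> PiE {..<k} (\<lambda>_. W). (\<forall>j\<in>{0, 1}. v j = w j) \<and> FV.indep {..<k} v}"
  have sub: "FV.closed W" "card W = q ^ k" if "W \<in> ?S" for W
    using typed_blocks_subspace[OF ne, of _ W k] that by blast+
  have sp: "FV.lspan {..<k} v = W" if W: "W \<in> ?S" and v: "v \<in> ?F W" for W v
  proof (rule FV.lspan_eqI)
    show "v j \<in> W" if "j \<in> {..<k}" for j using v that by (auto simp: PiE_iff)
  qed (use sub[OF W] v card_range_emb in simp_all)
  have "typed_tuples k w \<U> = (\<Union>W\<in>?S. ?F W)"
  proof (intro equalityI subsetI)
    fix v assume v: "v \<in> typed_tuples k w \<U>"
    then obtain U where U: "U \<in> \<U>" "has_type k U v" unfolding typed_tuples_def by blast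
    let ?W = "FV.lspan {..<k} v"
    have "?W \<in> typed_blocks k \<U>" unfolding typed_blocks_def using U by blast
    moreover have "FV.lspan {0, 1} w \<subseteq> ?W"
    proof (rule FV.lspan_subset[OF FV.closed_lspan])
      fix j :: nat assume j: "j \<in> {0, 1}"
      then have "w j = v j" using v unfolding typed_tuples_def by force
      moreover have "v j \<in> ?W" using j k by (intro FV.lspan_superset) auto
      ultimately show "w j \<in> ?W" by simp
    qed
    moreover have "v \<in> PiE {..<k} (\<lambda>_. ?W)"
      using v unfolding typed_tuples_def by (auto simp: PiE_iff intro: FV.lspan_superset)
    moreover have "\<forall>j\<in>{0, 1}. v j = w j" using v unfolding typed_tuples_def by blast
    moreover have "FV.indep {..<k} v" using U(2) by (rule has_type_indep) (rule ne[OF U(1)])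
    ultimately show "v \<in> (\<Union>W\<in>?S. ?F W)" by blast
  next
    fix v assume "v \<in> (\<Union>W\<in>?S. ?F W)"
    then obtain W where W: "W \<in> ?S" "v \<in> ?F W" by blast
    then obtain u U where u: "W = FV.lspan {..<k} u" "U \<in> \<U>" "has_type k U u"
      unfolding typed_blocks_def by blast
    have "FV.indep {..<k} u" using u(3) by (rule has_type_indep) (rule ne[OF u(2)])
    then have "has_type k U v" using has_type_change_basis[OF u(3)] sp[OF W] u(1) by simp
    moreover have "v \<in> PiE {..<k} (\<lambda>_. UNIV)" using W(2) by (auto simp: PiE_iff)
    ultimately show "v \<in> typed_tuples k w \<U>" unfolding typed_tuples_def using W(2) u(2) by blast
  qed
  then have "card (typed_tuples k w \<U>) = card (\<Union>W\<in>?S. ?F W)" by (simp only:)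
  also have "\<dots> = (\<Sum>W\<in>?S. card (?F W))"
  proof (rule card_UN_disjoint)
    have "finite (PiE {..<k} (\<lambda>_. W :: 'v set))" for W by (intro finite_PiE) auto
    then show "\<forall>W\<in>?S. finite (?F W)" by simp
    show "\<forall>W\<in>?S. \<forall>W'\<in>?S. W \<noteq> W' \<longrightarrow> ?F W \<inter> ?F W' = {}"
    proof (intro ballI impI equals0I)
      fix W W' v assume "W \<in> ?S" "W' \<in> ?S" "W \<noteq> W'" "v \<in> ?F W \<inter> ?F W'"
      then show False using sp[of W v] sp[of W' v] by simp
    qed
  qed (rule finite)
  finally have "real (card (typed_tuples k w \<U>)) = (\<Sum>W\<in>?S. real (card (?F W)))" by (simp only: of_nat_sum)
  also have "\<dots> = (\<Sum>W\<in>?S. \<Prod>j = 2..<k. real q ^ k - real q ^ j)"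
  proof (rule sum.cong[OF refl])
    fix W assume W: "W \<in> ?S"
    have "w ` {0, 1} \<subseteq> W" using W FV.lspan_superset[of "{0, 1}" _ w] by blast
    then have "real (card (?F W)) = (\<Prod>i = card {0, 1::nat}..<card {..<k}. real (card W) - real (card (range emb)) ^ i)"
      using w k sub(1)[OF W] by (intro FV.indep_extend) auto
    then show "real (card (?F W)) = (\<Prod>j = 2..<k. real q ^ k - real q ^ j)"
      using sub(2)[OF W] card_range_emb by (simp add: numeral_2_eq_2)
  qed
  finally show ?thesis by simp
qed

text \<open>
  Two vectors of a block on a common line give a relation whose coefficients span dimension at
  most 2.
\<close>

lemma typed_blocks_line:
  assumes sz: "\<And>U. U \<in> \<U> \<Longrightarrow> card U = 1 \<or> q ^ 2 < card U" and W: "W \<in> typed_blocks k \<U>"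
    and x: "x \<in> W" "c \<cdot> x \<in> W" "x \<noteq> 0"
  shows "c \<in> range emb"
proof -
  obtain v U where v: "W = FV.lspan {..<k} v" "U \<in> \<U>" "has_type k U v"
    using W unfolding typed_blocks_def by blast
  obtain a where a: "FL.lspan {..<k} a = U" "relator k v a" using v(3) unfolding has_type_def by blast
  obtain f where f: "\<forall>j\<in>{..<k}. f j \<in> range emb" "x = (\<Sum>j<k. f j \<cdot> v j)"
    using x(1) unfolding v(1) FV.lspan_def by blast
  obtain g where g: "\<forall>j\<in>{..<k}. g j \<in> range emb" "c \<cdot> x = (\<Sum>j<k. g j \<cdot> v j)"
    using x(2) unfolding v(1) FV.lspan_def by blast
  have "(\<Sum>j<k. (c * f j - g j) \<cdot> v j) = 0"
    using f(2) g(2) by (simp add: scale_left_diff_distrib sum_subtractf scale_sum_right)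
  then obtain e where e: "\<And>j. j < k \<Longrightarrow> c * f j - g j = e * a j"
    using a(2)[unfolded relator_def, THEN spec, of "\<lambda>j. c * f j - g j"] by blast
  have "\<exists>j<k. f j \<noteq> 0"
  proof (rule ccontr)
    assume "\<not> (\<exists>j<k. f j \<noteq> 0)"
    then have "x = 0" unfolding f(2) by (intro sum.neutral) auto
    then show False using x(3) by simp
  qed
  then obtain j0 where j0: "j0 < k" "f j0 \<noteq> 0" by blast
  have f0: "f j0 \<in> range emb" and g0: "g j0 \<in> range emb" using f(1) g(1) j0(1) by blast+
  have fin_c: ?thesis if "c * f j0 - g j0 = 0"
  proof -
    have "c = g j0 * inverse (f j0)" using that j0(2) by (simp add: field_simps)
    then show ?thesis using FL.mult_E[OF g0 FL.inverse_E[OF f0]] by (simp only:)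
  qed
  show ?thesis
  proof (cases "e = 0")
    case True
    then show ?thesis using fin_c e[OF j0(1)] by simp
  next
    case False
    \<comment> \<open>Solving \<open>c * f j - g j = e * a j\<close> for \<open>a j\<close> writes
      it over the small field in terms of \<open>c / e\<close> and \<open>- 1 / e\<close>.\<close>
    let ?b = "\<lambda>i::nat. if i = 0 then c / e else - 1 / e"
    have "U \<subseteq> FL.lspan {0, 1} ?b" unfolding a(1)[symmetric]
    proof (rule FL.lspan_subset[OF FL.closed_lspan])
      fix j assume j: "j \<in> {..<k}"
      have fj: "f j \<in> range emb" and gj: "g j \<in> range emb" using f(1) g(1) j by blast+
      have "a j = f j * (c / e) + g j * (- 1 / e)" using e[of j] j False by (simp add: field_simps)
      also have "f j * (c / e) \<in> FL.lspan {0, 1} ?b"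
        using FL.closed_scale[OF FL.closed_lspan fj FL.lspan_superset[of "{0, 1}" 0 ?b]] by simp
      then have "f j * (c / e) + g j * (- 1 / e) \<in> FL.lspan {0, 1} ?b"
        using FL.closed_scale[OF FL.closed_lspan gj FL.lspan_superset[of "{0, 1}" 1 ?b]]
        by (intro FL.closed_add[OF FL.closed_lspan]) simp_all
      finally show "a j \<in> FL.lspan {0, 1} ?b" .
    qed
    then have "card U \<le> card (FL.lspan {0, 1} ?b)" by (intro card_mono) auto
    also have "\<dots> \<le> q ^ 2" using FL.card_lspan_le[of "{0, 1}" ?b] card_range_emb by (simp add: numeral_2_eq_2)
    \<comment> \<open>Only the type \<open>{0}\<close> is left. Then the relator is zero, and
      \<open>c * f j0 = g j0\<close> with both coefficients in the small field.\<close>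
    finally have "card U = 1" using sz[OF v(2)] by simp
    then obtain z where z: "U = {z}" by (rule card_1_singletonE)
    moreover have "0 \<in> U" unfolding a(1)[symmetric] using FL.closed_lspan FL.closed_def by blast
    moreover have "a j0 \<in> U" unfolding a(1)[symmetric] using j0 by (intro FL.lspan_superset) auto
    ultimately have "a j0 = 0" by simp
    then show ?thesis using fin_c e[OF j0(1)] by simp
  qed
qed

text \<open>An injective linear map over the large field preserves exactly the relations of a tuple,
  hence its types.\<close>

lemma typed_blocks_image:
  assumes add: "\<And>x y. g (x + y) = g x + g y" and scale: "\<And>c x. g (c \<cdot> x) = c \<cdot> g x" and inj: "inj g"
    and W: "W \<in> typed_blocks k \<U>"
  shows "g ` W \<in> typed_blocks k \<U>"
proof -
  obtain v U where v: "W = FV.lspan {..<k} v" "U \<in> \<U>" "has_type k U v"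
    using W unfolding typed_blocks_def by blast
  have g0: "g 0 = 0" using add[of 0 0] by simp
  have gsum: "g (\<Sum>j<k. c j \<cdot> v j) = (\<Sum>j<k. c j \<cdot> g (v j))" for c
    by (induction k) (simp_all add: g0 add scale)
  have zero_iff: "g x = 0 \<longleftrightarrow> x = 0" for x using inj g0 by (metis injD)
  have "has_type k U (\<lambda>i. g (v i))"
    using v(3) unfolding has_type_def relator_def gsum[symmetric] zero_iff .
  moreover have "g ` W = FV.lspan {..<k} (\<lambda>i. g (v i))"
    unfolding v(1) FV.lspan_eq_image image_image gsum ..
  ultimately show ?thesis unfolding typed_blocks_def using v(2) by blast
qed

end

section \<open>The construction\<close>

text \<open>Taking \<open>Q^(j*l)\<close> out of the numerator and \<open>Q^j\<close> out of the
  denominator leaves \<open>Q^((l-1)*j)\<close>. The exponents add up as stated because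
  \<open>2 + ... + (k - 1)\<close> is \<open>(k choose 2) - 1\<close>. The bound on \<open>k\<close>
  makes \<open>m - j\<close> a true difference.\<close>

lemma gaussian_quotient:
  fixes Q :: real
  assumes "1 < Q" "k \<le> m + 1" "0 < l"
  shows "(\<Prod>j = 2..<k. (Q ^ (m * l) - Q ^ (j * l)) / (Q ^ k - Q ^ j)) =
    Q ^ ((l - 1) * ((k choose 2) - 1)) * (\<Prod>j = 2..k - 1. (Q ^ ((m - j) * l) - 1) / (Q ^ (k - j) - 1))"
proof -
  have e: "(Q ^ (m * l) - Q ^ (j * l)) / (Q ^ k - Q ^ j) = Q ^ ((l - 1) * j) * ((Q ^ ((m - j) * l) - 1) / (Q ^ (k - j) - 1))"
    if "j \<in> {2..<k}" for j
  proof -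
    have j: "j < k" "j \<le> m" using that assms(2) by auto
    have "Q ^ (m * l) = Q ^ (j * l) * Q ^ ((m - j) * l)"
      using j by (simp flip: power_add add_mult_distrib)
    then have n: "Q ^ (m * l) - Q ^ (j * l) = Q ^ (j * l) * (Q ^ ((m - j) * l) - 1)" by (simp add: right_diff_distrib)
    have "Q ^ k = Q ^ j * Q ^ (k - j)" using j by (simp flip: power_add)
    then have d: "Q ^ k - Q ^ j = Q ^ j * (Q ^ (k - j) - 1)" by (simp add: right_diff_distrib)
    have "j * l = (l - 1) * j + j" using assms(3) by (cases l) auto
    then have p: "Q ^ (j * l) = Q ^ ((l - 1) * j) * Q ^ j" by (simp add: power_add)
    have "Q \<noteq> 0" using assms(1) by simp
    then show ?thesis unfolding n d by (simp add: p)
  qed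
  have "(\<Prod>j = 2..<k. Q ^ ((l - 1) * j)) = Q ^ (\<Sum>j = 2..<k. (l - 1) * j)" by (simp add: power_sum)
  also have "(\<Sum>j = 2..<k. (l - 1) * j) = (l - 1) * (\<Sum>j = 2..<k. j)" by (simp add: sum_distrib_left)
  also have "(\<Sum>j = 2..<k. j) = (k choose 2) - 1"
  proof (cases "k < 2")
    case True
    then have "k = 0 \<or> k = 1" by auto
    then show ?thesis by (auto simp: binomial_eq_0)
  next
    case False
    then have "2 \<le> k" by simp
    then show ?thesis
    proof (induction k rule: dec_induct)
      case (step n)
      have "1 \<le> n choose 2" using step(1) zero_less_binomial[of 2 n] by linarith
      moreover have "Suc n choose 2 = n + (n choose 2)" by (simp add: numeral_2_eq_2)
      ultimately show ?case using step by simp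
    qed simp
  qed
  finally have "(\<Prod>j = 2..<k. Q ^ ((l - 1) * j)) = Q ^ ((l - 1) * ((k choose 2) - 1))" .
  moreover have "(\<Prod>j = 2..<k. (Q ^ (m * l) - Q ^ (j * l)) / (Q ^ k - Q ^ j)) =
    (\<Prod>j = 2..<k. Q ^ ((l - 1) * j)) * (\<Prod>j = 2..<k. (Q ^ ((m - j) * l) - 1) / (Q ^ (k - j) - 1))"
    unfolding prod.distrib[symmetric] by (intro prod.cong refl e)
  moreover have "{2..<k} = {2..k - 1}" by auto
  ultimately show ?thesis by (simp only:)
qed

text \<open>Compares the number of tuples spanning a \<open>d\<close>-dimensional space with the
  number of bases of a block that extend a given basis of a plane.\<close>

lemma prod_falling_split:
  fixes f :: "nat \<Rightarrow> real"
  assumes "2 \<le> d" "d \<le> k"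
  shows "(\<Prod>j<d. f j) * (\<Prod>j = d..<k. f j) = f 0 * f 1 * (\<Prod>j = 2..<k. f j)"
proof -
  have "(\<Prod>j<d. f j) * (\<Prod>j = d..<k. f j) = (\<Prod>j = 0..<k. f j)"
    using prod.atLeastLessThan_concat[of 0 d k f] assms by (simp add: atLeast0LessThan)
  also have "\<dots> = (\<Prod>j = 0..<2. f j) * (\<Prod>j = 2..<k. f j)"
    using prod.atLeastLessThan_concat[of 0 2 k f] assms by simp
  also have "(\<Prod>j = 0..<2. f j) = f 0 * f 1" by (simp add: numeral_2_eq_2)
  finally show ?thesis .
qed

text \<open>The bridge between \<open>dim\<close> and cardinalities: a basis, given as a set, is
  enumerated as an independent family.\<close>

lemma card_subspace:
  fixes smul :: "'a::{field,finite} \<Rightarrow> 'v::{ab_group_add,finite} \<Rightarrow> 'v"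
  assumes "vector_space smul" "module.subspace smul W"
  shows "card W = CARD('a) ^ vector_space.dim smul W"
proof -
  interpret vector_space smul by fact
  interpret S: subfield_space smul UNIV by unfold_locales auto
  obtain C where C: "C \<subseteq> W" "independent C" "W \<subseteq> span C" "card C = dim W" using basis_exists by blast
  let ?n = "card C"
  obtain h where h: "bij_betw h {..<?n} C"
    using ex_bij_betw_nat_finite[of C] by (auto simp: atLeast0LessThan)
  have re: "(\<Sum>x\<in>C. smul (u x) x) = (\<Sum>i<?n. smul (u (h i)) (h i))" for u
    using sum.reindex_bij_betw[OF h, of "\<lambda>x. smul (u x) x"] by simp
  have "S.indep {..<?n} h" unfolding S.indep_def
  proof (intro allI impI, elim conjE)
    fix c assume c: "(\<Sum>j<?n. smul (c j) (h j)) = 0"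
    let ?u = "\<lambda>x. c (the_inv_into {..<?n} h x)"
    have inv: "the_inv_into {..<?n} h (h i) = i" if "i < ?n" for i
      using h that by (simp add: bij_betw_def the_inv_into_f_f)
    have "(\<Sum>x\<in>C. smul (?u x) x) = 0" unfolding re using c inv by simp
    then have "\<forall>x\<in>C. ?u x = 0" using C(2) dependent_finite[of C] by auto
    moreover have "h i \<in> C" if "i < ?n" for i using h that by (auto simp: bij_betw_def)
    ultimately show "\<forall>j\<in>{..<?n}. c j = 0" using inv by (metis lessThan_iff)
  qed
  then have "card (S.lspan {..<?n} h) = CARD('a) ^ ?n" by (simp add: S.card_lspan)
  moreover have "S.lspan {..<?n} h = span C"
  proof
    have "S.closed (span C)" unfolding S.closed_def by (auto intro: span_zero span_add span_scale)
    then show "S.lspan {..<?n} h \<subseteq> span C"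
      by (rule S.lspan_subset) (use h in \<open>auto simp: bij_betw_def intro: span_base\<close>)
    show "span C \<subseteq> S.lspan {..<?n} h"
    proof (rule span_minimal)
      show "C \<subseteq> S.lspan {..<?n} h"
      proof
        fix x assume "x \<in> C"
        then obtain i where "i < ?n" "x = h i" using h by (auto simp: bij_betw_def)
        then show "x \<in> S.lspan {..<?n} h" by (simp add: S.lspan_superset)
      qed
      show "subspace (S.lspan {..<?n} h)"
        using S.closed_lspan[of "{..<?n}" h] unfolding S.closed_def subspace_def by blast
    qed
  qed
  moreover have "span C = W" using C(1,3) assms(2) by (metis span_minimal subset_antisym)
  ultimately show ?thesis using C(4) by simp
qed

context extension_space
begin

lemma vector_space_restrict: "vector_space (\<lambda>a. sc (emb a))"
  by unfold_locales (simp_all add: scale_right_distrib emb_add scale_left_distrib emb_mult emb_1)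

lemma subspace_restrict_iff: "module.subspace (\<lambda>a. sc (emb a)) W \<longleftrightarrow> FV.closed W"
proof -
  interpret R: vector_space "\<lambda>a. sc (emb a)" by (rule vector_space_restrict)
  show ?thesis unfolding R.subspace_def FV.closed_def by blast
qed

lemma subspace_dim_restrict_iff:
  "module.subspace (\<lambda>a. sc (emb a)) W \<and> vector_space.dim (\<lambda>a. sc (emb a)) W = n \<longleftrightarrow> FV.closed W \<and> card W = q ^ n"
proof -
  have "card W = q ^ vector_space.dim (\<lambda>a. sc (emb a)) W" if "FV.closed W"
    using card_subspace[OF vector_space_restrict, of W] that card_a by (simp add: subspace_restrict_iff)
  then show ?thesis using q_gt_1 by (auto simp: subspace_restrict_iff)
qed

section \<open>Copying the design to every line\<close>

text \<open>The choice is made from the set of nonzero multiples of \<open>x\<close>, which depends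
  only on the line; hence all nonzero vectors of a line get the same representative.\<close>

definition line_rep :: "'v \<Rightarrow> 'v" where
  "line_rep x = (SOME y. y \<in> (\<lambda>c. c \<cdot> x) ` (UNIV - {0}))"

definition line_reps :: "'v set" where
  "line_reps = line_rep ` (UNIV - {0})"

lemma line_rep_eq: obtains c where "c \<noteq> 0" "line_rep x = c \<cdot> x"
proof -
  have "1 \<cdot> x \<in> (\<lambda>c. c \<cdot> x) ` (UNIV - {0})" by (rule imageI) simp
  then have "line_rep x \<in> (\<lambda>c. c \<cdot> x) ` (UNIV - {0})" unfolding line_rep_def by (rule someI)
  then show ?thesis using that by blast
qed

lemma line_rep_scale: "c \<noteq> 0 \<Longrightarrow> line_rep (c \<cdot> x) = line_rep x"
proof -
  assume c: "c \<noteq> 0"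
  have "(\<lambda>e. e \<cdot> c \<cdot> x) ` (UNIV - {0}) = (\<lambda>e. e \<cdot> x) ` (UNIV - {0})"
  proof (intro equalityI image_subsetI)
    fix e :: 'b assume "e \<in> UNIV - {0}"
    then show "e \<cdot> c \<cdot> x \<in> (\<lambda>e. e \<cdot> x) ` (UNIV - {0})"
      using c by (intro image_eqI[of _ _ "e * c"]) auto
  next
    fix e :: 'b assume "e \<in> UNIV - {0}"
    then show "e \<cdot> x \<in> (\<lambda>e. e \<cdot> c \<cdot> x) ` (UNIV - {0})"
      using c by (intro image_eqI[of _ _ "e / c"]) auto
  qed
  then show ?thesis unfolding line_rep_def by simp
qed

lemma line_rep_mem: "x \<noteq> 0 \<Longrightarrow> line_rep x \<in> line_reps"
  unfolding line_reps_def by simp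

lemma line_reps_nonzero: "r \<in> line_reps \<Longrightarrow> r \<noteq> 0"
proof -
  assume "r \<in> line_reps"
  then obtain x where x: "r = line_rep x" "x \<in> UNIV - {0}" unfolding line_reps_def by (rule imageE)
  obtain c where "c \<noteq> 0" "line_rep x = c \<cdot> x" by (rule line_rep_eq)
  then show ?thesis using x by simp
qed

lemma line_rep_line_reps: "r \<in> line_reps \<Longrightarrow> line_rep r = r"
proof -
  assume "r \<in> line_reps"
  then obtain x where x: "r = line_rep x" unfolding line_reps_def by (rule imageE)
  obtain c where "c \<noteq> 0" "line_rep x = c \<cdot> x" by (rule line_rep_eq)
  then show ?thesis using line_rep_scale[of c x] x by simp
qed

lemma line_rep_unique:
  assumes "r \<in> line_reps" "x \<noteq> 0" "x = c \<cdot> r"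
  shows "r = line_rep x"
proof -
  have "c \<noteq> 0" using assms by auto
  then show ?thesis using line_rep_scale[of c r] line_rep_line_reps[OF assms(1)] assms(3) by simp
qed

definition on_line :: "'v \<Rightarrow> 'b set \<Rightarrow> 'v set" where
  "on_line r U = (\<lambda>b. b \<cdot> r) ` U"

definition line_blocks :: "'b set multiset \<Rightarrow> 'v set multiset" where
  "line_blocks B = (\<Sum>r\<in>line_reps. image_mset (on_line r) B)"

lemma inj_on_line: "r \<noteq> 0 \<Longrightarrow> inj (on_line r)"
  unfolding on_line_def by (rule inj_image_eq_iff[THEN iffD1, THEN injI, rotated]) (auto simp: inj_on_def)

lemma closed_on_line: "FL.closed U \<Longrightarrow> FV.closed (on_line r U)"
  unfolding FV.closed_def
proof (intro conjI ballI)
  assume U: "FL.closed U"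
  show "0 \<in> on_line r U" unfolding on_line_def by (rule image_eqI[of _ _ 0]) (use U in \<open>auto simp: FL.closed_def\<close>)
  fix x y assume "x \<in> on_line r U" "y \<in> on_line r U"
  then show "x + y \<in> on_line r U" unfolding on_line_def
    using FL.closed_add[OF U] by (auto simp flip: scale_left_distrib)
next
  fix e x assume "FL.closed U" "e \<in> range emb" "x \<in> on_line r U"
  then show "e \<cdot> x \<in> on_line r U" unfolding on_line_def
    using FL.closed_scale[of U e] by auto
qed

lemma card_on_line: "r \<noteq> 0 \<Longrightarrow> card (on_line r U) = card U"
  unfolding on_line_def by (rule card_image) (simp add: inj_on_def)

lemma in_line_blocks: "S \<in># line_blocks B \<longleftrightarrow> (\<exists>r\<in>line_reps. \<exists>U. U \<in># B \<and> S = on_line r U)"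
  unfolding line_blocks_def by (auto simp: set_mset_sum)

lemma size_filter_sum: "finite R \<Longrightarrow> size (filter_mset P (\<Sum>r\<in>R. M r)) = (\<Sum>r\<in>R. size (filter_mset P (M r)))"
  by (induction R rule: finite_induct) auto

text \<open>The nonzero vector \<open>x\<close> lies on one line only, so the copies on all other
  lines contain no superset of \<open>T\<close>. On the line of \<open>r\<close> the count is pulled
  back to the field.\<close>

lemma count_line_blocks:
  assumes "r \<in> line_reps" and x: "x \<in> T" "x \<noteq> 0" and T: "T \<subseteq> range (\<lambda>b. b \<cdot> r)"
  shows "size {#S \<in># line_blocks B. T \<subseteq> S#} = size {#U \<in># B. {b. b \<cdot> r \<in> T} \<subseteq> U#}"
proof -
  have r0: "r \<noteq> 0" by (rule line_reps_nonzero) fact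
  have f: "size {#S \<in># image_mset (on_line r') B. T \<subseteq> S#} = size {#U \<in># B. T \<subseteq> on_line r' U#}" for r'
    by (simp add: filter_mset_image_mset)
  have "size {#S \<in># line_blocks B. T \<subseteq> S#} = (\<Sum>r'\<in>line_reps. size {#U \<in># B. T \<subseteq> on_line r' U#})"
    unfolding line_blocks_def by (simp add: size_filter_sum f)
  also have "\<dots> = (\<Sum>r'\<in>{r}. size {#U \<in># B. T \<subseteq> on_line r' U#})"
  proof (rule sum.mono_neutral_right)
    show "\<forall>r'\<in>line_reps - {r}. size {#U \<in># B. T \<subseteq> on_line r' U#} = 0"
    proof
      fix r' assume r': "r' \<in> line_reps - {r}"
      have "\<not> T \<subseteq> on_line r' U" for U
      proof
        assume "T \<subseteq> on_line r' U"
        then obtain b where "x = b \<cdot> r'" using x unfolding on_line_def by blast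
        then have "r' = line_rep x" using r' x by (intro line_rep_unique) auto
        moreover obtain b where "x = b \<cdot> r" using T x by blast
        then have "r = line_rep x" using assms(1) x by (intro line_rep_unique) auto
        ultimately show False using r' by simp
      qed
      then show "size {#U \<in># B. T \<subseteq> on_line r' U#} = 0" by simp
    qed
  qed (use assms(1) in auto)
  also have "\<dots> = size {#U \<in># B. T \<subseteq> on_line r U#}" by simp
  finally have 1: "size {#S \<in># line_blocks B. T \<subseteq> S#} = size {#U \<in># B. T \<subseteq> on_line r U#}" .
  have "T \<subseteq> on_line r U \<longleftrightarrow> {b. b \<cdot> r \<in> T} \<subseteq> U" for U
  proof
    assume sub: "T \<subseteq> on_line r U"
    show "{b. b \<cdot> r \<in> T} \<subseteq> U"
    proof
      fix b assume "b \<in> {b. b \<cdot> r \<in> T}"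
      then obtain b' where "b' \<in> U" "b \<cdot> r = b' \<cdot> r" using sub unfolding on_line_def by blast
      then show "b \<in> U" using r0 by simp
    qed
  next
    assume "{b. b \<cdot> r \<in> T} \<subseteq> U"
    then show "T \<subseteq> on_line r U" using T unfolding on_line_def by blast
  qed
  then show ?thesis using 1 by simp
qed

text \<open>The map \<open>g\<close> permutes the lines but sends a representative only to a
  multiple of the representative of the image line. The scalar is absorbed by the invariance of
  \<open>B\<close>.\<close>

lemma image_line_blocks:
  assumes scale: "\<And>c x. g (c \<cdot> x) = c \<cdot> g x" and inj: "inj g"
    and inv: "\<And>c. c \<noteq> 0 \<Longrightarrow> image_mset (image ((*) c)) B = B"
  shows "image_mset (image g) (line_blocks B) = line_blocks B"
proof -
  have g0: "g x \<noteq> 0" if "x \<noteq> 0" for x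
  proof
    assume "g x = 0"
    moreover have "g 0 = 0" using scale[of 0 0] by simp
    ultimately show False using injD[OF inj, of x 0] that by simp
  qed
  let ?\<rho> = "\<lambda>r. line_rep (g r)"
  have \<rho>: "?\<rho> r \<in> line_reps" if "r \<in> line_reps" for r
    using line_rep_mem g0 line_reps_nonzero that by simp
  have "inj_on ?\<rho> line_reps"
  proof (rule inj_onI)
    fix r s assume r: "r \<in> line_reps" "s \<in> line_reps" "?\<rho> r = ?\<rho> s"
    obtain c where c: "c \<noteq> 0" "?\<rho> r = c \<cdot> g r" by (rule line_rep_eq)
    obtain d where d: "d \<noteq> 0" "?\<rho> s = d \<cdot> g s" by (rule line_rep_eq)
    have "g (c \<cdot> r) = g (d \<cdot> s)" using r c d by (simp add: scale)
    then have "c \<cdot> r = d \<cdot> s" by (rule injD[OF inj])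
    then have "line_rep r = line_rep s" using line_rep_scale[OF c(1), of r] line_rep_scale[OF d(1), of s] by simp
    then show "r = s" using r line_rep_line_reps by simp
  qed
  moreover from this have "?\<rho> ` line_reps = line_reps"
    by (intro card_subset_eq) (use \<rho> in \<open>auto simp: card_image\<close>)
  ultimately have bij: "bij_betw ?\<rho> line_reps line_reps" unfolding bij_betw_def ..
  have on: "image_mset (image g) (image_mset (on_line r) B) = image_mset (on_line (?\<rho> r)) B" for r
  proof -
    obtain c where c: "c \<noteq> 0" "?\<rho> r = c \<cdot> g r" by (rule line_rep_eq)
    then have gr: "g r = inverse c \<cdot> ?\<rho> r" by simp
    have "g ` on_line r U = on_line (?\<rho> r) ((*) (inverse c) ` U)" for U
    proof -
      have "x \<cdot> g r = (inverse c * x) \<cdot> ?\<rho> r" for x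
        using gr scale_scale[of x "inverse c" "?\<rho> r"] by (simp only: mult.commute)
      then show ?thesis unfolding on_line_def image_image scale by (intro image_cong refl)
    qed
    then have "image_mset (image g) (image_mset (on_line r) B) = image_mset (on_line (?\<rho> r)) (image_mset (image ((*) (inverse c))) B)"
      by (simp add: multiset.map_comp comp_def)
    then show ?thesis using inv[of "inverse c"] c(1) by simp
  qed
  have "image_mset (image g) (\<Sum>r\<in>R. M r) = (\<Sum>r\<in>R. image_mset (image g) (M r))" for R :: "'v set" and M :: "'v \<Rightarrow> 'v set multiset"
    by (induction R rule: infinite_finite_induct) auto
  then have "image_mset (image g) (line_blocks B) = (\<Sum>r\<in>line_reps. image_mset (on_line (?\<rho> r)) B)"
    unfolding line_blocks_def on[symmetric] .
  also have "\<dots> = line_blocks B"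
    unfolding line_blocks_def by (rule sum.reindex_bij_betw[OF bij])
  finally show ?thesis .
qed

text \<open>A nonzero vector of a block determines its line, and on one line copying is
  injective.\<close>

lemma simple_line_blocks:
  assumes "simple_blocks B" and nz: "\<And>U. U \<in># B \<Longrightarrow> \<exists>b\<in>U. b \<noteq> 0"
  shows "simple_blocks (line_blocks B)"
  unfolding simple_blocks_def
proof
  fix S
  have sm: "count (line_blocks B) S = (\<Sum>r\<in>line_reps. count (image_mset (on_line r) B) S)"
    unfolding line_blocks_def by (simp add: count_sum)
  show "count (line_blocks B) S \<le> 1"
  proof (cases "S \<in># line_blocks B")
    case True
    then obtain r U where r: "r \<in> line_reps" and U: "U \<in># B" "S = on_line r U" unfolding in_line_blocks by blast
    obtain b where b: "b \<in> U" "b \<noteq> 0" using nz[OF U(1)] by blast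
    let ?x = "b \<cdot> r"
    have x: "?x \<in> S" "?x \<noteq> 0" using b U(2) line_reps_nonzero[OF r] unfolding on_line_def by auto
    have "count (line_blocks B) S = (\<Sum>r'\<in>{r}. count (image_mset (on_line r') B) S)"
      unfolding sm
    proof (rule sum.mono_neutral_right)
      show "\<forall>r'\<in>line_reps - {r}. count (image_mset (on_line r') B) S = 0"
      proof
        fix r' assume r': "r' \<in> line_reps - {r}"
        have "S \<notin># image_mset (on_line r') B"
        proof
          assume "S \<in># image_mset (on_line r') B"
          then obtain U' where "S = on_line r' U'" by auto
          then obtain b' where "?x = b' \<cdot> r'" using x(1) unfolding on_line_def by blast
          then have "r' = line_rep ?x" using r' x(2) by (intro line_rep_unique) auto
          moreover have "r = line_rep ?x" using r x(2) by (intro line_rep_unique) auto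
          ultimately show False using r' by simp
        qed
        then show "count (image_mset (on_line r') B) S = 0" by (simp only: not_in_iff)
      qed
    qed (use r in auto)
    also have "\<dots> = count B U"
    proof -
      have "on_line r -` {S} \<inter> set_mset B = {U}"
        using injD[OF inj_on_line[OF line_reps_nonzero[OF r]]] U by blast
      then show ?thesis by (simp add: count_image_mset)
    qed
    also have "\<dots> \<le> 1" using assms(1) unfolding simple_blocks_def by blast
    finally show ?thesis .
  qed (simp add: not_in_iff)
qed

section \<open>The number of typed blocks through a plane of the second kind\<close>

text \<open>A tuple of type \<open>{0}\<close> satisfies only the trivial relation, so every type of
  it is \<open>{0}\<close>.\<close>

lemma card_typed_tuples_insert_zero:
  assumes "\<And>U. U \<in> \<U> \<Longrightarrow> card U \<noteq> 1"
  shows "card (typed_tuples k w (insert {0} \<U>)) = card (typed_tuples k w {{0}}) + card (typed_tuples k w \<U>)"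
proof -
  have "typed_tuples k w (insert {0} \<U>) = typed_tuples k w {{0}} \<union> typed_tuples k w \<U>"
    unfolding typed_tuples_def by blast
  moreover have "typed_tuples k w {{0}} \<inter> typed_tuples k w \<U> = {}"
  proof (rule equals0I)
    fix v assume "v \<in> typed_tuples k w {{0}} \<inter> typed_tuples k w \<U>"
    then obtain U where U: "U \<in> \<U>" "has_type k U v" and z: "has_type k {0} v" unfolding typed_tuples_def by blast
    obtain a where a: "FL.lspan {..<k} a = U" "relator k v a" using U(2) unfolding has_type_def by blast
    obtain b where b: "FL.lspan {..<k} b = {0}" "relator k v b" using z unfolding has_type_def by blast
    have b0: "b i = 0" if "i < k" for i using FL.lspan_superset[of "{..<k}" i b] b(1) that by auto
    have "\<exists>e. \<forall>i<k. a i = e * a i" by (rule exI[of _ 1]) simp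
    then have "(\<Sum>i<k. a i \<cdot> v i) = 0" using a(2)[unfolded relator_def, THEN spec, of a] by blast
    then obtain e where "\<forall>i<k. a i = e * b i" using b(2)[unfolded relator_def, THEN spec, of a] by blast
    then have "FL.lspan {..<k} a = FL.lspan {..<k} b" by (intro FL.lspan_cong) (use b0 in simp)
    then have "card U = 1" using a(1) b(1) by simp
    then show False using assms[OF U(1)] by simp
  qed
  moreover have "finite (typed_tuples k w \<V>)" for \<V>
  proof -
    have "finite (PiE {..<k} (\<lambda>_. UNIV :: 'v set))" by (intro finite_PiE) auto
    then show ?thesis unfolding typed_tuples_def by simp
  qed
  ultimately show ?thesis by (simp add: card_Un_disjoint)
qed

lemma LV_indep_imp_FV_indep: "LV.indep J w \<Longrightarrow> FV.indep J w"
  unfolding LV.indep_def FV.indep_def by blast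

text \<open>Identifies the count with the right side of the equation for \<open>lam\<close>. The
  \<open>q^l - 1\<close> relators per tuple cancel against the numerator of the orbit size
  \<open>(q^l - 1) / (q^u - 1)\<close>.\<close>

lemma card_typed_blocks:
  fixes w :: "nat \<Rightarrow> nat \<Rightarrow> int"
  assumes card_v: "CARD('v) = q ^ (m * l)" and k: "3 \<le> k" "k \<le> m + 1" and w0: "w0 \<in> {0, 1 :: nat}"
    and inv: "\<And>U c. U \<in> \<U> \<Longrightarrow> c \<noteq> 0 \<Longrightarrow> (*) c ` U \<in> \<U>"
    and d: "\<And>U. U \<in> \<U> \<Longrightarrow> 3 \<le> d U \<and> FL.closed U \<and> card U = q ^ d U"
    and sum: "\<And>f :: nat \<Rightarrow> real. (\<Sum>U\<in>\<U>. f (d U)) =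
      (\<Sum>r = 2..k - 1. \<Sum>u | u dvd gcd (r + 1) l. of_int (w r u) * (real q ^ l - 1) / (real q ^ u - 1) * f (r + 1))"
    and x: "LV.indep {0, 1} x"
  defines "\<V> \<equiv> \<U> \<union> (if w0 = 1 then {{0}} else {})"
  shows "real (card {W \<in> typed_blocks k \<V>. FV.lspan {0, 1} x \<subseteq> W}) =
    (\<Sum>r = 2..k - 1. \<Sum>u | u dvd gcd (r + 1) l.
         of_int (w r u) *
         (((real q ^ k - 1) * (real q ^ k - real q) *
             (\<Prod>j = 2..k - 2. real q ^ (m * l) - real q ^ (j * l))) /
          ((real q ^ u - 1) * (\<Prod>j = r + 1..k - 1. real q ^ k - real q ^ j))))
      + real w0 * real q ^ ((l - 1) * ((k choose 2) - 1)) *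
        (\<Prod>j = 2..k - 1. (real q ^ ((m - j) * l) - 1) / (real q ^ (k - j) - 1))"
proof -
  let ?Q = "real q"
  have Q: "1 < ?Q" using q_gt_1 by simp
  let ?A = "\<lambda>d. \<Prod>j<d. ?Q ^ k - ?Q ^ j"
  let ?D = "\<Prod>j = 2..<k. ?Q ^ k - ?Q ^ j"
  let ?P = "\<Prod>j = 2..<k - 1. ?Q ^ (m * l) - ?Q ^ (j * l)"
  have pw: "real (q ^ l) ^ j = ?Q ^ (j * l)" for j by (simp add: mult.commute flip: power_mult)
  have "1 < ?Q ^ l" using Q l_pos by (rule one_less_power)
  then have ql: "?Q ^ l - 1 \<noteq> 0" by simp
  have D: "?D \<noteq> 0" using Q by (auto simp: power_inject_exp)
  have cardU: "q ^ 2 < card U" if "U \<in> \<U>" for U using d[OF that] q_gt_1 by (simp add: power_strict_increasing_iff)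
  have gt: "1 < q ^ 2" "q < q ^ 2" using q_gt_1 by (simp_all add: power2_eq_square one_less_mult)
  have neq: "card U \<noteq> q" if "U \<in> \<V>" for U
    using cardU[of U] that gt q_gt_1 unfolding \<V>_def by (auto split: if_splits)
  have T1: "real (card (typed_tuples k x \<U>)) * (?Q ^ l - 1) = (\<Sum>U\<in>\<U>. ?A (d U)) * ?P"
    using count_typed_tuples[of \<U> d x k] inv d x card_v unfolding pw by simp
  have T0: "real (card (typed_tuples k x {{0}})) = (\<Prod>j = 2..<k. ?Q ^ (m * l) - ?Q ^ (j * l))"
    using count_typed_tuples_zero[of k x] k x card_v unfolding pw by simp
  have "real (card (typed_tuples k x \<V>)) = real (card (typed_tuples k x \<U>)) + real w0 * real (card (typed_tuples k x {{0}}))"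
  proof (cases "w0 = 1")
    case True
    then have "\<V> = insert {0} \<U>" unfolding \<V>_def by simp
    then have "card (typed_tuples k x \<V>) = card (typed_tuples k x {{0}}) + card (typed_tuples k x \<U>)"
      using card_typed_tuples_insert_zero[of \<U> k x] cardU gt by fastforce
    then show ?thesis using True by simp
  next
    case False
    then have "w0 = 0" using w0 by simp
    then show ?thesis unfolding \<V>_def by simp
  qed
  moreover have "real (card {W \<in> typed_blocks k \<V>. FV.lspan {0, 1} x \<subseteq> W}) * ?D = real (card (typed_tuples k x \<V>))"
    using k by (intro count_typed_blocks LV_indep_imp_FV_indep x neq) auto
  ultimately have "real (card {W \<in> typed_blocks k \<V>. FV.lspan {0, 1} x \<subseteq> W}) =
    real (card (typed_tuples k x \<U>)) / ?D + real w0 * (real (card (typed_tuples k x {{0}})) / ?D)"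
    using D by (simp add: field_simps)
  also have "real (card (typed_tuples k x {{0}})) / ?D = (\<Prod>j = 2..<k. (?Q ^ (m * l) - ?Q ^ (j * l)) / (?Q ^ k - ?Q ^ j))"
    unfolding T0 prod_dividef ..
  also have "\<dots> = ?Q ^ ((l - 1) * ((k choose 2) - 1)) * (\<Prod>j = 2..k - 1. (?Q ^ ((m - j) * l) - 1) / (?Q ^ (k - j) - 1))"
    by (rule gaussian_quotient[OF Q k(2) l_pos])
  also have "real (card (typed_tuples k x \<U>)) / ?D = (\<Sum>U\<in>\<U>. ?A (d U) * (?P / (?D * (?Q ^ l - 1))))"
  proof -
    have "real (card (typed_tuples k x \<U>)) = (\<Sum>U\<in>\<U>. ?A (d U)) * ?P / (?Q ^ l - 1)"
      using T1 ql by (simp add: eq_divide_eq)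
    then show ?thesis unfolding sum_distrib_right[symmetric] by (simp add: mult.commute)
  qed
  also have "\<dots> = (\<Sum>r = 2..k - 1. \<Sum>u | u dvd gcd (r + 1) l.
      of_int (w r u) * (?Q ^ l - 1) / (?Q ^ u - 1) * (?A (r + 1) * (?P / (?D * (?Q ^ l - 1)))))"
    by (rule sum)
  also have "\<dots> = (\<Sum>r = 2..k - 1. \<Sum>u | u dvd gcd (r + 1) l. of_int (w r u) *
         (((?Q ^ k - 1) * (?Q ^ k - ?Q) * (\<Prod>j = 2..k - 2. ?Q ^ (m * l) - ?Q ^ (j * l))) /
          ((?Q ^ u - 1) * (\<Prod>j = r + 1..k - 1. ?Q ^ k - ?Q ^ j))))"
  proof (intro sum.cong refl)
    fix r u assume "r \<in> {2..k - 1}" "u \<in> {u. u dvd gcd (r + 1) l}"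
    then have r: "2 \<le> r + 1" "r + 1 \<le> k" using k by auto
    let ?E = "\<Prod>j = r + 1..<k. ?Q ^ k - ?Q ^ j"
    have E: "?E \<noteq> 0" using Q by (auto simp: power_inject_exp)
    \<comment> \<open>Both sides equal the full product over \<open>j < k\<close>.\<close>
    have AE: "?A (r + 1) * ?E = (?Q ^ k - 1) * (?Q ^ k - ?Q) * ?D"
      using prod_falling_split[OF r, of "\<lambda>j. ?Q ^ k - ?Q ^ j"] by simp
    have A: "?A (r + 1) / ?D = (?Q ^ k - 1) * (?Q ^ k - ?Q) / ?E"
      by (rule iffD2[OF frac_eq_eq[OF D E] AE])
    have s1: "{r + 1..k - 1} = {r + 1..<k}" and s2: "{2..k - 2} = {2..<k - 1}" using k by auto
    have "of_int (w r u) * (?Q ^ l - 1) / (?Q ^ u - 1) * (?A (r + 1) * (?P / (?D * (?Q ^ l - 1)))) =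
      of_int (w r u) / (?Q ^ u - 1) * ((?A (r + 1) / ?D) * ?P) * ((?Q ^ l - 1) / (?Q ^ l - 1))"
      by (simp only: times_divide_eq_left times_divide_eq_right divide_divide_eq_left divide_divide_eq_right mult_ac)
    also have "\<dots> = of_int (w r u) / (?Q ^ u - 1) * ((?Q ^ k - 1) * (?Q ^ k - ?Q) / ?E * ?P)"
      unfolding A using ql by simp
    also have "\<dots> = of_int (w r u) * (((?Q ^ k - 1) * (?Q ^ k - ?Q) * ?P) / ((?Q ^ u - 1) * ?E))"
      by (simp only: times_divide_eq_left times_divide_eq_right divide_divide_eq_left divide_divide_eq_right mult_ac)
    finally show "of_int (w r u) * (?Q ^ l - 1) / (?Q ^ u - 1) * (?A (r + 1) * (?P / (?D * (?Q ^ l - 1)))) =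
      of_int (w r u) * (((?Q ^ k - 1) * (?Q ^ k - ?Q) * (\<Prod>j = 2..k - 2. ?Q ^ (m * l) - ?Q ^ (j * l))) /
          ((?Q ^ u - 1) * (\<Prod>j = r + 1..k - 1. ?Q ^ k - ?Q ^ j)))"
      unfolding s1 s2 .
  qed
  finally show ?thesis by (simp only: mult.assoc)
qed

section \<open>The two kinds of planes\<close>

text \<open>In the second case \<open>x\<close> and \<open>c \<cdot> x\<close> witness, by
  \<open>typed_blocks_line\<close>, that no typed block contains the plane, while \<open>r\<close>
  names the only line whose copies can.\<close>

lemma plane_cases:
  assumes "FV.closed T" "card T = q ^ 2"
  obtains (independent) x where "LV.indep {0, 1} x" "T = FV.lspan {0, 1} x"
  | (line) r x c where "r \<in> line_reps" "x \<in> T" "x \<noteq> 0" "c \<cdot> x \<in> T" "c \<notin> range emb" "T \<subseteq> range (\<lambda>b. b \<cdot> r)"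
proof -
  obtain n v where v: "v \<in> PiE {..<n} (\<lambda>_. T)" "FV.indep {..<n} v" "FV.lspan {..<n} v = T"
    by (rule FV.basis_exists_family[OF assms(1)])
  have "q ^ n = q ^ 2" using FV.card_lspan[of "{..<n}" v] v assms(2) card_range_emb by simp
  then have "n = 2" using q_gt_1 by (simp add: power_inject_exp)
  then have n: "{..<n} = {0, 1}" by auto
  have i: "FV.indep {0, 1} v" and T: "T = FV.lspan {0, 1} v" using v(2,3) unfolding n by simp_all
  show ?thesis
  proof (cases "LV.indep {0, 1} v")
    case True
    then show ?thesis using T by (rule independent)
  next
    case False
    then obtain a b where ab: "a \<cdot> v 0 + b \<cdot> v 1 = 0" "a \<noteq> 0 \<or> b \<noteq> 0" unfolding LV.indep_two_iff by blast
    have v0: "v 0 \<noteq> 0"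
      using i FL.one_E FL.zero_E unfolding FV.indep_two_iff by (metis add_0 scale_one scale_zero_left zero_neq_one)
    have "b \<noteq> 0"
    proof
      assume "b = 0"
      then show False using ab v0 by simp
    qed
    have "inverse b \<cdot> (a \<cdot> v 0 + b \<cdot> v 1) = 0" using ab by simp
    then have "(inverse b * a) \<cdot> v 0 + v 1 = 0" using \<open>b \<noteq> 0\<close> by (simp add: scale_right_distrib)
    then have v1: "v 1 = (- (inverse b * a)) \<cdot> v 0" by (simp add: add_eq_0_iff2)
    \<comment> \<open>The ratio of the two basis vectors. In the small field it would make them
      dependent there.\<close>
    define c where "c = - (inverse b * a)"
    have v1c: "v 1 = c \<cdot> v 0" unfolding c_def by (rule v1)
    have c: "c \<notin> range emb"
    proof
      assume "c \<in> range emb"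
      moreover have "c \<cdot> v 0 + (- 1) \<cdot> v 1 = 0" using v1c by simp
      ultimately have "- 1 = (0 :: 'b)" using i FL.uminus_E[OF FL.one_E] unfolding FV.indep_two_iff by blast
      then show False by simp
    qed
    obtain e where e: "e \<noteq> 0" "line_rep (v 0) = e \<cdot> v 0" by (rule line_rep_eq)
    have vT: "v 0 \<in> T" "v 1 \<in> T" unfolding T by (rule FV.lspan_superset; simp)+
    show ?thesis
    proof (rule line[of "line_rep (v 0)" "v 0" c])
      show "line_rep (v 0) \<in> line_reps" using v0 by (rule line_rep_mem)
      show "c \<cdot> v 0 \<in> T" using vT(2) v1c by simp
      show "T \<subseteq> range (\<lambda>b. b \<cdot> line_rep (v 0))"
      proof
        fix y assume "y \<in> T"
        then obtain f where "y = (\<Sum>j\<in>{0, 1}. f j \<cdot> v j)" unfolding T FV.lspan_def by blast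
        then have "y = (f 0 + f 1 * c) \<cdot> v 0" using v1c by (simp add: scale_left_distrib)
        also have "\<dots> = ((f 0 + f 1 * c) / e) \<cdot> line_rep (v 0)" using e by simp
        finally show "y \<in> range (\<lambda>b. b \<cdot> line_rep (v 0))" by blast
      qed
    qed (rule vT(1) v0 c)+
  qed
qed

lemma LV_indep_twoD: "LV.indep {0, 1} x \<Longrightarrow> a \<cdot> x 0 + b \<cdot> x 1 = 0 \<Longrightarrow> a = 0 \<and> b = 0"
  unfolding LV.indep_two_iff by blast

lemma no_line_block:
  assumes "LV.indep {0, 1} x" "r \<in> line_reps"
  shows "\<not> FV.lspan {0, 1} x \<subseteq> on_line r U"
proof
  assume sub: "FV.lspan {0, 1} x \<subseteq> on_line r U"
  have "x 0 \<in> FV.lspan {0, 1} x" "x 1 \<in> FV.lspan {0, 1} x" by (rule FV.lspan_superset; simp)+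
  then obtain a b where ab: "x 0 = a \<cdot> r" "x 1 = b \<cdot> r" using sub unfolding on_line_def by blast
  have "b \<cdot> x 0 + (- a) \<cdot> x 1 = 0" unfolding ab by (simp add: mult.commute)
  then have "a = 0" using LV_indep_twoD[OF assms(1)] by fastforce
  then have "1 \<cdot> x 0 + 0 \<cdot> x 1 = 0" using ab by simp
  then have "(1 :: 'b) = 0" using LV_indep_twoD[OF assms(1)] by blast
  then show False by simp
qed

text \<open>A line over the small field has only \<open>q\<close> elements, so \<open>U\<close>
  contains two elements whose ratio is outside that field.\<close>

lemma large_subspace_not_in_line:
  assumes "q ^ 2 \<le> card U"
  obtains b b' where "b \<in> U" "b \<noteq> 0" "b' \<in> U" "b' / b \<notin> range emb"
proof -
  have "q < q ^ 2" using q_gt_1 by (simp add: power2_eq_square)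
  then have lt: "q < card U" using assms by simp
  have "\<not> U \<subseteq> {0}"
  proof
    assume "U \<subseteq> {0}"
    then have "card U \<le> card {0 :: 'b}" by (intro card_mono) auto
    then show False using lt q_gt_1 by simp
  qed
  then obtain b where b: "b \<in> U" "b \<noteq> 0" by blast
  have "\<not> U \<subseteq> (\<lambda>e. e * b) ` range emb"
  proof
    assume "U \<subseteq> (\<lambda>e. e * b) ` range emb"
    then have "card U \<le> card ((\<lambda>e. e * b) ` range emb)" by (intro card_mono) auto
    also have "\<dots> \<le> q" using card_image_le[of "range emb" "\<lambda>e. e * b"] card_range_emb by simp
    finally show False using lt by simp
  qed
  then obtain b' where b': "b' \<in> U" "b' \<notin> (\<lambda>e. e * b) ` range emb" by blast
  have "b' / b \<notin> range emb"
  proof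
    assume "b' / b \<in> range emb"
    then have "b' / b * b \<in> (\<lambda>e. e * b) ` range emb" by (rule imageI)
    then show False using b' b by simp
  qed
  then show ?thesis using b b'(1) by (intro that)
qed

text \<open>For simplicity of the result, the two parts must not share a block. A copied block of
  dimension at least 2 has two vectors with ratio outside the small field, which
  \<open>typed_blocks_line\<close> forbids in a typed block.\<close>

lemma line_block_not_typed:
  assumes sz: "\<And>U. U \<in> \<V> \<Longrightarrow> card U = 1 \<or> q ^ 2 < card U"
    and "S \<in># line_blocks B" and big: "\<And>U. U \<in># B \<Longrightarrow> q ^ 2 \<le> card U"
  shows "S \<notin> typed_blocks k \<V>"
proof
  assume S: "S \<in> typed_blocks k \<V>"
  obtain r U where r: "r \<in> line_reps" and U: "U \<in># B" "S = on_line r U" using assms(2) unfolding in_line_blocks by blast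
  obtain b b' where b: "b \<in> U" "b \<noteq> 0" "b' \<in> U" "b' / b \<notin> range emb"
    by (rule large_subspace_not_in_line[OF big[OF U(1)]])
  have "b \<cdot> r \<in> S" "b' \<cdot> r \<in> S" using b U(2) unfolding on_line_def by blast+
  moreover have "(b' / b) \<cdot> b \<cdot> r = b' \<cdot> r" using b by simp
  moreover have "b \<cdot> r \<noteq> 0" using b line_reps_nonzero[OF r] by simp
  ultimately have "b' / b \<in> range emb" using typed_blocks_line[OF sz S, of "b \<cdot> r" "b' / b"] by simp
  then show False using b by simp
qed

text \<open>Pulling \<open>T\<close> back along the line gives a plane of the original design.
  Discarding blocks with fewer than \<open>q ^ 2\<close> elements does not matter, since they
  contain no plane.\<close>

lemma count_line_block_plane:
  assumes design: "\<And>T. FL.closed T \<Longrightarrow> card T = q ^ 2 \<Longrightarrow> size {#U \<in># B. T \<subseteq> U#} = lam"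
    and T: "FV.closed T" "card T = q ^ 2" and r: "r \<in> line_reps" and x: "x \<in> T" "x \<noteq> 0"
    and sub: "T \<subseteq> range (\<lambda>b. b \<cdot> r)"
  shows "size {#S \<in># line_blocks {#U \<in># B. q ^ 2 \<le> card U#}. T \<subseteq> S#} = lam"
proof -
  let ?T = "{b. b \<cdot> r \<in> T}"
  have r0: "r \<noteq> 0" using r by (rule line_reps_nonzero)
  have "on_line r ?T = T" using sub unfolding on_line_def by blast
  then have card: "card ?T = q ^ 2" using card_on_line[OF r0, of ?T] T(2) by simp
  have "FL.closed ?T"
    using T(1) unfolding FL.closed_def FV.closed_def by (simp add: scale_left_distrib flip: scale_scale)
  then have "size {#U \<in># B. ?T \<subseteq> U#} = lam" using card by (rule design)
  moreover have "{#U \<in># {#U \<in># B. q ^ 2 \<le> card U#}. ?T \<subseteq> U#} = {#U \<in># B. ?T \<subseteq> U#}"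
  proof -
    have "q ^ 2 \<le> card U" if "?T \<subseteq> U" for U using card_mono[OF _ that] card by simp
    then show ?thesis by (auto simp: filter_filter_mset intro!: filter_mset_cong)
  qed
  ultimately show ?thesis using count_line_blocks[OF r x sub] by simp
qed

end

section \<open>The general linear group and the final design\<close>

lemma subgroup_GL_action: "subgroup (GL_action :: ('b::field ^ 'm \<Rightarrow> 'b ^ 'm) set) (BijGroup UNIV)"
proof -
  have inv: "invertible A \<Longrightarrow> \<exists>A'. invertible A' \<and> A ** A' = mat 1 \<and> A' ** A = mat 1" for A :: "'b ^ 'm ^ 'm"
    unfolding invertible_def by blast
  have bij: "bij (\<lambda>x. A *v x)" if A: "invertible A" for A :: "'b ^ 'm ^ 'm"
  proof -
    obtain A' where "A ** A' = mat 1" "A' ** A = mat 1" using inv[OF A] by blast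
    then show ?thesis
      by (intro o_bij[of "\<lambda>x. A' *v x"]) (auto simp: fun_eq_iff matrix_vector_mul_assoc)
  qed
  have carrier: "g \<in> Bij UNIV" if "g \<in> GL_action" for g :: "'b ^ 'm \<Rightarrow> 'b ^ 'm"
    using that bij unfolding GL_action_def Bij_def by auto
  show ?thesis
  proof (rule group.subgroupI[OF group_BijGroup])
    show "GL_action \<subseteq> carrier (BijGroup (UNIV :: ('b ^ 'm) set))" using carrier by (auto simp: BijGroup_def)
    have "invertible (mat 1 :: 'b ^ 'm ^ 'm)"
      unfolding invertible_def by (intro exI[of _ "mat 1"]) simp
    then have "(\<lambda>x. (mat 1 :: 'b ^ 'm ^ 'm) *v x) \<in> GL_action" unfolding GL_action_def by blast
    then show "(GL_action :: ('b ^ 'm \<Rightarrow> 'b ^ 'm) set) \<noteq> {}" by blast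
  next
    fix g :: "'b ^ 'm \<Rightarrow> 'b ^ 'm" assume g: "g \<in> GL_action"
    then obtain A where A: "invertible A" "g = (\<lambda>x. A *v x)" unfolding GL_action_def by blast
    obtain A' where A': "invertible A'" "A ** A' = mat 1" "A' ** A = mat 1" using inv[OF A(1)] by blast
    have "(\<lambda>x\<in>UNIV. inv_into UNIV g x) = (\<lambda>x. A' *v x)"
    proof
      fix x
      have "g (A' *v x) = x" unfolding A(2) using A'(2) by (simp add: matrix_vector_mul_assoc)
      moreover have "inj g" using bij[OF A(1)] A(2) by (simp add: bij_is_inj)
      ultimately show "(\<lambda>x\<in>UNIV. inv_into UNIV g x) x = A' *v x" by (simp add: inv_f_eq)
    qed
    moreover have "inv\<^bsub>BijGroup UNIV\<^esub> g = (\<lambda>x\<in>UNIV. inv_into UNIV g x)" using carrier[OF g] by (rule inv_BijGroup)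
    ultimately show "inv\<^bsub>BijGroup UNIV\<^esub> g \<in> GL_action" unfolding GL_action_def using A'(1) by auto
  next
    fix g h :: "'b ^ 'm \<Rightarrow> 'b ^ 'm" assume g: "g \<in> GL_action" and h: "h \<in> GL_action"
    then obtain A C where A: "invertible A" "g = (\<lambda>x. A *v x)" and C: "invertible C" "h = (\<lambda>x. C *v x)"
      unfolding GL_action_def by blast
    have "g \<otimes>\<^bsub>BijGroup UNIV\<^esub> h = (\<lambda>x. (A ** C) *v x)"
      using carrier[OF g] carrier[OF h] unfolding BijGroup_def A(2) C(2)
      by (auto simp: fun_eq_iff compose_def matrix_vector_mul_assoc)
    moreover have "invertible (A ** C)" using A(1) C(1) by (rule invertible_mult)
    ultimately show "g \<otimes>\<^bsub>BijGroup UNIV\<^esub> h \<in> GL_action" unfolding GL_action_def by auto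
  qed
qed

theorem theorem5p4:
  fixes emb :: "'a::{field,finite} \<Rightarrow> 'b::{field,finite}"
    and q m l k w0 lam :: nat
    and w :: "nat \<Rightarrow> nat \<Rightarrow> int"
    and K :: "nat set"
    and B :: "'b set multiset"
  assumes "primepow q" and "CARD('a) = q" and "CARD('b) = q ^ l" and "CARD('m::finite) = m"
    and "field_embedding emb"
    and "3 \<le> k" and "k \<le> min (m + 1) l"
    and "w0 \<in> {0, 1}"
    and "\<And>r u. 2 \<le> r \<Longrightarrow> r \<le> k - 1 \<Longrightarrow> u dvd gcd (r + 1) l \<Longrightarrow>
           0 \<le> w r u \<and> of_int (w r u) \<le> orbit_number q l (r + 1) u"
    and "real lam =
      (\<Sum>r = 2..k - 1. \<Sum>u | u dvd gcd (r + 1) l.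
         of_int (w r u) *
         (((real q ^ k - 1) * (real q ^ k - real q) *
             (\<Prod>j = 2..k - 2. real q ^ (m * l) - real q ^ (j * l))) /
          ((real q ^ u - 1) * (\<Prod>j = r + 1..k - 1. real q ^ k - real q ^ j))))
      + real w0 * real q ^ ((l - 1) * ((k choose 2) - 1)) *
        (\<Prod>j = 2..k - 1. (real q ^ ((m - j) * l) - 1) / (real q ^ (k - j) - 1))"
    and "q_pbd (ext_scale emb) l K lam B"
    and "admits_automorphism_group (ext_scale emb) B singer_cycle"
  shows "\<exists>B' :: ('b ^ 'm) set multiset.
    q_pbd (ext_vec_scale emb) (m * l) (K \<union> {k}) lam B' \<and>
    admits_automorphism_group (ext_vec_scale emb) B' GL_action \<and>
    (simple_blocks B \<longrightarrow> simple_blocks B')"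
proof -
  \<comment> \<open>The large field as a space over itself, in order to read the given design in
    terms of \<open>closed\<close> sets and cardinalities.\<close>
  interpret L: extension_space emb q l "(*) :: 'b \<Rightarrow> 'b \<Rightarrow> 'b"
    by unfold_locales (use assms in \<open>auto simp: algebra_simps\<close>)
  interpret V: extension_space emb q l "(*s) :: 'b \<Rightarrow> 'b ^ 'm \<Rightarrow> 'b ^ 'm"
    by unfold_locales (use assms in \<open>auto simp: vec.scale_right_distrib vec.scale_left_distrib\<close>)
  have ext: "ext_scale emb = (\<lambda>a. (*) (emb a))" "ext_vec_scale emb = (\<lambda>a. (*s) (emb a) :: 'b ^ 'm \<Rightarrow> _)"
    by (auto simp: fun_eq_iff ext_scale_def ext_vec_scale_def)
  note pbd = assms(11)[unfolded q_pbd_def ext]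
  have block: "L.FL.closed U \<and> (\<exists>n\<in>K. card U = q ^ n)" if "U \<in># B" for U
    using pbd that L.subspace_dim_restrict_iff[of U] by metis
  have design: "size {#U \<in># B. T \<subseteq> U#} = lam" if "L.FL.closed T" "card T = q ^ 2" for T
    using pbd that L.subspace_dim_restrict_iff[of T 2] by blast
  have singer: "image_mset (image ((*) c)) B = B" if "c \<noteq> 0" for c
    using assms(12) that unfolding admits_automorphism_group_def singer_cycle_def by blast
  have k: "k \<le> m + 1" "k \<le> l" using assms(7) by simp_all
  obtain \<U> d where inv: "\<And>U c. U \<in> \<U> \<Longrightarrow> c \<noteq> 0 \<Longrightarrow> (*) c ` U \<in> \<U>"
    and d: "\<And>U. U \<in> \<U> \<Longrightarrow> 3 \<le> d U \<and> L.FL.closed U \<and> card U = q ^ d U"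
    and sum: "\<And>f :: nat \<Rightarrow> real. (\<Sum>U\<in>\<U>. f (d U)) =
      (\<Sum>r = 2..k - 1. \<Sum>u | u dvd gcd (r + 1) l. of_int (w r u) * (real q ^ l - 1) / (real q ^ u - 1) * f (r + 1))"
    by (rule L.obtain_invariant_family[OF k(2), of w]) (use assms(9) in blast)+
  \<comment> \<open>Type \<open>{0}\<close> stands for the blocks with a basis independent over the
    large field; \<open>w0\<close> decides whether they are taken.\<close>
  define \<V> where "\<V> = \<U> \<union> (if w0 = 1 then {{0}} else {})"
  have big: "q ^ 2 < card U" if "U \<in> \<U>" for U
    using d[OF that] L.q_gt_1 by (simp add: power_strict_increasing_iff)
  have sz: "card U = 1 \<or> q ^ 2 < card U" if "U \<in> \<V>" for U
    using that big[of U] unfolding \<V>_def by (auto split: if_splits)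
  have "q < q ^ 2" using L.q_gt_1 by (simp add: power2_eq_square)
  then have neq: "card U \<noteq> q" if "U \<in> \<V>" for U using sz[OF that] L.q_gt_1 by auto
  have card_v: "CARD('b ^ 'm) = q ^ (m * l)" using assms(3,4) by (simp add: mult.commute flip: power_mult)
  \<comment> \<open>Blocks of dimension less than 2 cover nothing, but copies of \<open>{0}\<close> on different lines coincide.\<close>
  let ?B = "{#U \<in># B. q ^ 2 \<le> card U#}"
  let ?W = "V.typed_blocks k \<V>"
  let ?B' = "V.line_blocks ?B + mset_set ?W"
  have count_W: "card {W \<in> ?W. V.FV.lspan {0, 1} x \<subseteq> W} = lam" if x: "V.LV.indep {0, 1} x" for x
  proof -
    \<comment> \<open>The prescribed value of \<open>lam\<close> enters here: it is the number of
      typed blocks through any plane of the second kind.\<close>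
    have "real (card {W \<in> ?W. V.FV.lspan {0, 1} x \<subseteq> W}) = real lam"
      unfolding \<V>_def assms(10)
      by (rule V.card_typed_blocks[where d = d, OF card_v assms(6) k(1) assms(8)]) (fact inv d sum x)+
    then show ?thesis by (simp only: of_nat_eq_iff)
  qed
  have "q_pbd (ext_vec_scale emb) (m * l) (K \<union> {k}) lam ?B'"
    unfolding q_pbd_def ext
  proof (intro conjI allI impI)
    show "vector_space (\<lambda>a. (*s) (emb a) :: 'b ^ 'm \<Rightarrow> _)" by (rule V.vector_space_restrict)
    show "vector_space.dim (\<lambda>a. (*s) (emb a)) (UNIV :: ('b ^ 'm) set) = m * l"
      using V.subspace_dim_restrict_iff[of UNIV "m * l"] V.FV.closed_UNIV card_v by blast
  next
    fix S :: "('b ^ 'm) set" assume "S \<in># ?B'"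
    then consider "S \<in># V.line_blocks ?B" | "S \<in> ?W" by auto
    then have "V.FV.closed S \<and> (\<exists>n\<in>K \<union> {k}. card S = q ^ n)"
    proof cases
      case 1
      then obtain r U where r: "r \<in> V.line_reps" "U \<in># ?B" "S = V.on_line r U" unfolding V.in_line_blocks by blast
      then have "L.FL.closed U \<and> (\<exists>n\<in>K. card U = q ^ n)" using block[of U] by simp
      then show ?thesis using r V.closed_on_line[of U r] V.card_on_line[OF V.line_reps_nonzero[OF r(1)], of U] by auto
    next
      case 2
      have "V.FV.closed S" by (rule V.typed_blocks_subspace(1)[OF neq 2])
      moreover have "card S = q ^ k" by (rule V.typed_blocks_subspace(2)[OF neq 2])
      ultimately show ?thesis by blast
    qed
    then obtain n where "n \<in> K \<union> {k}" "V.FV.closed S" "card S = q ^ n" by blast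
    then show "module.subspace (\<lambda>a. (*s) (emb a)) S" "vector_space.dim (\<lambda>a. (*s) (emb a)) S \<in> K \<union> {k}"
      using V.subspace_dim_restrict_iff[of S n] by auto
  next
    fix T :: "('b ^ 'm) set" assume "module.subspace (\<lambda>a. (*s) (emb a)) T \<and> vector_space.dim (\<lambda>a. (*s) (emb a)) T = 2"
    then have T: "V.FV.closed T" "card T = q ^ 2" using V.subspace_dim_restrict_iff[of T 2] by blast+
    have sp: "size {#S \<in># ?B'. T \<subseteq> S#} = size {#S \<in># V.line_blocks ?B. T \<subseteq> S#} + card {W \<in> ?W. T \<subseteq> W}"
      by (simp add: filter_mset_mset_set)
    show "size {#S \<in># ?B'. T \<subseteq> S#} = lam"
    proof (rule V.plane_cases[OF T])
      fix x assume x: "V.LV.indep {0, 1} x" "T = V.FV.lspan {0, 1} x"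
      have "\<not> T \<subseteq> S" if "S \<in># V.line_blocks ?B" for S
        using V.no_line_block[OF x(1)] that unfolding V.in_line_blocks x(2) by blast
      then have "set_mset {#S \<in># V.line_blocks ?B. T \<subseteq> S#} = {}" by simp
      then have "{#S \<in># V.line_blocks ?B. T \<subseteq> S#} = {#}" by (simp only: set_mset_eq_empty_iff)
      then show ?thesis using sp count_W[OF x(1)] x(2) by simp
    next
      fix r x c assume r: "r \<in> V.line_reps" "x \<in> T" "x \<noteq> 0" "c *s x \<in> T" "c \<notin> range emb" "T \<subseteq> range (\<lambda>b. b *s r)"
      have "{W \<in> ?W. T \<subseteq> W} = {}" using V.typed_blocks_line[of \<V>, OF sz, of _ k x c] r by blast
      then have "card {W \<in> ?W. T \<subseteq> W} = 0" by (simp only: card.empty)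
      moreover have "size {#S \<in># V.line_blocks ?B. T \<subseteq> S#} = lam"
        by (rule V.count_line_block_plane[OF design T r(1-3,6)])
      ultimately show ?thesis using sp by simp
    qed
  qed
  moreover have "admits_automorphism_group (ext_vec_scale emb) ?B' GL_action"
    unfolding admits_automorphism_group_def
  proof (intro conjI ballI)
    show "subgroup GL_action (BijGroup (UNIV :: ('b ^ 'm) set))" by (rule subgroup_GL_action)
  next
    fix g :: "'b ^ 'm \<Rightarrow> 'b ^ 'm" assume "g \<in> GL_action"
    then obtain A where A: "g = (\<lambda>x. A *v x)" "invertible A" unfolding GL_action_def by blast
    have add: "g (x + y) = g x + g y" and scale: "g (c *s x) = c *s g x" for x y c
      unfolding A(1) by (simp_all add: matrix_vector_right_distrib vector_scalar_commute)
    have "vector_space (ext_vec_scale emb :: 'a \<Rightarrow> 'b ^ 'm \<Rightarrow> _)" unfolding ext by (rule V.vector_space_restrict)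
    then show "Vector_Spaces.linear (ext_vec_scale emb) (ext_vec_scale emb) g"
      by (intro Vector_Spaces.linear.intro module_hom.intro module_hom_axioms.intro)
        (auto simp: add scale ext_vec_scale_def module_iff_vector_space)
    have inj: "inj g"
    proof -
      obtain A' where "A' ** A = mat 1" using A(2) unfolding invertible_def by blast
      then have "A' *v g x = x" for x unfolding A(1) by (simp add: matrix_vector_mul_assoc)
      then show ?thesis by (rule inj_on_inverseI)
    qed
    have "image_mset (image ((*) c)) ?B = ?B" if c: "c \<noteq> 0" for c
    proof -
      have "card ((*) c ` U) = card U" for U :: "'b set" using c by (intro card_image) (simp add: inj_on_def)
      then have "image_mset (image ((*) c)) ?B = {#U \<in># image_mset (image ((*) c)) B. q ^ 2 \<le> card U#}"
        by (simp add: filter_mset_image_mset)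
      then show ?thesis using singer[OF c] by (simp only:)
    qed
    then have "image_mset (image g) (V.line_blocks ?B) = V.line_blocks ?B"
      by (intro V.image_line_blocks scale inj)
    moreover have "image_mset (image g) (mset_set ?W) = mset_set ?W"
    proof -
      have injW: "inj_on (image g) ?W" using inj by (meson inj_image_eq_iff inj_onI)
      have "image g ` ?W \<subseteq> ?W" using V.typed_blocks_image[of g, OF add scale inj] by blast
      then have "image g ` ?W = ?W" using card_image[OF injW] by (intro card_subset_eq) auto
      then show ?thesis using image_mset_mset_set[OF injW] by simp
    qed
    ultimately show "image_mset (image g) ?B' = ?B'" by simp
  qed
  moreover have "simple_blocks ?B'" if simple: "simple_blocks B"
  proof -
    have "simple_blocks ?B" using simple unfolding simple_blocks_def by (simp add: le_SucI)
    moreover have "\<exists>b\<in>U. b \<noteq> 0" if "U \<in># ?B" for U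
    proof -
      have "q ^ 2 \<le> card U" using that by simp
      then show ?thesis using L.large_subspace_not_in_line[of U] by metis
    qed
    ultimately have line: "simple_blocks (V.line_blocks ?B)" by (rule V.simple_line_blocks)
    show ?thesis unfolding simple_blocks_def
    proof
      fix S
      show "count ?B' S \<le> 1"
      proof (cases "S \<in># V.line_blocks ?B")
        case True
        have "S \<notin> ?W"
        proof (rule V.line_block_not_typed[OF _ True])
          show "card U = 1 \<or> q ^ 2 < card U" if "U \<in> \<V>" for U using that by (rule sz)
          show "q ^ 2 \<le> card U" if "U \<in># ?B" for U using that by simp
        qed
        then show ?thesis using line unfolding simple_blocks_def by simp
      next
        case False
        then show ?thesis by (simp add: not_in_iff count_mset_set')
      qed
    qed
  qed
  ultimately show ?thesis by blast
qed

end
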